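(* Let $r\ge 1$. Let $E=\{e_i\}_{i=1}^N$ ($N\le\infty$) be a $1$-unconditional basic sequence in $L_1=L_1([0,1],\lambda)$ which is $r$-concave with constant $K_1$. Let $\mu$ be a probability measure on $[0,1]$ and let $X$ be a subspace of $L_1([0,1],\mu)$ such that $\|x\|_{L_r([0,1],\mu)}\le K_2\|x\|_{L_1([0,1],\mu)}$ for all $x\in X$. Then $(\sum\bigoplus X)_E$ embeds isomorphically into $L_1$, i.e. there is a linear map $T:(\sum\bigoplus X)_E\to L_1$ and constants $a,b>0$ with $b/a\le C$ such that $a\|x\|\le\|Tx\|_{L_1}\le b\|x\|$ for all $x$, where $C$ depends only on $K_1$, $K_2$ and $r$. Consequently, if $1\le r<p\le 2$ and $E=\{e_i\}$ and $F=\{f_i\}$ are two $1$-unconditional basic sequences in $L_1$ with $E$ $r$-concave with constant $K_1$ and $F$ $p$-convex with constant $K_2$, then the space $E(F)$ of matrices $A=\{a_{k,l}\}$ with norm \[ \|A\|_{E(F)}=\Big\|\sum_k \Big\|\sum_l a_{k,l}f_l\Big\|_{L_1}\,e_k\Big\|_{L_1} \] embeds isomorphically into $L_1$ with isomorphism constant depending only on $r,p,K_1$ and $K_2$.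
   Context: $L_p$ denotes $L_p([0,1],\lambda)$ with $\lambda$ Lebesgue measure. A basis/basic sequence $\{e_i\}$ (finite or infinite) is $1$-unconditional if $\|\sum_i a_ie_i\|\le\|\sum_i b_ie_i\|$ whenever $|a_i|=|b_i|$ for all $i$. For $x=\sum_j x(j)e_j$ in the span of $\{e_j\}$ and $\alpha>0$, write $|x|^\alpha=\sum_j|x(j)|^\alpha e_j$ (and similarly $(\sum_i|x_i|^\alpha)^{1/\alpha}=\sum_j(\sum_i|x_i(j)|^\alpha)^{1/\alpha}e_j$). A $1$-unconditional basic sequence $\{e_i\}$ is $p$-convex with constant $K$ if for all $n$ and all $x_1,\dots,x_n$ in its span, $\|(\sum_{i=1}^n|x_i|^p)^{1/p}\|\le K(\sum_{i=1}^n\|x_i\|^p)^{1/p}$; it is $r$-concave with constant $K$ if for all such $x_1,\dots,x_n$, $(\sum_{i=1}^n\|x_i\|^r)^{1/r}\le K\|(\sum_{i=1}^n|x_i|^r)^{1/r}\|$. For a $1$-unconditional basic sequence $E=\{e_i\}$ and a Banach space $X$, $(\sum\bigoplus X)_E$ is the space of sequences $x=(x_1,x_2,\dots)$ with $x_i\in X$ for which the norm $\|x\|=\|\sum_i\|x_i\|_X e_i\|$ is finite. *)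

theory Defs
  imports "HOL-Probability.Probability"
begin

definition L1M :: "real measure" where
  "L1M = lebesgue_on {0..1}"

definition L1in :: "(real \<Rightarrow> real) \<Rightarrow> bool" where
  "L1in f \<longleftrightarrow> integrable L1M f"

definition L1norm :: "(real \<Rightarrow> real) \<Rightarrow> real" where
  "L1norm f = integral\<^sup>L L1M (\<lambda>t. \<bar>f t\<bar>)"

definition index_set :: "nat set \<Rightarrow> bool" where
  "index_set I \<longleftrightarrow> I = UNIV \<or> (\<exists>N. I = {..<N})"

definition comb :: "(nat \<Rightarrow> real \<Rightarrow> real) \<Rightarrow> nat set \<Rightarrow> (nat \<Rightarrow> real) \<Rightarrow> real \<Rightarrow> real" where
  "comb e S c = (\<lambda>t. \<Sum>j\<in>S. c j * e j t)"

definition psum :: "(nat \<Rightarrow> real \<Rightarrow> real) \<Rightarrow> nat set \<Rightarrow> (nat \<Rightarrow> real) \<Rightarrow> nat \<Rightarrow> real \<Rightarrow> real" where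
  "psum e I c n = comb e (I \<inter> {..<n}) c"

definition series_conv :: "(nat \<Rightarrow> real \<Rightarrow> real) \<Rightarrow> nat set \<Rightarrow> (nat \<Rightarrow> real) \<Rightarrow> bool" where
  "series_conv e I c \<longleftrightarrow>
     (\<exists>g. L1in g \<and> (\<lambda>n. L1norm (\<lambda>t. psum e I c n t - g t)) \<longlonglongrightarrow> 0)"

definition series_norm :: "(nat \<Rightarrow> real \<Rightarrow> real) \<Rightarrow> nat set \<Rightarrow> (nat \<Rightarrow> real) \<Rightarrow> real" where
  "series_norm e I c = lim (\<lambda>n. L1norm (psum e I c n))"

text \<open>basic sequence (Grunblum criterion): nonzero vectors with uniformly bounded
  partial-sum projections\<close>
definition basic_seq :: "(nat \<Rightarrow> real \<Rightarrow> real) \<Rightarrow> nat set \<Rightarrow> bool" where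
  "basic_seq e I \<longleftrightarrow> index_set I \<and> (\<forall>j\<in>I. L1in (e j) \<and> L1norm (e j) > 0) \<and>
     (\<exists>K. \<forall>c m n. m \<le> n \<longrightarrow> L1norm (psum e I c m) \<le> K * L1norm (psum e I c n))"

definition one_unconditional :: "(nat \<Rightarrow> real \<Rightarrow> real) \<Rightarrow> nat set \<Rightarrow> bool" where
  "one_unconditional e I \<longleftrightarrow>
     (\<forall>S a b. finite S \<longrightarrow> S \<subseteq> I \<longrightarrow> (\<forall>j\<in>S. \<bar>a j\<bar> = \<bar>b j\<bar>) \<longrightarrow>
        L1norm (comb e S a) \<le> L1norm (comb e S b))"

definition unc_basic_seq :: "(nat \<Rightarrow> real \<Rightarrow> real) \<Rightarrow> nat set \<Rightarrow> bool" where
  "unc_basic_seq e I \<longleftrightarrow> basic_seq e I \<and> one_unconditional e I"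

text \<open>p-convexity with constant K; the vectors x_1..x_n of the (linear) span are given by
  coefficient vectors xs i (i < n) supported on a common finite S contained in I\<close>
definition p_convex :: "real \<Rightarrow> real \<Rightarrow> (nat \<Rightarrow> real \<Rightarrow> real) \<Rightarrow> nat set \<Rightarrow> bool" where
  "p_convex p K e I \<longleftrightarrow>
     (\<forall>(n::nat) S (xs :: nat \<Rightarrow> nat \<Rightarrow> real). finite S \<longrightarrow> S \<subseteq> I \<longrightarrow>
        L1norm (comb e S (\<lambda>j. (\<Sum>i<n. \<bar>xs i j\<bar> powr p) powr (1/p)))
          \<le> K * (\<Sum>i<n. L1norm (comb e S (xs i)) powr p) powr (1/p))"

definition r_concave :: "real \<Rightarrow> real \<Rightarrow> (nat \<Rightarrow> real \<Rightarrow> real) \<Rightarrow> nat set \<Rightarrow> bool" where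
  "r_concave r K e I \<longleftrightarrow>
     (\<forall>(n::nat) S (xs :: nat \<Rightarrow> nat \<Rightarrow> real). finite S \<longrightarrow> S \<subseteq> I \<longrightarrow>
        (\<Sum>i<n. L1norm (comb e S (xs i)) powr r) powr (1/r)
          \<le> K * L1norm (comb e S (\<lambda>j. (\<Sum>i<n. \<bar>xs i j\<bar> powr r) powr (1/r))))"

definition prob_on_01 :: "real measure \<Rightarrow> bool" where
  "prob_on_01 \<mu> \<longleftrightarrow> prob_space \<mu> \<and> sets \<mu> = sets (restrict_space borel {0..1::real})"

definition Lnorm1 :: "real measure \<Rightarrow> (real \<Rightarrow> real) \<Rightarrow> real" where
  "Lnorm1 \<mu> x = integral\<^sup>L \<mu> (\<lambda>t. \<bar>x t\<bar>)"

definition lin_subspace_L1 :: "real measure \<Rightarrow> (real \<Rightarrow> real) set \<Rightarrow> bool" where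
  "lin_subspace_L1 \<mu> X \<longleftrightarrow> (\<forall>x\<in>X. integrable \<mu> x) \<and> (\<lambda>t. 0) \<in> X \<and>
     (\<forall>x\<in>X. \<forall>y\<in>X. (\<lambda>t. x t + y t) \<in> X) \<and> (\<forall>c. \<forall>x\<in>X. (\<lambda>t. c * x t) \<in> X)"

definition dsum_space :: "(nat \<Rightarrow> real \<Rightarrow> real) \<Rightarrow> nat set \<Rightarrow> real measure \<Rightarrow> (real \<Rightarrow> real) set
     \<Rightarrow> (nat \<Rightarrow> real \<Rightarrow> real) set" where
  "dsum_space e I \<mu> X = {x. (\<forall>i\<in>I. x i \<in> X) \<and> (\<forall>i. i \<notin> I \<longrightarrow> x i = (\<lambda>t. 0)) \<and>
      series_conv e I (\<lambda>i. Lnorm1 \<mu> (x i))}"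

definition dsum_norm :: "(nat \<Rightarrow> real \<Rightarrow> real) \<Rightarrow> nat set \<Rightarrow> real measure \<Rightarrow> (nat \<Rightarrow> real \<Rightarrow> real) \<Rightarrow> real" where
  "dsum_norm e I \<mu> x = series_norm e I (\<lambda>i. Lnorm1 \<mu> (x i))"

definition EF_space :: "(nat \<Rightarrow> real \<Rightarrow> real) \<Rightarrow> nat set \<Rightarrow> (nat \<Rightarrow> real \<Rightarrow> real) \<Rightarrow> nat set
     \<Rightarrow> (nat \<Rightarrow> nat \<Rightarrow> real) set" where
  "EF_space e I f J = {A. (\<forall>k l. (k \<notin> I \<or> l \<notin> J) \<longrightarrow> A k l = 0) \<and>
      (\<forall>k\<in>I. series_conv f J (A k)) \<and> series_conv e I (\<lambda>k. series_norm f J (A k))}"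

definition EF_norm :: "(nat \<Rightarrow> real \<Rightarrow> real) \<Rightarrow> nat set \<Rightarrow> (nat \<Rightarrow> real \<Rightarrow> real) \<Rightarrow> nat set
     \<Rightarrow> (nat \<Rightarrow> nat \<Rightarrow> real) \<Rightarrow> real" where
  "EF_norm e I f J A = series_norm e I (\<lambda>k. series_norm f J (A k))"

end

theory Submission
  imports Defs "HOL-Library.Function_Algebras"
begin

text \<open>
  For the first part, send \<open>x\<close> to \<open>\<Sum>\<^sub>i x\<^sub>i(t) e\<^sub>i(s)\<close>, a function on the product of \<open>[0,1]\<close> with Lebesgue
  measure and \<open>([0,1], \<mu>)\<close>; this product is the image of \<open>[0,1]\<close> under a measure preserving map. The norm of the
  image is at least \<open>\<parallel>\<Sum> \<parallel>x\<^sub>i\<parallel>\<^sub>1 e\<^sub>i\<parallel>\<close> by the triangle inequality for integrals and unconditionality. It is at most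
  \<open>K\<^sub>1 \<parallel>\<Sum> \<parallel>x\<^sub>i\<parallel>\<^sub>r e\<^sub>i\<parallel>\<close> by the integral form of r-concavity.

  For the second part, it suffices to find a density \<open>d\<close> such that the \<open>L\<^sub>r(d)\<close>-norm of \<open>y/d\<close> is bounded by a
  multiple of \<open>\<parallel>y\<parallel>\<^sub>1\<close> for all \<open>y\<close> in the span of \<open>F\<close>. By Khinchine's inequality, p-convexity gives
  \<open>\<integral> max(1, \<bar>x\<^sub>1\<bar>, ..., \<bar>x\<^sub>n\<bar>) \<le> 1 + 2 K (\<Sum> \<parallel>x\<^sub>i\<parallel>\<^sup>p)\<^sup>1\<^sup>/\<^sup>p\<close>. Hence \<open>\<integral> max(1, \<bar>x\<^sub>1\<bar>, ..., \<bar>x\<^sub>n\<bar>) - \<Sum> \<parallel>x\<^sub>i\<parallel>\<^sup>p\<close> is bounded above, and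
  nearly maximizing it produces \<open>g \<ge> 1\<close> such that \<open>\<integral> max(\<bar>x\<bar>, g) \<le> \<integral> g + \<parallel>x\<parallel>\<^sup>p\<close> for all \<open>x\<close>. Applying this to
  \<open>2\<^sup>-\<^sup>k x\<close> and summing over \<open>k\<close> bounds \<open>\<integral> \<bar>x\<bar>\<^sup>r g\<^sup>1\<^sup>-\<^sup>r\<close> because \<open>r < p\<close>, so \<open>d = g / \<integral> g\<close> is as required.
\<close>

text \<open>Dividing by a positive density \<open>d\<close> is an isometry of L1 into L1 of the
  measure with density \<open>d\<close>. It turns E(F) into a direct sum of copies of the space of
  all y/d with y in the closed span of F, and the sought bound on y/d is precisely the hypothesis of
  the first claim. Convexity compares coefficients, whereas a density needs pointwise information
  about functions. Unconditionality bridges the gap: the norm of a combination is equivalent to the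
  L1 norm of its square function, and as p \<le> 2 the l2 sums are controlled by the lp sums to
  which convexity applies. In the maximization the penalty is linear in the total cost, while the
  maximal functions grow only like its power 1/p. As p > 1, the lists worth considering have bounded
  cost, so the integral of g is bounded in terms of p and K alone, which makes the final constant
  uniform. On the layer where \<bar>x\<bar>/g is about 2^k, passing to \<bar>x\<bar>^r costs 2^(kr),
  while scaling x by 2^-k gains 2^(-kp).\<close>

section \<open>Linear selections and completeness\<close>

text \<open>The embeddings must be linear on functions rather than on classes modulo null sets. Representatives
  of limits are therefore chosen linearly, along a Hamel basis.\<close>

lemma linear_selection:
  fixes s1 :: "real \<Rightarrow> 'a::ab_group_add \<Rightarrow> 'a" and s2 :: "real \<Rightarrow> 'b::ab_group_add \<Rightarrow> 'b"
  assumes vs: "vector_space s1" "vector_space s2"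
    and R0: "R 0 0"
    and Radd: "\<And>x y u v. R x u \<Longrightarrow> R y v \<Longrightarrow> R (x + y) (u + v)"
    and Rscale: "\<And>c x u. R x u \<Longrightarrow> R (s1 c x) (s2 c u)"
  shows "\<exists>T. (\<forall>x y. T (x + y) = T x + T y) \<and> (\<forall>c x. T (s1 c x) = s2 c (T x)) \<and>
    (\<forall>x. (\<exists>u. R x u) \<longrightarrow> R x (T x))"
proof -
  interpret vector_space_pair s1 s2
    using vs by (simp add: vector_space_pair_def)
  define D where "D = {x. \<exists>u. R x u}"
  \<comment> \<open>\<open>B\<close> is taken inside the domain \<open>D\<close>, so each basis
    vector has a related value. As \<open>R\<close> respects sums and multiples, the linear
    extension stays related on the whole span of \<open>B\<close>, which contains
    \<open>D\<close>.\<close>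
  obtain B where B: "B \<subseteq> D" "vs1.independent B" "D \<subseteq> vs1.span B"
    using vs1.maximal_independent_subset[of D] by metis
  define T where "T = construct B (\<lambda>b. SOME u. R b u)"
  have lin: "Vector_Spaces.linear s1 s2 T"
    unfolding T_def by (rule linear_construct) fact
  interpret T: Vector_Spaces.linear s1 s2 T by fact
  have "R x (T x)" if "x \<in> vs1.span B" for x
    using that
  proof (induction rule: vs1.span_induct_alt)
    case base
    then show ?case by (simp add: R0 T.zero)
  next
    case (step c b y)
    have "R b (T b)"
      using B(1,2) step(1) unfolding T_def D_def
      by (auto simp: construct_basis intro: someI_ex)
    then show ?case
      using step by (auto simp: T.add T.scale intro!: Radd Rscale)
  qed
  then show ?thesis
    using B(3) T.add T.scale by (intro exI[of _ T]) (auto simp: D_def)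
qed

lemma linear_selection_seq:
  fixes R :: "(nat \<Rightarrow> real) \<Rightarrow> (real \<Rightarrow> real) \<Rightarrow> bool"
  assumes R0: "R (\<lambda>i. 0) (\<lambda>t. 0)"
    and Radd: "\<And>x y u v. R x u \<Longrightarrow> R y v \<Longrightarrow> R (\<lambda>i. x i + y i) (\<lambda>t. u t + v t)"
    and Rscale: "\<And>c x u. R x u \<Longrightarrow> R (\<lambda>i. c * x i) (\<lambda>t. c * u t)"
  obtains T where "\<And>x y. T (\<lambda>i. x i + y i) = (\<lambda>t. T x t + T y t)"
    "\<And>c x. T (\<lambda>i. c * x i) = (\<lambda>t. c * T x t)" "\<And>x u. R x u \<Longrightarrow> R x (T x)"
proof -
  have "\<exists>T. (\<forall>x y. T (x + y) = T x + T y) \<and> (\<forall>c x. T (\<lambda>i. c * x i) = (\<lambda>t. c * T x t)) \<and>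
    (\<forall>x. (\<exists>u. R x u) \<longrightarrow> R x (T x))"
    by (rule linear_selection[where ?s1.0 = "\<lambda>c x i. c * x i" and ?s2.0 = "\<lambda>c x i. c * x i"])
      (unfold_locales, auto simp: fun_eq_iff algebra_simps plus_fun_def zero_fun_def assms)
  then show ?thesis using that unfolding plus_fun_def by blast
qed

lemma linear_selection_fun_seq:
  fixes R :: "(nat \<Rightarrow> real \<Rightarrow> real) \<Rightarrow> (real \<Rightarrow> real) \<Rightarrow> bool"
  assumes R0: "R (\<lambda>i t. 0) (\<lambda>t. 0)"
    and Radd: "\<And>x y u v. R x u \<Longrightarrow> R y v \<Longrightarrow> R (\<lambda>i t. x i t + y i t) (\<lambda>t. u t + v t)"
    and Rscale: "\<And>c x u. R x u \<Longrightarrow> R (\<lambda>i t. c * x i t) (\<lambda>t. c * u t)"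
  obtains T where "\<And>x y. T (\<lambda>i t. x i t + y i t) = (\<lambda>t. T x t + T y t)"
    "\<And>c x. T (\<lambda>i t. c * x i t) = (\<lambda>t. c * T x t)" "\<And>x u. R x u \<Longrightarrow> R x (T x)"
proof -
  have "\<exists>T. (\<forall>x y. T (x + y) = T x + T y) \<and> (\<forall>c x. T (\<lambda>i t. c * x i t) = (\<lambda>t. c * T x t)) \<and>
    (\<forall>x. (\<exists>u. R x u) \<longrightarrow> R x (T x))"
    by (rule linear_selection[where ?s1.0 = "\<lambda>c x i t. c * x i t" and ?s2.0 = "\<lambda>c x i. c * x i"])
      (unfold_locales, auto simp: fun_eq_iff algebra_simps plus_fun_def zero_fun_def assms)
  then show ?thesis using that unfolding plus_fun_def by blast
qed

section \<open>Lebesgue measure on the unit interval with Borel and with completed sets\<close>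

definition L1B :: "real measure" where
  "L1B = restrict_space lborel {0..1}"

lemma space_L1B [simp]: "space L1B = {0..1}"
  and space_L1M [simp]: "space L1M = {0..1}"
  and sets_L1B: "sets L1B = sets (restrict_space borel {0..1})"
  by (simp_all add: L1B_def L1M_def space_restrict_space sets_restrict_space)

lemma prob_space_L1B: "prob_space L1B"
  by (rule prob_spaceI) (simp add: L1B_def emeasure_restrict_space)

lemma prob_space_L1M: "prob_space L1M"
  by (rule prob_spaceI) (simp add: L1M_def emeasure_restrict_space)

lemma borel_measurable_L1B [measurable (raw)]:
  "f \<in> borel_measurable borel \<Longrightarrow> f \<in> borel_measurable L1B"
  unfolding L1B_def by (intro measurable_restrict_space1) simp

lemma measurable_L1B_ext:
  assumes "(f :: real \<Rightarrow> real) \<in> borel_measurable L1B"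
  shows "(\<lambda>t. indicator {0..1} t * f t) \<in> borel_measurable borel"
  using assms unfolding L1B_def by (subst (asm) borel_measurable_restrict_space_iff) auto

lemma measurable_L1M_if_L1B:
  assumes "(f :: real \<Rightarrow> real) \<in> borel_measurable L1B" shows "f \<in> borel_measurable L1M"
proof -
  have "(\<lambda>t. indicator {0..1} t * f t) \<in> borel_measurable lebesgue"
    using measurable_L1B_ext[OF assms] by (simp add: borel_measurable_if_lebesgue_on measurable_completion)
  then show ?thesis
    unfolding L1M_def by (subst borel_measurable_restrict_space_iff) (auto )
qed

lemma
  assumes f: "(f :: real \<Rightarrow> real) \<in> borel_measurable L1B"
  shows integrable_L1M_iff: "integrable L1M f \<longleftrightarrow> integrable L1B f"
    and integral_L1M_eq: "integral\<^sup>L L1M f = integral\<^sup>L L1B f"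
proof -
  have m: "(\<lambda>t. indicator {0..1} t * f t) \<in> borel_measurable lborel"
    using measurable_L1B_ext[OF f] by simp
  show "integrable L1M f \<longleftrightarrow> integrable L1B f"
    using m by (simp add: L1M_def L1B_def integrable_restrict_space integrable_completion)
  show "integral\<^sup>L L1M f = integral\<^sup>L L1B f"
    using m by (simp add: L1M_def L1B_def integral_restrict_space integral_completion)
qed

text \<open>Products, image measures and compositions are formed with the Borel measure
  \<open>L1B\<close>, while the norm refers to the completed \<open>L1M\<close>. Replacing a
  function on a null set passes from the latter to the former.\<close>

lemma borel_version:
  assumes "(f :: real \<Rightarrow> real) \<in> borel_measurable L1M"
  obtains g where "g \<in> borel_measurable borel" "AE t in L1M. g t = f t"
proof -
  have "(\<lambda>t. indicator {0..1} t * f t) \<in> borel_measurable lebesgue"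
    using assms unfolding L1M_def by (subst (asm) borel_measurable_restrict_space_iff) auto
  from completion_ex_borel_measurable_real[OF this] obtain g where
    g: "g \<in> borel_measurable borel" "AE t in lborel. indicator {0..1} t * f t = g t" by auto
  have "AE t in lebesgue. indicator {0..1} t * f t = g t"
    using g(2) by (rule AE_completion)
  then have "AE t in L1M. g t = f t"
    unfolding L1M_def by (subst AE_restrict_space_iff) (auto elim!: eventually_mono)
  with g(1) show ?thesis using that by blast
qed

lemma L1norm_cong_AE:
  assumes "f \<in> borel_measurable L1M" "g \<in> borel_measurable L1M" "AE t in L1M. f t = g t"
  shows "L1norm f = L1norm g"
  unfolding L1norm_def using assms by (intro integral_cong_AE) (auto elim: eventually_mono)

lemma L1norm_nonneg [simp]: "0 \<le> L1norm f"
  by (simp add: L1norm_def)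

lemma L1norm_zero [simp]: "L1norm (\<lambda>t. 0) = 0"
  by (simp add: L1norm_def)

lemma L1norm_scale: "L1norm (\<lambda>t. c * f t) = \<bar>c\<bar> * L1norm f"
  by (simp add: L1norm_def abs_mult)

lemma L1norm_triangle:
  assumes "L1in f" "L1in g" shows "L1norm (\<lambda>t. f t + g t) \<le> L1norm f + L1norm g"
proof -
  have "L1norm (\<lambda>t. f t + g t) \<le> (\<integral>t. \<bar>f t\<bar> + \<bar>g t\<bar> \<partial>L1M)"
    using assms unfolding L1norm_def L1in_def by (intro integral_mono) auto
  then show ?thesis using assms by (simp add: L1norm_def L1in_def)
qed

lemma L1norm_triangle_diff:
  assumes "L1in f" "L1in g" "L1in h"
  shows "L1norm (\<lambda>t. f t - h t) \<le> L1norm (\<lambda>t. f t - g t) + L1norm (\<lambda>t. g t - h t)"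
  using L1norm_triangle[of "\<lambda>t. f t - g t" "\<lambda>t. g t - h t"] assms by (simp add: L1in_def)

lemma L1norm_minus_commute: "L1norm (\<lambda>t. f t - g t) = L1norm (\<lambda>t. g t - f t)"
  by (simp add: L1norm_def abs_minus_commute)

lemma L1norm_diff_abs:
  assumes "L1in f" "L1in g" shows "\<bar>L1norm f - L1norm g\<bar> \<le> L1norm (\<lambda>t. f t - g t)"
  using L1norm_triangle[of "\<lambda>t. f t - g t" g] L1norm_triangle[of "\<lambda>t. g t - f t" f] assms
    L1norm_minus_commute[of f g] by (simp add: L1in_def)

lemma L1norm_tendsto:
  assumes "\<And>n. L1in (f n)" "L1in g" "(\<lambda>n. L1norm (\<lambda>t. f n t - g t)) \<longlonglongrightarrow> 0"
  shows "(\<lambda>n. L1norm (f n)) \<longlonglongrightarrow> L1norm g"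
  using assms(3) L1norm_diff_abs[OF assms(1,2)]
  by (subst LIM_zero_iff[symmetric], intro Lim_null_comparison[OF _ assms(3)]) simp

text \<open>A subsequence converges almost everywhere, and Fatou's lemma turns the Cauchy bounds
  into bounds on the distance to its pointwise limit. A Borel version is returned because limits are
  later composed with \<open>L1B\<close> and its densities.\<close>

lemma L1_complete:
  assumes f: "\<And>n. L1in (f n)"
    and C: "\<And>\<epsilon>. \<epsilon> > 0 \<Longrightarrow> \<exists>N. \<forall>m\<ge>N. \<forall>n\<ge>m. L1norm (\<lambda>t. f m t - f n t) < \<epsilon>"
  obtains g where "g \<in> borel_measurable borel" "L1in g" "(\<lambda>n. L1norm (\<lambda>t. f n t - g t)) \<longlonglongrightarrow> 0"
proof -
  have fi [simp, measurable]: "integrable L1M (f n)" for n using f by (simp add: L1in_def)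
  then have fm [measurable]: "f n \<in> borel_measurable L1M" for n by auto
  have C': "\<exists>N. \<forall>i\<ge>N. \<forall>j\<ge>N. LINT x|L1M. norm (f i x - f j x) < \<epsilon>" if "\<epsilon> > 0" for \<epsilon>
  proof -
    obtain N where N: "\<forall>m\<ge>N. \<forall>n\<ge>m. L1norm (\<lambda>t. f m t - f n t) < \<epsilon>" using C[OF \<open>\<epsilon> > 0\<close>] by blast
    have "L1norm (\<lambda>t. f i t - f j t) < \<epsilon>" if "i \<ge> N" "j \<ge> N" for i j
    proof (cases "i \<le> j")
      case True
      then show ?thesis using N that by simp
    next
      case False
      then show ?thesis
        using N that by (subst L1norm_minus_commute) simp
    qed
    then show ?thesis by (auto simp: L1norm_def)
  qed
  obtain r where r: "strict_mono r" "AE x in L1M. Cauchy (\<lambda>i. f (r i) x)"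
    using cauchy_L1_AE_cauchy_subseq[of L1M f, OF fi C'] by metis
  define h where "h x = lim (\<lambda>i. f (r i) x)" for x
  have hm [measurable]: "h \<in> borel_measurable L1M" unfolding h_def by measurable
  have conv: "AE x in L1M. (\<lambda>i. f (r i) x) \<longlonglongrightarrow> h x"
    using r(2) by eventually_elim (auto simp: h_def Cauchy_convergent_iff convergent_LIMSEQ_iff)
  \<comment> \<open>The index \<open>m\<close> is fixed while the limit runs along the subsequence,
    so the bound reaches every late \<open>f m\<close> and not only the members of the
    subsequence.\<close>
  have key: "(\<integral>\<^sup>+x. norm (f m x - h x) \<partial>L1M) \<le> ennreal \<epsilon>"
    if N: "\<forall>k\<ge>N. \<forall>n\<ge>k. L1norm (\<lambda>t. f k t - f n t) < \<epsilon>" "m \<ge> N" and e: "\<epsilon> > 0" for m N \<epsilon>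
  proof -
    have "(\<integral>\<^sup>+x. norm (f m x - h x) \<partial>L1M) = (\<integral>\<^sup>+x. liminf (\<lambda>i. ennreal (norm (f m x - f (r i) x))) \<partial>L1M)"
    proof (rule nn_integral_cong_AE, use conv in eventually_elim)
      fix x assume "(\<lambda>i. f (r i) x) \<longlonglongrightarrow> h x"
      then have "(\<lambda>i. ennreal (norm (f m x - f (r i) x))) \<longlonglongrightarrow> ennreal (norm (f m x - h x))"
        by (intro tendsto_intros)
      then show "ennreal (norm (f m x - h x)) = liminf (\<lambda>i. ennreal (norm (f m x - f (r i) x)))"
        by (intro lim_imp_Liminf[symmetric] trivial_limit_sequentially)
    qed
    also have "\<dots> \<le> liminf (\<lambda>i. \<integral>\<^sup>+x. ennreal (norm (f m x - f (r i) x)) \<partial>L1M)"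
      by (rule nn_integral_liminf) measurable
    also have "\<dots> \<le> ennreal \<epsilon>"
    proof (rule Liminf_le)
      show "sequentially \<noteq> bot" by simp
      show "\<forall>\<^sub>F i in sequentially. (\<integral>\<^sup>+x. ennreal (norm (f m x - f (r i) x)) \<partial>L1M) \<le> ennreal \<epsilon>"
        using eventually_ge_at_top[of m]
      proof eventually_elim
        case (elim i)
        then have "r i \<ge> m" using seq_suble[OF r(1), of i] by simp
        then have "L1norm (\<lambda>t. f m t - f (r i) t) < \<epsilon>" using N by auto
        then show ?case
          by (subst nn_integral_eq_integral) (auto simp: L1norm_def intro!: ennreal_leI)
      qed
    qed
    finally show ?thesis .
  qed
  obtain N where "\<forall>k\<ge>N. \<forall>n\<ge>k. L1norm (\<lambda>t. f k t - f n t) < 1" using C[of 1] by auto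
  from key[OF this order_refl] have "(\<integral>\<^sup>+x. norm (f N x - h x) \<partial>L1M) \<le> 1" by simp
  then have "integrable L1M (\<lambda>x. f N x - h x)"
    by (intro integrableI_bounded) (auto simp: order_le_less_trans[OF _ ennreal_one_less_top])
  from Bochner_Integration.integrable_diff[OF fi[of N] this] have hi: "integrable L1M h" by simp
  obtain g where g: "g \<in> borel_measurable borel" "AE t in L1M. g t = h t"
    using borel_version[OF hm] by blast
  have gm [measurable]: "g \<in> borel_measurable L1M"
    using g(1) borel_measurable_L1B measurable_L1M_if_L1B by blast
  have gi: "integrable L1M g"
    using hi g(2) by (subst integrable_cong_AE[of _ _ h]) auto
  have "(\<lambda>n. L1norm (\<lambda>t. f n t - g t)) \<longlonglongrightarrow> 0"
  proof (rule LIMSEQ_I)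
    fix \<epsilon> :: real assume "\<epsilon> > 0"
    then obtain N where N: "\<forall>k\<ge>N. \<forall>n\<ge>k. L1norm (\<lambda>t. f k t - f n t) < \<epsilon>/2" using C[of "\<epsilon>/2"] by auto
    have "L1norm (\<lambda>t. f n t - g t) < \<epsilon>" if "n \<ge> N" for n
    proof -
      have "L1norm (\<lambda>t. f n t - g t) = L1norm (\<lambda>t. f n t - h t)"
        using g(2) by (intro L1norm_cong_AE) auto
      also have "\<dots> \<le> \<epsilon>/2"
      proof -
        have "(\<integral>\<^sup>+x. norm (f n x - h x) \<partial>L1M) = ennreal (L1norm (\<lambda>t. f n t - h t))"
          using hi by (subst nn_integral_eq_integral) (auto simp: L1norm_def)
        then show ?thesis using key[OF N that] \<open>\<epsilon> > 0\<close> by simp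
      qed
      finally show ?thesis using \<open>\<epsilon> > 0\<close> by simp
    qed
    then show "\<exists>N. \<forall>n\<ge>N. norm (L1norm (\<lambda>t. f n t - g t) - 0) < \<epsilon>" by auto
  qed
  with g(1) gi show ?thesis using that by (auto simp: L1in_def)
qed

section \<open>A measure preserving map onto the square\<close>

definition ternary :: "(nat \<Rightarrow> real) \<Rightarrow> real" where
  "ternary b = (\<Sum>k. b k * (1/3) ^ Suc k)"

text \<open>The base 3 digit of weight \<open>(1/3) ^ Suc m\<close>, with the same indexing as in
  \<open>ternary\<close>.\<close>

definition tdigit :: "nat \<Rightarrow> real \<Rightarrow> real" where
  "tdigit m z = of_int \<lfloor>3 ^ Suc m * z\<rfloor> - 3 * of_int \<lfloor>3 ^ m * z\<rfloor>"

lemma tdigit_bounds: "0 \<le> tdigit m z" "tdigit m z \<le> 2"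
proof -
  define x where "x = 3 ^ m * z"
  have *: "3 ^ Suc m * z = 3 * x" by (simp add: x_def)
  have "3 * \<lfloor>x\<rfloor> \<le> \<lfloor>3 * x\<rfloor>" "\<lfloor>3 * x\<rfloor> \<le> 3 * \<lfloor>x\<rfloor> + 2" by linarith+
  then have "real_of_int (3 * \<lfloor>x\<rfloor>) \<le> real_of_int \<lfloor>3 * x\<rfloor>"
    "real_of_int \<lfloor>3 * x\<rfloor> \<le> real_of_int (3 * \<lfloor>x\<rfloor> + 2)" unfolding of_int_le_iff .
  then show "0 \<le> tdigit m z" "tdigit m z \<le> 2"
    unfolding tdigit_def * x_def[symmetric] by simp_all
qed

text \<open>The tail \<open>t m\<close> of the expansion satisfies
  \<open>3 * t m = b m + t (Suc m)\<close>, so \<open>3 ^ m * t 0\<close> is an integer plus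
  \<open>t m\<close>. Digits at most 1 keep every tail at most 1/2, so floors remove it exactly;
  with the digit 2 a tail could reach 1.\<close>

lemma tdigit_ternary:
  assumes b: "\<And>k. b k \<in> {0, 1}"
  shows "tdigit m (ternary b) = b m"
proof -
  have geo: "(\<lambda>k. (1/3) ^ Suc k :: real) sums (1/2)"
    using geometric_sums[of "1/3 :: real"] sums_mult[of "\<lambda>k. (1/3)^k :: real" "3/2" "1/3"] by simp
  have b01: "0 \<le> b k" "b k \<le> 1" for k using b[of k] by auto
  define t where "t m = ternary (\<lambda>k. b (k + m))" for m
  have summ: "summable (\<lambda>k. b (k + m) * (1/3) ^ Suc k)" for m
    by (rule summable_comparison_test[OF _ sums_summable[OF geo]])
      (intro exI[of _ 0], simp add: b01 abs_mult mult_left_le_one_le)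
  have step: "3 * t m = b m + t (Suc m)" for m
  proof -
    have "t (Suc m) / 3 = (\<Sum>k. b (Suc k + m) * (1/3) ^ Suc (Suc k))"
      unfolding t_def ternary_def
      by (subst suminf_divide[OF summ, symmetric]) (simp add: field_simps)
    also have "\<dots> = t m - b m / 3"
      unfolding t_def ternary_def by (subst suminf_split_head[OF summ]) simp
    finally show ?thesis by simp
  qed
  have t0: "0 \<le> t m" for m
    unfolding t_def ternary_def by (intro suminf_nonneg summ) (simp add: b01)
  have t1: "t m < 1" for m
  proof -
    have "t m \<le> (\<Sum>k. (1/3) ^ Suc k)"
      unfolding t_def ternary_def
      by (intro suminf_le summ sums_summable[OF geo]) (auto intro!: mult_left_le_one_le simp: b01)
    then show ?thesis using sums_unique[OF geo] by simp
  qed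
  have "\<exists>N. 3 ^ m * t 0 = of_int N + t m"
  proof (induction m)
    case 0
    show ?case by (intro exI[of _ 0]) simp
  next
    case (Suc m)
    then obtain N where N: "3 ^ m * t 0 = of_int N + t m" by blast
    have "3 ^ Suc m * t 0 = 3 * of_int N + (b m + t (Suc m))"
      using N step[of m] by simp
    then have "3 ^ Suc m * t 0 = of_int (3 * N + \<lfloor>b m\<rfloor>) + t (Suc m)"
      using b[of m] by auto
    then show ?case by blast
  qed
  then obtain N where N: "3 ^ m * t 0 = of_int N + t m" by blast
  then have N': "3 ^ Suc m * t 0 = of_int (3 * N + \<lfloor>b m\<rfloor>) + t (Suc m)"
    using step[of m] b[of m] by auto
  have "\<lfloor>3 ^ m * t 0\<rfloor> = N" unfolding N using t0[of m] t1[of m] by linarith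
  moreover have "\<lfloor>3 ^ Suc m * t 0\<rfloor> = 3 * N + \<lfloor>b m\<rfloor>"
    unfolding N' using t0[of "Suc m"] t1[of "Suc m"] by linarith
  ultimately have "tdigit m (t 0) = b m"
    unfolding tdigit_def using b[of m] by auto
  then show ?thesis by (simp add: t_def)
qed

section \<open>Rational cuts and the coding of the square\<close>

definition rat01 :: "nat \<Rightarrow> real" where
  "rat01 = from_nat_into (\<rat> \<inter> {0..1})"

lemma range_rat01: "range rat01 = \<rat> \<inter> {0..1}"
proof -
  have "0 \<in> \<rat> \<inter> {0..1::real}" by simp
  then have "\<rat> \<inter> {0..1::real} \<noteq> {}" by blast
  then show ?thesis
    unfolding rat01_def by (rule range_from_nat_into) (intro countable_Int1 countable_rat)
qed

lemma rat01_bounds: "0 \<le> rat01 k" "rat01 k \<le> 1"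
proof -
  have "rat01 k \<in> \<rat> \<inter> {0..1}" unfolding range_rat01[symmetric] by (rule rangeI)
  then show "0 \<le> rat01 k" "rat01 k \<le> 1" by simp_all
qed

text \<open>The term is the rational itself when it lies below \<open>s\<close> and 0 otherwise, so
  density of the rationals recovers \<open>s\<close>. The value 0 for the other rationals is
  harmless because \<open>s\<close> is nonnegative.\<close>

lemma SUP_rat01:
  assumes s: "s \<in> {0..1}"
  shows "(SUP k. rat01 k * indicator {rat01 k<..} s) = s"
proof -
  define h where "h k = rat01 k * indicator {rat01 k<..} s" for k
  have le: "h k \<le> s" for k
    using s rat01_bounds[of k] by (cases "rat01 k < s") (simp_all add: h_def)
  have nonneg: "0 \<le> h k" for k using rat01_bounds[of k] by (simp add: h_def)
  have bdd: "bdd_above (range h)"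
    using le by (rule bdd_aboveI2)
  have "s \<le> (SUP k. h k)"
  proof (rule dense_le)
    fix y assume "y < s"
    show "y \<le> (SUP k. h k)"
    proof (cases "y < 0")
      case True
      then have "y \<le> h 0" using nonneg[of 0] by linarith
      then show ?thesis by (rule cSUP_upper2[OF bdd UNIV_I])
    next
      case False
      obtain q where q: "q \<in> \<rat>" "y < q" "q < s" using Rats_dense_in_real[OF \<open>y < s\<close>] by blast
      have "q \<in> range rat01" unfolding range_rat01 using q False s by simp
      then obtain k where k: "q = rat01 k" by blast
      have "h k = q" using q(3) by (simp add: h_def k)
      then have "y \<le> h k" using q(2) by linarith
      then show ?thesis by (rule cSUP_upper2[OF bdd UNIV_I])
    qed
  qed
  moreover have "(SUP k. h k) \<le> s" by (rule cSUP_least) (simp_all add: le)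
  ultimately show ?thesis by (simp add: h_def)
qed

text \<open>A point of the unit square is encoded by its rational cuts, interleaved as ternary digits.
  Only the digits 0 and 1 occur, so the expansion is unique and can be decoded measurably.\<close>

definition pair_code :: "real \<times> real \<Rightarrow> real" where
  "pair_code x = ternary (\<lambda>k. if even k then indicator {rat01 (k div 2)<..} (fst x)
                              else indicator {rat01 (k div 2)<..} (snd x))"

text \<open>Forces decoding into the unit interval even at arguments that are not codes, so that
  decoding is a measurable map into spaces carried by that interval.\<close>

definition clamp01 :: "real \<Rightarrow> real" where "clamp01 x = max 0 (min 1 x)"

definition decode :: "nat \<Rightarrow> real \<Rightarrow> real" where
  "decode i z = clamp01 (SUP k. rat01 k * tdigit (2 * k + i) z)"

lemma decode_pair_code:
  assumes "s \<in> {0..1}" "t \<in> {0..1}"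
  shows "decode 0 (pair_code (s, t)) = s" "decode 1 (pair_code (s, t)) = t"
proof -
  have d: "tdigit k (pair_code (s, t)) =
      (if even k then indicator {rat01 (k div 2)<..} s else indicator {rat01 (k div 2)<..} t)" for k
    unfolding pair_code_def by (subst tdigit_ternary) (auto simp: indicator_def)
  show "decode 0 (pair_code (s, t)) = s" "decode 1 (pair_code (s, t)) = t"
    using assms unfolding decode_def d by (auto simp: SUP_rat01 clamp01_def)
qed

lemma pair_code_measurable [measurable]: "pair_code \<in> borel_measurable (borel \<Otimes>\<^sub>M borel)"
  unfolding pair_code_def ternary_def by measurable

lemma decode_measurable [measurable]: "decode i \<in> borel_measurable borel"
proof -
  have "(\<lambda>z. rat01 k * tdigit (2 * k + i) z) \<in> borel_measurable borel" for k
    unfolding tdigit_def by measurable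
  moreover have "bdd_above (range (\<lambda>k. rat01 k * tdigit (2 * k + i) z))" for z
    using mult_mono[OF rat01_bounds(2) tdigit_bounds(2)] rat01_bounds tdigit_bounds
    by (intro bdd_aboveI[of _ "1 * 2"]) auto
  ultimately have "(\<lambda>z. SUP k. rat01 k * tdigit (2 * k + i) z) \<in> borel_measurable borel"
    by (intro borel_measurable_cSUP) auto
  then show ?thesis unfolding decode_def clamp01_def by measurable
qed

lemma decode_range: "decode i z \<in> {0..1}"
  by (auto simp: decode_def clamp01_def)

text \<open>Inverse transform sampling: the pseudo-inverse \<open>I\<close> of the distribution
  function carries the uniform law to \<open>\<nu>\<close>. It lives on the open interval; extending
  it by 0 changes it only at two endpoints of measure zero, as far as \<open>L1B\<close> is
  concerned.\<close>

lemma quantile_on_01: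
  assumes "real_distribution \<nu>"
  obtains J where "J \<in> borel_measurable borel" "distr L1B borel J = \<nu>"
proof -
  interpret real_distribution \<nu> by fact
  interpret cdf_distribution \<nu> by unfold_locales
  define J where "J t = indicator {0<..<1} t * I t" for t :: real
  have J [measurable]: "J \<in> borel_measurable borel"
    using measurable_CI unfolding J_def
    by (subst (asm) borel_measurable_restrict_space_iff) auto
  have "distr L1B borel J = distr (restrict_space lborel {0<..<1::real}) borel I"
  proof (rule measure_eqI)
    fix A assume "A \<in> sets (distr L1B borel J)"
    then have A [measurable]: "A \<in> sets borel" by simp
    have [measurable]: "J \<in> borel_measurable L1B" by (rule borel_measurable_L1B) measurable
    have m: "I \<in> borel_measurable (restrict_space lborel {0<..<1::real})"
      using measurable_CI
      by (simp only: measurable_cong_sets[OF sets_restrict_space_cong[OF sets_lborel] refl])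
    have eq: "I -` A \<inter> {0<..<1} = J -` A \<inter> {0<..<1}" by (auto simp: J_def)
    have "emeasure (distr L1B borel J) A = emeasure L1B (J -` A \<inter> {0..1})"
      by (subst emeasure_distr) auto
    also have "\<dots> = emeasure lborel (J -` A \<inter> {0..1})"
      unfolding L1B_def by (subst emeasure_restrict_space) auto
    also have "\<dots> = emeasure lborel (J -` A \<inter> {0<..<1})"
    proof (rule emeasure_eq_AE)
      show "AE x in lborel. (x \<in> J -` A \<inter> {0..1}) = (x \<in> J -` A \<inter> {0<..<1})"
        using AE_lborel_singleton[of 0] AE_lborel_singleton[of 1] by eventually_elim auto
      show "J -` A \<inter> {0..1} \<in> sets lborel" "J -` A \<inter> {0<..<1} \<in> sets lborel"
        using measurable_sets[OF J A] by auto
    qed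
    also have "\<dots> = emeasure (restrict_space lborel {0<..<1}) (I -` A \<inter> {0<..<1})"
      unfolding eq by (subst emeasure_restrict_space) auto
    also have "\<dots> = emeasure (distr (restrict_space lborel {0<..<1}) borel I) A"
      by (subst emeasure_distr[OF m A]) (simp add: space_restrict_space)
    finally show "emeasure (distr L1B borel J) A
        = emeasure (distr (restrict_space lborel {0<..<1}) borel I) A" .
  qed simp
  then show ?thesis using distr_I_eq_M by (intro that[OF J]) simp
qed

lemma space_prob_on_01: "prob_on_01 \<mu> \<Longrightarrow> space \<mu> = {0..1}"
  unfolding prob_on_01_def
  using sets_eq_imp_space_eq[of \<mu> "restrict_space borel {0..1}"] by (simp add: space_restrict_space)

text \<open>The law of the code of a random point of the product is a distribution on the line,
  hence samplable from one uniform variable. Decoding the sample gives back a pair with the product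
  law.\<close>

lemma sampling:
  assumes \<mu>: "prob_on_01 \<mu>"
  obtains U V where "U \<in> measurable L1B L1B" "V \<in> measurable L1B \<mu>"
    "distr L1B (L1B \<Otimes>\<^sub>M \<mu>) (\<lambda>\<tau>. (U \<tau>, V \<tau>)) = L1B \<Otimes>\<^sub>M \<mu>"
proof -
  interpret L: prob_space L1B by (rule prob_space_L1B)
  interpret M: prob_space \<mu> using \<mu> by (simp add: prob_on_01_def)
  interpret P: pair_prob_space L1B \<mu> ..
  note sp = space_prob_on_01[OF \<mu>]
  have sets\<mu>: "sets \<mu> = sets (restrict_space borel {0..1})" using \<mu> by (simp add: prob_on_01_def)
  have into: "f \<in> measurable M N"
    if "f \<in> measurable M borel" "\<And>x. f x \<in> {0..1}" "sets N = sets (restrict_space borel {0..1::real})"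
    for f :: "'c \<Rightarrow> real" and M N
    using that by (subst measurable_cong_sets[OF refl that(3)], intro measurable_restrict_space2) auto
  have id1: "(\<lambda>x. x) \<in> measurable L1B borel" by measurable
  have id2: "(\<lambda>x. x) \<in> measurable \<mu> borel"
    by (subst measurable_cong_sets[OF sets\<mu> refl], intro measurable_restrict_space1) simp
  have code: "pair_code \<in> borel_measurable (L1B \<Otimes>\<^sub>M \<mu>)"
  proof -
    have "(\<lambda>x. (fst x, snd x)) \<in> measurable (L1B \<Otimes>\<^sub>M \<mu>) (borel \<Otimes>\<^sub>M borel)"
      by (intro measurable_Pair measurable_compose[OF measurable_fst id1] measurable_compose[OF measurable_snd id2])
    from measurable_compose[OF this pair_code_measurable] show ?thesis by simp
  qed
  define \<nu> where "\<nu> = distr (L1B \<Otimes>\<^sub>M \<mu>) borel pair_code"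
  have "real_distribution \<nu>"
    unfolding \<nu>_def by (rule P.real_distribution_distr[OF code])
  then obtain J where J: "J \<in> borel_measurable borel" "distr L1B borel J = \<nu>"
    by (rule quantile_on_01)
  have J' [measurable]: "J \<in> borel_measurable L1B" using J(1) by (rule borel_measurable_L1B)
  have d0: "decode 0 \<in> measurable borel L1B" and d1: "decode 1 \<in> measurable borel \<mu>"
    by (rule into[OF decode_measurable decode_range sets_L1B])
      (rule into[OF decode_measurable decode_range sets\<mu>])
  then have d [measurable]: "(\<lambda>z. (decode 0 z, decode 1 z)) \<in> measurable borel (L1B \<Otimes>\<^sub>M \<mu>)"
    by (rule measurable_Pair)
  have "distr L1B (L1B \<Otimes>\<^sub>M \<mu>) (\<lambda>\<tau>. (decode 0 (J \<tau>), decode 1 (J \<tau>)))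
      = distr (distr L1B borel J) (L1B \<Otimes>\<^sub>M \<mu>) (\<lambda>z. (decode 0 z, decode 1 z))"
    by (simp only: distr_distr[OF d J'] comp_def)
  also have "\<dots> = distr (L1B \<Otimes>\<^sub>M \<mu>) (L1B \<Otimes>\<^sub>M \<mu>) (\<lambda>x. (decode 0 (pair_code x), decode 1 (pair_code x)))"
    unfolding J(2) \<nu>_def by (simp only: distr_distr[OF d code] comp_def)
  also have "\<dots> = distr (L1B \<Otimes>\<^sub>M \<mu>) (L1B \<Otimes>\<^sub>M \<mu>) (\<lambda>x. x)"
    by (rule distr_cong[OF refl refl]) (clarsimp simp: space_pair_measure sp decode_pair_code[simplified])
  also have "\<dots> = L1B \<Otimes>\<^sub>M \<mu>" by (rule distr_id)
  finally show ?thesis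
    by (rule that[OF measurable_compose[OF J' d0] measurable_compose[OF J' d1]])
qed

section \<open>Unconditional sequences and integral concavity\<close>

lemma Bernoulli_powr:
  fixes x r :: real
  assumes "0 \<le> x" "1 \<le> r"
  shows "1 + r * (x - 1) \<le> x powr r"
proof (cases "r = 1")
  case False
  then have r: "r > 1" using assms by simp
  \<comment> \<open>With the conjugate exponent \<open>q\<close>, Young's inequality for the product
    of \<open>x\<close> and 1 is the tangent line inequality at 1, up to the factor
    \<open>r\<close>.\<close>
  define q where "q = r / (r - 1)"
  have q: "q > 1" "1 / r + 1 / q = 1" using r by (auto simp: q_def field_simps)
  from Youngs_inequality[OF r q assms(1), of 1] have "x \<le> x powr r / r + 1 / q" by simp
  moreover have "1 / q = 1 - 1 / r" using q by simp
  ultimately have "r * x \<le> r * (x powr r / r + (1 - 1 / r))" using r by (intro mult_left_mono) auto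
  also have "\<dots> = x powr r + r - 1" using r by (simp add: field_simps)
  finally show ?thesis by (simp add: algebra_simps)
qed (use assms in simp)

lemma le_one_plus_powr:
  fixes x r :: real
  assumes "0 \<le> x" "1 \<le> r"
  shows "x \<le> 1 + x powr r"
proof (cases "x \<le> 1")
  case False
  then have "x powr 1 \<le> x powr r" using assms by (intro powr_mono) auto
  then show ?thesis using False by simp
qed (simp add: add_increasing2)

text \<open>Jensen's inequality through its supporting line: Bernoulli's inequality at
  \<open>f x / m\<close>, where \<open>m\<close> is the mean, has an affine left side whose
  expectation is \<open>m powr r\<close> after rescaling.\<close>

lemma (in prob_space) power_mean:
  fixes f :: "'a \<Rightarrow> real"
  assumes f: "integrable M f" "\<And>x. 0 \<le> f x" and fr: "integrable M (\<lambda>x. f x powr r)" and r: "1 \<le> r"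
  shows "expectation f \<le> (expectation (\<lambda>x. f x powr r)) powr (1 / r)"
proof (cases "expectation f = 0")
  case False
  define m where "m = expectation f"
  have m: "m > 0" using False f(2) Bochner_Integration.integral_nonneg[of M f] by (simp add: m_def order_less_le)
  have i: "integrable M (\<lambda>x. m powr r * (1 + r * (f x / m - 1)))"
    using f(1) by auto
  have pw: "m powr r * (1 + r * (f x / m - 1)) \<le> f x powr r" for x
  proof -
    have "m powr r * (1 + r * (f x / m - 1)) \<le> m powr r * (f x / m) powr r"
      using m f(2)[of x] r by (intro mult_left_mono Bernoulli_powr) auto
    also have "\<dots> = f x powr r" using m f(2)[of x] by (simp add: powr_divide)
    finally show ?thesis .
  qed
  have "m powr r = expectation (\<lambda>x. m powr r * (1 + r * (f x / m - 1)))"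
    using f(1) m by (simp add: prob_space m_def[symmetric])
  also have "\<dots> \<le> expectation (\<lambda>x. f x powr r)"
    using i fr pw by (intro integral_mono) auto
  finally have "(m powr r) powr (1 / r) \<le> (expectation (\<lambda>x. f x powr r)) powr (1 / r)"
    using r by (intro powr_mono2) auto
  then show ?thesis using m r by (simp add: powr_powr m_def)
qed simp

lemma (in finite_measure) simple_function_integrable:
  fixes f :: "'a \<Rightarrow> real"
  assumes "simple_function M f" shows "integrable M f"
  by (rule integrable_simple_function[OF assms]) simp

text \<open>The values of \<open>F\<close> may have any type. With \<open>F\<close> a vector of
  coefficients, one finite partition serves all functionals \<open>g\<close> of that vector, in
  particular the norm and every coordinate.\<close>

lemma (in finite_measure) integral_simple_compose:
  fixes g :: "'b \<Rightarrow> real"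
  assumes F: "simple_function M F"
  shows "integral\<^sup>L M (\<lambda>t. g (F t)) = (\<Sum>y\<in>F ` space M. measure M (F -` {y} \<inter> space M) * g y)"
proof -
  note D = simple_functionD[OF F]
  have "integral\<^sup>L M (\<lambda>t. g (F t))
      = integral\<^sup>L M (\<lambda>t. \<Sum>y\<in>F ` space M. g y * indicator (F -` {y} \<inter> space M) t)"
  proof (rule Bochner_Integration.integral_cong[OF refl])
    fix t assume t: "t \<in> space M"
    have "(\<Sum>y\<in>F ` space M. g y * indicator (F -` {y} \<inter> space M) t)
        = (\<Sum>y\<in>F ` space M. if y = F t then g y else 0)"
      using t by (intro sum.cong) (auto simp: indicator_def)
    then show "g (F t) = (\<Sum>y\<in>F ` space M. g y * indicator (F -` {y} \<inter> space M) t)"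
      using D(1) t by simp
  qed
  also have "\<dots> = (\<Sum>y\<in>F ` space M. g y * measure M (F -` {y} \<inter> space M))"
    using D(2) by (subst Bochner_Integration.integral_sum) (auto intro!: integrable_real_indicator simp: less_top[symmetric])
  finally show ?thesis by (simp add: mult.commute)
qed

lemma simple_function_vector:
  assumes "finite S" "\<And>j. j \<in> S \<Longrightarrow> simple_function M (s j)"
  shows "simple_function M (\<lambda>t j. if j \<in> S then s j t else (0::real))"
  using assms
proof (induction S rule: finite_induct)
  case (insert k S)
  have "simple_function M (\<lambda>t. (\<lambda>j. if j \<in> S then s j t else 0)(k := s k t))"
    using insert by (intro simple_function_compose2[where h = "\<lambda>v x. v(k := x)"]) auto
  also have "(\<lambda>t. (\<lambda>j. if j \<in> S then s j t else 0)(k := s k t)) = (\<lambda>t j. if j \<in> insert k S then s j t else 0)"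
    by (auto simp: fun_eq_iff)
  finally show ?case .
qed simp

section \<open>Monotonicity and integral concavity of an unconditional norm\<close>

lemma comb_cong: "(\<And>j. j \<in> S \<Longrightarrow> a j = b j) \<Longrightarrow> comb e S a = comb e S b"
  by (simp add: comb_def)

lemma comb_add: "comb e S (\<lambda>j. a j + b j) = (\<lambda>t. comb e S a t + comb e S b t)"
  by (simp add: comb_def sum.distrib algebra_simps)

lemma comb_scale: "comb e S (\<lambda>j. c * a j) = (\<lambda>t. c * comb e S a t)"
  by (simp add: comb_def sum_distrib_left mult.assoc)

lemma comb_diff: "comb e S (\<lambda>j. a j - b j) = (\<lambda>t. comb e S a t - comb e S b t)"
  by (simp add: comb_def sum_subtractf algebra_simps)

locale unconditional_seq =
  fixes e :: "nat \<Rightarrow> real \<Rightarrow> real" and I :: "nat set"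
  assumes L1in_e: "j \<in> I \<Longrightarrow> L1in (e j)"
    and unconditional: "one_unconditional e I"
begin

lemma L1in_comb: "S \<subseteq> I \<Longrightarrow> L1in (comb e S a)"
  unfolding comb_def L1in_def
  by (intro Bochner_Integration.integrable_sum integrable_mult_right) (use L1in_e L1in_def in auto)

lemma norm_sign:
  assumes "finite S" "S \<subseteq> I" "\<And>j. j \<in> S \<Longrightarrow> \<bar>a j\<bar> = \<bar>b j\<bar>"
  shows "L1norm (comb e S a) = L1norm (comb e S b)"
  using assms unconditional unfolding one_unconditional_def by (intro antisym) auto

lemma norm_add:
  assumes "S \<subseteq> I"
  shows "L1norm (comb e S (\<lambda>j. a j + b j)) \<le> L1norm (comb e S a) + L1norm (comb e S b)"
  unfolding comb_add by (intro L1norm_triangle L1in_comb assms)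

lemma norm_scale: "L1norm (comb e S (\<lambda>j. c * a j)) = \<bar>c\<bar> * L1norm (comb e S a)"
  unfolding comb_scale by (rule L1norm_scale)

lemma norm_le_sum:
  assumes "finite S" "S \<subseteq> I"
  shows "L1norm (comb e S a) \<le> (\<Sum>j\<in>S. \<bar>a j\<bar> * L1norm (e j))"
  using assms
proof (induction S rule: finite_induct)
  case (insert k S)
  have "comb e (insert k S) a = (\<lambda>t. a k * e k t + comb e S a t)"
    using insert by (simp add: comb_def)
  then have "L1norm (comb e (insert k S) a) \<le> L1norm (\<lambda>t. a k * e k t) + L1norm (comb e S a)"
    using insert L1in_e[of k] by (auto intro!: L1norm_triangle L1in_comb simp: L1in_def)
  then show ?case using insert by (simp add: L1norm_scale)
qed (simp add: comb_def)

lemma norm_diff_le_sum: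
  assumes "finite S" "S \<subseteq> I"
  shows "\<bar>L1norm (comb e S a) - L1norm (comb e S b)\<bar> \<le> (\<Sum>j\<in>S. \<bar>a j - b j\<bar> * L1norm (e j))"
proof -
  have "\<bar>L1norm (comb e S a) - L1norm (comb e S b)\<bar> \<le> L1norm (comb e S (\<lambda>j. a j - b j))"
    unfolding comb_diff using assms by (intro L1norm_diff_abs L1in_comb)
  also note norm_le_sum[OF assms]
  finally show ?thesis .
qed

lemma norm_mono:
  assumes S: "finite S" "S \<subseteq> I" and le: "\<And>j. j \<in> S \<Longrightarrow> \<bar>a j\<bar> \<le> \<bar>b j\<bar>"
  shows "L1norm (comb e S a) \<le> L1norm (comb e S b)"
proof -
  \<comment> \<open>Coefficients are lowered one at a time; \<open>T\<close> holds the coordinates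
    already replaced.\<close>
  have "L1norm (comb e S (\<lambda>j. if j \<in> T then a j else b j)) \<le> L1norm (comb e S b)"
    if "T \<subseteq> S" for T
    using finite_subset[OF that S(1)] that
  proof (induction T rule: finite_induct)
    case (insert k T)
    define c where "c j = (if j \<in> T then a j else b j)" for j
    \<comment> \<open>\<open>a k\<close> is a convex combination of \<open>b k\<close> and \<open>- b k\<close>, and flipping that sign does not change the norm.\<close>
    define u where "u = (if b k = 0 then 1 else (1 + a k / b k) / 2)"
    have bk: "\<bar>a k\<bar> \<le> \<bar>b k\<bar>" using le insert by auto
    have u: "0 \<le> u" "u \<le> 1"
      using bk abs_le_D1[of "a k / b k" 1] abs_le_D2[of "a k / b k" 1] by (auto simp: u_def abs_divide divide_le_eq_1)
    have ak: "a k = u * b k + (1 - u) * (- b k)"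
      using bk by (auto simp: u_def field_simps)
    have eq: "(if j \<in> insert k T then a j else b j) = u * c j + (1 - u) * (c(k := - b k)) j" for j
      using insert(2) ak by (auto simp: c_def algebra_simps)
    have "L1norm (comb e S (\<lambda>j. if j \<in> insert k T then a j else b j))
        \<le> u * L1norm (comb e S c) + (1 - u) * L1norm (comb e S (c(k := - b k)))"
      unfolding eq using norm_add[OF S(2), of "\<lambda>j. u * c j" "\<lambda>j. (1 - u) * (c(k := - b k)) j"] u
      by (simp add: norm_scale del: fun_upd_apply)
    also have "L1norm (comb e S (c(k := - b k))) = L1norm (comb e S c)"
      using insert(2) by (intro norm_sign S) (auto simp: c_def)
    also have "u * L1norm (comb e S c) + (1 - u) * L1norm (comb e S c) = L1norm (comb e S c)"
      by (simp add: algebra_simps)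
    finally show ?case using insert by (simp add: c_def[abs_def])
  qed simp
  from this[of S] show ?thesis by (simp cong: comb_cong)
qed

text \<open>If the coefficient vector equals \<open>h i\<close> with probability \<open>w i\<close>,
  concavity is applied to the vectors \<open>w i powr (1/r) * h i\<close>. The weights then turn
  sums of r-th powers into expectations on both sides, and the power mean inequality lowers the left
  side to the expected norm.\<close>

lemma concave_simple:
  assumes conc: "r_concave r K e I" and r: "1 \<le> r" and S: "finite S" "S \<subseteq> I"
    and \<mu>: "prob_space \<mu>" and s: "\<And>j. j \<in> S \<Longrightarrow> simple_function \<mu> (s j)"
  shows "integral\<^sup>L \<mu> (\<lambda>t. L1norm (comb e S (\<lambda>j. s j t)))
    \<le> K * L1norm (comb e S (\<lambda>j. (integral\<^sup>L \<mu> (\<lambda>t. \<bar>s j t\<bar> powr r)) powr (1 / r)))"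
proof -
  interpret prob_space \<mu> by fact
  define F where "F = (\<lambda>t j. if j \<in> S then s j t else (0::real))"
  have F: "simple_function \<mu> F" unfolding F_def using S s by (intro simple_function_vector)
  define N where "N y = L1norm (comb e S y)" for y
  have NF: "L1norm (comb e S (\<lambda>j. s j t)) = N (F t)" for t
    unfolding N_def F_def by (simp cong: comb_cong)
  define Y where "Y = F ` space \<mu>"
  have "finite Y" unfolding Y_def using simple_functionD(1)[OF F] .
  then obtain n and h :: "nat \<Rightarrow> nat \<Rightarrow> real" where h: "Y = h ` {..<n}" "inj_on h {..<n}"
    using finite_imp_nat_seg_image_inj_on[of Y] unfolding lessThan_def by metis
  define w where "w i = prob (F -` {h i} \<inter> space \<mu>)" for i
  have w: "w i \<ge> 0" for i by (simp add: w_def)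
  have int: "expectation (\<lambda>t. g (F t)) = (\<Sum>i<n. w i * g (h i))" for g
    using integral_simple_compose[OF F, of g] h by (simp add: Y_def[symmetric] w_def sum.reindex)
  have simp1: "simple_function \<mu> (\<lambda>t. g (F t))" for g :: "_ \<Rightarrow> real"
    using F by (rule simple_function_compose1)
  define x where "x i j = w i powr (1 / r) * h i j" for i j
  have xr: "\<bar>x i j\<bar> powr r = w i * \<bar>h i j\<bar> powr r" for i j
    using r w[of i] by (simp add: x_def abs_mult powr_mult powr_powr)
  have Nx: "N (x i) powr r = w i * N (h i) powr r" for i
    using r w[of i] by (simp add: N_def x_def[abs_def] norm_scale powr_mult powr_powr)
  have "expectation (\<lambda>t. N (F t)) \<le> (expectation (\<lambda>t. N (F t) powr r)) powr (1 / r)"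
    using r by (intro power_mean simple_function_integrable simp1) (auto simp: N_def)
  also have "expectation (\<lambda>t. N (F t) powr r) = (\<Sum>i<n. N (x i) powr r)"
    unfolding Nx by (rule int)
  also have "(\<Sum>i<n. N (x i) powr r) powr (1 / r)
      \<le> K * N (\<lambda>j. (\<Sum>i<n. \<bar>x i j\<bar> powr r) powr (1 / r))"
    using conc S unfolding r_concave_def N_def by blast
  also have "N (\<lambda>j. (\<Sum>i<n. \<bar>x i j\<bar> powr r) powr (1 / r))
      = N (\<lambda>j. (expectation (\<lambda>t. \<bar>s j t\<bar> powr r)) powr (1 / r))"
  proof -
    have "(\<Sum>i<n. \<bar>x i j\<bar> powr r) = expectation (\<lambda>t. \<bar>s j t\<bar> powr r)" if "j \<in> S" for j
      using int[of "\<lambda>y. \<bar>y j\<bar> powr r"] that by (simp add: xr F_def)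
    then show ?thesis unfolding N_def by (simp cong: comb_cong)
  qed
  finally show ?thesis unfolding NF by (simp add: N_def)
qed

text \<open>Simple functions increasing to \<open>\<bar>y j\<bar>\<close> reduce the claim to the
  simple case: dominated convergence handles the left side and monotonicity of the norm bounds every
  right side. Since \<open>K\<close> has no prescribed sign, multiplying the latter bound requires
  \<open>\<bar>K\<bar>\<close>.\<close>

lemma concave_integral:
  assumes conc: "r_concave r K e I" and r: "1 \<le> r" and S: "finite S" "S \<subseteq> I"
    and \<mu>: "prob_space \<mu>" and y: "\<And>j. j \<in> S \<Longrightarrow> y j \<in> borel_measurable \<mu>"
    and yr: "\<And>j. j \<in> S \<Longrightarrow> integrable \<mu> (\<lambda>t. \<bar>y j t\<bar> powr r)"
  shows "integrable \<mu> (\<lambda>t. L1norm (comb e S (\<lambda>j. y j t)))"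
    and "integral\<^sup>L \<mu> (\<lambda>t. L1norm (comb e S (\<lambda>j. y j t)))
    \<le> \<bar>K\<bar> * L1norm (comb e S (\<lambda>j. (integral\<^sup>L \<mu> (\<lambda>t. \<bar>y j t\<bar> powr r)) powr (1 / r)))" (is "_ \<le> _ * ?R")
proof -
  interpret prob_space \<mu> by fact
  have "\<exists>f. \<forall>n. simple_function \<mu> (f n) \<and> (\<forall>t. 0 \<le> f n t \<and> f n t \<le> \<bar>y j t\<bar>)
      \<and> (\<forall>t. (\<lambda>n. f n t) \<longlonglongrightarrow> \<bar>y j t\<bar>)" if "j \<in> S" for j
  proof -
    have "(\<lambda>t. \<bar>y j t\<bar>) \<in> borel_measurable \<mu>" using y[OF that] by measurable
    from borel_measurable_implies_simple_function_sequence_real[OF this] obtain f where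
      f: "incseq f" "\<And>i. simple_function \<mu> (f i)" "\<And>t. bdd_above (range (\<lambda>i. f i t))"
        "\<And>i t. 0 \<le> f i t" "(\<lambda>t. \<bar>y j t\<bar>) = (SUP i. f i)" by auto
    have sup: "\<bar>y j t\<bar> = (SUP i. f i t)" for t
      using fun_cong[OF f(5), of t] by (simp add: image_image)
    have "(\<lambda>n. f n t) \<longlonglongrightarrow> \<bar>y j t\<bar>" for t
      unfolding sup using f(1,3) by (intro LIMSEQ_incseq_SUP) (auto simp: incseq_def le_fun_def)
    moreover have "f n t \<le> \<bar>y j t\<bar>" for n t
      unfolding sup by (intro cSUP_upper f(3)) simp
    ultimately show ?thesis using f(2,4) by blast
  qed
  then obtain s where s: "\<And>j n. j \<in> S \<Longrightarrow> simple_function \<mu> (s j n)"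
    "\<And>j n t. j \<in> S \<Longrightarrow> 0 \<le> s j n t" "\<And>j n t. j \<in> S \<Longrightarrow> s j n t \<le> \<bar>y j t\<bar>"
    "\<And>j t. j \<in> S \<Longrightarrow> (\<lambda>n. s j n t) \<longlonglongrightarrow> \<bar>y j t\<bar>"
    by metis
  define N where "N y = L1norm (comb e S y)" for y
  have Ny: "N (\<lambda>j. y j t) = N (\<lambda>j. \<bar>y j t\<bar>)" for t
    unfolding N_def by (intro norm_sign S) simp
  have conv: "(\<lambda>n. N (\<lambda>j. s j n t)) \<longlonglongrightarrow> N (\<lambda>j. y j t)" for t
  proof -
    have "(\<lambda>n. \<Sum>j\<in>S. \<bar>s j n t - \<bar>y j t\<bar>\<bar> * L1norm (e j)) \<longlonglongrightarrow> (\<Sum>j\<in>S. \<bar>\<bar>y j t\<bar> - \<bar>y j t\<bar>\<bar> * L1norm (e j))"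
      by (intro tendsto_intros s(4))
    then have lim: "(\<lambda>n. \<Sum>j\<in>S. \<bar>s j n t - \<bar>y j t\<bar>\<bar> * L1norm (e j)) \<longlonglongrightarrow> 0" by simp
    have "(\<lambda>n. N (\<lambda>j. s j n t) - N (\<lambda>j. y j t)) \<longlonglongrightarrow> 0"
      unfolding Ny N_def by (rule Lim_null_comparison[OF _ lim]) (simp add: norm_diff_le_sum S)
    then show ?thesis by (simp add: LIM_zero_iff)
  qed
  have sm: "simple_function \<mu> (\<lambda>t. N (\<lambda>j. s j n t))" for n
  proof -
    have "simple_function \<mu> (\<lambda>t. N (\<lambda>j. if j \<in> S then s j n t else 0))"
      by (rule simple_function_compose1[OF simple_function_vector]) (use S s in auto)
    also have "(\<lambda>t. N (\<lambda>j. if j \<in> S then s j n t else 0)) = (\<lambda>t. N (\<lambda>j. s j n t))"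
      unfolding N_def by (simp cong: comb_cong)
    finally show ?thesis .
  qed
  have Nm [measurable]: "(\<lambda>t. N (\<lambda>j. y j t)) \<in> borel_measurable \<mu>"
    by (rule borel_measurable_LIMSEQ_real[OF conv]) (intro borel_measurable_simple_function sm)
  have yi: "integrable \<mu> (\<lambda>t. \<bar>y j t\<bar>)" if "j \<in> S" for j
  proof (rule Bochner_Integration.integrable_bound)
    show "integrable \<mu> (\<lambda>t. 1 + \<bar>y j t\<bar> powr r)" using yr[OF that] by simp
    show "(\<lambda>t. \<bar>y j t\<bar>) \<in> borel_measurable \<mu>" using y[OF that] by measurable
    have "\<bar>y j t\<bar> \<le> 1 + \<bar>y j t\<bar> powr r" for t using r by (intro le_one_plus_powr) auto
    then show "AE t in \<mu>. norm \<bar>y j t\<bar> \<le> norm (1 + \<bar>y j t\<bar> powr r)"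
      by (intro AE_I2) (simp add: order_trans[OF _ abs_ge_self])
  qed
  have Ni: "integrable \<mu> (\<lambda>t. N (\<lambda>j. y j t))"
  proof (rule Bochner_Integration.integrable_bound)
    show "integrable \<mu> (\<lambda>t. \<Sum>j\<in>S. \<bar>y j t\<bar> * L1norm (e j))" using yi by auto
    show "AE t in \<mu>. norm (N (\<lambda>j. y j t)) \<le> norm (\<Sum>j\<in>S. \<bar>y j t\<bar> * L1norm (e j))"
    proof (intro AE_I2)
      fix t
      have "0 \<le> N (\<lambda>j. y j t)" by (simp add: N_def)
      moreover have "N (\<lambda>j. y j t) \<le> (\<Sum>j\<in>S. \<bar>y j t\<bar> * L1norm (e j))"
        unfolding N_def by (rule norm_le_sum[OF S])
      ultimately show "norm (N (\<lambda>j. y j t)) \<le> norm (\<Sum>j\<in>S. \<bar>y j t\<bar> * L1norm (e j))"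
        by simp
    qed
  qed (rule Nm)
  then show "integrable \<mu> (\<lambda>t. L1norm (comb e S (\<lambda>j. y j t)))" by (simp add: N_def)
  have lim: "(\<lambda>n. expectation (\<lambda>t. N (\<lambda>j. s j n t))) \<longlonglongrightarrow> expectation (\<lambda>t. N (\<lambda>j. y j t))"
  proof (rule integral_dominated_convergence[OF _ _ Ni])
    show "AE t in \<mu>. norm (N (\<lambda>j. s j n t)) \<le> N (\<lambda>j. y j t)" for n
    proof (intro AE_I2)
      fix t
      have "N (\<lambda>j. s j n t) \<le> N (\<lambda>j. y j t)"
        unfolding N_def using s(2,3) by (intro norm_mono S) simp
      then show "norm (N (\<lambda>j. s j n t)) \<le> N (\<lambda>j. y j t)" by (simp add: N_def)
    qed
    show "(\<lambda>t. N (\<lambda>j. s j n t)) \<in> borel_measurable \<mu>" for n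
      by (intro borel_measurable_simple_function sm)
    show "AE t in \<mu>. (\<lambda>n. N (\<lambda>j. s j n t)) \<longlonglongrightarrow> N (\<lambda>j. y j t)"
      using conv by simp
  qed (rule Nm)
  have le: "expectation (\<lambda>t. N (\<lambda>j. s j n t)) \<le> \<bar>K\<bar> * ?R" for n
  proof -
    have 1: "expectation (\<lambda>t. N (\<lambda>j. s j n t)) \<le> K * L1norm (comb e S (\<lambda>j. (expectation (\<lambda>t. \<bar>s j n t\<bar> powr r)) powr (1 / r)))"
      unfolding N_def by (rule concave_simple[OF conc r S \<mu> s(1)])
    have 2: "L1norm (comb e S (\<lambda>j. (expectation (\<lambda>t. \<bar>s j n t\<bar> powr r)) powr (1 / r))) \<le> ?R"
    proof (rule norm_mono[OF S])
      fix j assume j: "j \<in> S"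
      have "expectation (\<lambda>t. \<bar>s j n t\<bar> powr r) \<le> expectation (\<lambda>t. \<bar>y j t\<bar> powr r)"
      proof (rule integral_mono[OF _ yr[OF j]])
        show "integrable \<mu> (\<lambda>t. \<bar>s j n t\<bar> powr r)"
          by (rule simple_function_integrable[OF simple_function_compose1[OF s(1)[OF j]]])
        show "\<bar>s j n t\<bar> powr r \<le> \<bar>y j t\<bar> powr r" for t
          using s(2,3)[OF j, of n t] r by (intro powr_mono2) auto
      qed
      then have "(expectation (\<lambda>t. \<bar>s j n t\<bar> powr r)) powr (1 / r)
          \<le> (expectation (\<lambda>t. \<bar>y j t\<bar> powr r)) powr (1 / r)"
        using r by (intro powr_mono2) auto
      then show "\<bar>(expectation (\<lambda>t. \<bar>s j n t\<bar> powr r)) powr (1 / r)\<bar>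
          \<le> \<bar>(expectation (\<lambda>t. \<bar>y j t\<bar> powr r)) powr (1 / r)\<bar>"
        by simp
    qed
    show ?thesis
      by (rule order_trans[OF 1 mult_mono[OF abs_ge_self 2]]) simp_all
  qed
  have "expectation (\<lambda>t. N (\<lambda>j. y j t)) \<le> \<bar>K\<bar> * ?R"
    by (rule LIMSEQ_le_const2[OF lim]) (simp add: le)
  then show "integral\<^sup>L \<mu> (\<lambda>t. L1norm (comb e S (\<lambda>j. y j t))) \<le> \<bar>K\<bar> * ?R"
    by (simp add: N_def)
qed

end

section \<open>Sampling on the product\<close>

lemma L1norm_eq_L1B:
  assumes "f \<in> borel_measurable L1B" shows "L1norm f = integral\<^sup>L L1B (\<lambda>t. \<bar>f t\<bar>)"
  unfolding L1norm_def using assms by (intro integral_L1M_eq borel_measurable_abs)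

text \<open>The vectors are going to be composed with the sampling map, for which Borel
  measurability is the convenient notion. Finite combinations change only on null sets, so all
  hypotheses expressed by norms carry over.\<close>

lemma unconditional_seq_borel_version:
  assumes "unconditional_seq e I"
  obtains e' where "unconditional_seq e' I" "\<And>j. e' j \<in> borel_measurable borel"
    "\<And>S c. S \<subseteq> I \<Longrightarrow> L1norm (comb e' S c) = L1norm (comb e S c)"
proof -
  interpret unconditional_seq e I by fact
  have "\<exists>g. g \<in> borel_measurable borel \<and> (j \<in> I \<longrightarrow> (AE t in L1M. g t = e j t))" for j
  proof (cases "j \<in> I")
    case True
    then have "e j \<in> borel_measurable L1M" using L1in_e unfolding L1in_def by auto
    from borel_version[OF this] show ?thesis by blast
  next
    case False
    have "(\<lambda>t. 0 :: real) \<in> borel_measurable borel" by simp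
    then show ?thesis using False by blast
  qed
  then obtain e' where e': "\<And>j. e' j \<in> borel_measurable borel"
    "\<And>j. j \<in> I \<Longrightarrow> AE t in L1M. e' j t = e j t" by metis
  have m: "e' j \<in> borel_measurable L1M" for j
    by (intro measurable_L1M_if_L1B borel_measurable_L1B e')
  have L1: "L1in (e' j)" if "j \<in> I" for j
  proof -
    have "integrable L1M (e' j) \<longleftrightarrow> integrable L1M (e j)"
      using e'(2)[OF that] m L1in_e[OF that] by (intro integrable_cong_AE) (auto simp: L1in_def)
    then show ?thesis using L1in_e[OF that] by (simp add: L1in_def)
  qed
  have eq: "L1norm (comb e' S c) = L1norm (comb e S c)" if S: "S \<subseteq> I" for S c
  proof (cases "finite S")
    case True
    have ae: "AE t in L1M. \<forall>j\<in>S. e' j t = e j t"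
      using S e'(2) by (intro AE_finite_allI True) auto
    show ?thesis
    proof (rule L1norm_cong_AE)
      show "comb e' S c \<in> borel_measurable L1M" unfolding comb_def using m by measurable
      show "comb e S c \<in> borel_measurable L1M" using L1in_comb[OF S, of c] unfolding L1in_def by auto
      show "AE t in L1M. comb e' S c t = comb e S c t"
        using ae by eventually_elim (simp add: comb_def)
    qed
  qed (simp add: comb_def)
  have "unconditional_seq e' I"
  proof
    show "one_unconditional e' I"
      using unconditional unfolding one_unconditional_def by (simp add: eq)
  qed (rule L1)
  with e'(1) eq show ?thesis using that by blast
qed

locale sampled_seq = unconditional_seq e I for e I +
  fixes \<mu> :: "real measure" and U V :: "real \<Rightarrow> real"
  assumes borel_e: "e j \<in> borel_measurable borel"
    and \<mu>: "prob_on_01 \<mu>"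
    and U: "U \<in> measurable L1B L1B" and V: "V \<in> measurable L1B \<mu>"
    and UV: "distr L1B (L1B \<Otimes>\<^sub>M \<mu>) (\<lambda>\<tau>. (U \<tau>, V \<tau>)) = L1B \<Otimes>\<^sub>M \<mu>"
begin

sublocale M: prob_space \<mu> using \<mu> by (simp add: prob_on_01_def)
sublocale L: prob_space L1B by (rule prob_space_L1B)
sublocale P: pair_prob_space L1B \<mu> ..

definition sample :: "nat set \<Rightarrow> (nat \<Rightarrow> real \<Rightarrow> real) \<Rightarrow> real \<Rightarrow> real" where
  "sample S y = (\<lambda>\<tau>. \<Sum>j\<in>S. y j (V \<tau>) * e j (U \<tau>))"

context
  fixes S :: "nat set" and y :: "nat \<Rightarrow> real \<Rightarrow> real"
  assumes S: "finite S" "S \<subseteq> I" and y: "\<And>j. j \<in> S \<Longrightarrow> integrable \<mu> (y j)"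
begin

lemma integrable_product_comb:
  "integrable (L1B \<Otimes>\<^sub>M \<mu>) (\<lambda>(s, t). comb e S (\<lambda>j. y j t) s)"
proof -
  have "integrable (L1B \<Otimes>\<^sub>M \<mu>) (\<lambda>(s, t). y j t * e j s)" if j: "j \<in> S" for j
  proof -
    have [measurable]: "e j \<in> borel_measurable L1B" by (intro borel_measurable_L1B borel_e)
    have [measurable]: "y j \<in> borel_measurable \<mu>" using y[OF j] by auto
    have ei: "integrable L1B (e j)"
      using L1in_e[of j] j S by (auto simp: L1in_def integrable_L1M_iff)
    show ?thesis
    proof (rule P.Fubini_integrable)
      show "(\<lambda>(s, t). y j t * e j s) \<in> borel_measurable (L1B \<Otimes>\<^sub>M \<mu>)" by measurable
      show "integrable L1B (\<lambda>s. \<integral>t. norm (case (s, t) of (s, t) \<Rightarrow> y j t * e j s) \<partial>\<mu>)"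
        using ei by (simp add: abs_mult)
      show "AE s in L1B. integrable \<mu> (\<lambda>t. case (s, t) of (s, t) \<Rightarrow> y j t * e j s)"
        using y[OF j] by simp
    qed
  qed
  then show ?thesis
    unfolding comb_def split_beta by (intro Bochner_Integration.integrable_sum)
qed

text \<open>The pair \<open>(U, V)\<close> preserves measure, so the norm is a double integral over
  the product. Fubini with the second variable outside leaves, for each \<open>t\<close>, the norm
  of a combination of \<open>e\<close>.\<close>

lemma L1in_sample: "L1in (sample S y)"
  and L1norm_sample: "L1norm (sample S y) = (\<integral>t. L1norm (comb e S (\<lambda>j. y j t)) \<partial>\<mu>)"
  and integrable_norm_comb: "integrable \<mu> (\<lambda>t. L1norm (comb e S (\<lambda>j. y j t)))"
proof -
  define h where "h = (\<lambda>(s, t). comb e S (\<lambda>j. y j t) s)"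
  have hi: "integrable (L1B \<Otimes>\<^sub>M \<mu>) h" unfolding h_def by (rule integrable_product_comb)
  then have hm: "h \<in> borel_measurable (L1B \<Otimes>\<^sub>M \<mu>)" by auto
  have UVm: "(\<lambda>\<tau>. (U \<tau>, V \<tau>)) \<in> measurable L1B (L1B \<Otimes>\<^sub>M \<mu>)"
    using U V by measurable
  have sample_eq: "sample S y = (\<lambda>\<tau>. h (U \<tau>, V \<tau>))"
    by (simp add: sample_def h_def comb_def)
  have si: "integrable L1B (sample S y)"
    unfolding sample_eq using hi hm UVm UV by (subst integrable_distr_eq[symmetric]) auto
  then have sm: "sample S y \<in> borel_measurable L1B" by auto
  show "L1in (sample S y)" using si sm by (simp add: L1in_def integrable_L1M_iff)
  have hi': "integrable (L1B \<Otimes>\<^sub>M \<mu>) (case_prod (\<lambda>s t. \<bar>comb e S (\<lambda>j. y j t) s\<bar>))"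
    using integrable_abs[OF hi] by (simp add: h_def case_prod_unfold)
  have cm: "comb e S c \<in> borel_measurable L1B" for c
    unfolding comb_def by (intro borel_measurable_sum borel_measurable_times borel_measurable_const borel_measurable_L1B borel_e)
  have N: "L1norm (comb e S c) = (\<integral>s. \<bar>comb e S c s\<bar> \<partial>L1B)" for c
    using cm by (rule L1norm_eq_L1B)
  have "L1norm (sample S y) = (\<integral>\<tau>. \<bar>h (U \<tau>, V \<tau>)\<bar> \<partial>L1B)"
    using sm unfolding sample_eq by (rule L1norm_eq_L1B)
  also have "\<dots> = (\<integral>x. \<bar>h x\<bar> \<partial>(L1B \<Otimes>\<^sub>M \<mu>))"
    using integral_distr[OF UVm, of "\<lambda>x. \<bar>h x\<bar>"] hm by (simp add: UV)
  also have "\<dots> = (\<integral>t. (\<integral>s. \<bar>comb e S (\<lambda>j. y j t) s\<bar> \<partial>L1B) \<partial>\<mu>)"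
    using P.integral_snd[OF hi'] by (simp add: h_def case_prod_unfold)
  finally show "L1norm (sample S y) = (\<integral>t. L1norm (comb e S (\<lambda>j. y j t)) \<partial>\<mu>)"
    unfolding N .
  show "integrable \<mu> (\<lambda>t. L1norm (comb e S (\<lambda>j. y j t)))"
    unfolding N using P.integrable_snd[OF hi'] by simp
qed

end

text \<open>The signs of \<open>y j t\<close> vary with \<open>t\<close>, so unconditionality has to
  be used at each \<open>t\<close> separately. This becomes possible once Fubini has written the
  double integral as an average of norms.\<close>

lemma L1norm_sample_ge:
  assumes S: "finite S" "S \<subseteq> I" and y: "\<And>j. j \<in> S \<Longrightarrow> integrable \<mu> (y j)"
  shows "L1norm (comb e S (\<lambda>j. Lnorm1 \<mu> (y j))) \<le> L1norm (sample S y)"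
proof -
  have y': "\<And>j. j \<in> S \<Longrightarrow> integrable \<mu> (\<lambda>t. \<bar>y j t\<bar>)" using y by auto
  have int: "integrable (L1B \<Otimes>\<^sub>M \<mu>) (case_prod (\<lambda>s t. comb e S (\<lambda>j. \<bar>y j t\<bar>) s))"
    by (rule integrable_product_comb[OF S y'])
  have int': "integrable (L1B \<Otimes>\<^sub>M \<mu>) (case_prod (\<lambda>s t. \<bar>comb e S (\<lambda>j. \<bar>y j t\<bar>) s\<bar>))"
    using integrable_abs[OF int] by (simp add: case_prod_unfold)
  have cm: "comb e S c \<in> borel_measurable L1B" for c
    unfolding comb_def by (intro borel_measurable_sum borel_measurable_times borel_measurable_const borel_measurable_L1B borel_e)
  have N: "L1norm (comb e S c) = (\<integral>s. \<bar>comb e S c s\<bar> \<partial>L1B)" for c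
    using cm by (rule L1norm_eq_L1B)
  have "comb e S (\<lambda>j. Lnorm1 \<mu> (y j)) s = (\<integral>t. comb e S (\<lambda>j. \<bar>y j t\<bar>) s \<partial>\<mu>)" for s
    unfolding comb_def Lnorm1_def using y' by (simp add: Bochner_Integration.integral_sum)
  then have "L1norm (comb e S (\<lambda>j. Lnorm1 \<mu> (y j))) = (\<integral>s. \<bar>\<integral>t. comb e S (\<lambda>j. \<bar>y j t\<bar>) s \<partial>\<mu>\<bar> \<partial>L1B)"
    unfolding N by simp
  also have "\<dots> \<le> (\<integral>s. (\<integral>t. \<bar>comb e S (\<lambda>j. \<bar>y j t\<bar>) s\<bar> \<partial>\<mu>) \<partial>L1B)"
    using P.integrable_fst[OF int] P.integrable_fst[OF int']
    by (intro integral_mono integrable_abs) auto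
  also have "\<dots> = (\<integral>t. (\<integral>s. \<bar>comb e S (\<lambda>j. \<bar>y j t\<bar>) s\<bar> \<partial>L1B) \<partial>\<mu>)"
    using P.integral_snd[OF int'] P.integral_fst[OF int'] by simp
  also have "\<dots> = (\<integral>t. L1norm (comb e S (\<lambda>j. y j t)) \<partial>\<mu>)"
    unfolding N[symmetric] using norm_sign[OF S, of "\<lambda>j. \<bar>y j _\<bar>" "\<lambda>j. y j _"]
    by (intro Bochner_Integration.integral_cong refl) simp
  also have "\<dots> = L1norm (sample S y)"
    by (rule L1norm_sample[OF S y, symmetric])
  finally show ?thesis .
qed

lemma L1norm_sample_le:
  assumes S: "finite S" "S \<subseteq> I" and y: "\<And>j. j \<in> S \<Longrightarrow> integrable \<mu> (y j)"
    and conc: "r_concave r K1 e I" and r: "1 \<le> r"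
    and yr: "\<And>j. j \<in> S \<Longrightarrow> integrable \<mu> (\<lambda>t. \<bar>y j t\<bar> powr r)"
    and K2: "\<And>j. j \<in> S \<Longrightarrow> (integral\<^sup>L \<mu> (\<lambda>t. \<bar>y j t\<bar> powr r)) powr (1 / r) \<le> K2 * Lnorm1 \<mu> (y j)"
  shows "L1norm (sample S y) \<le> \<bar>K1\<bar> * \<bar>K2\<bar> * L1norm (comb e S (\<lambda>j. Lnorm1 \<mu> (y j)))"
proof -
  have ym: "\<And>j. j \<in> S \<Longrightarrow> y j \<in> borel_measurable \<mu>" using y by auto
  have "L1norm (sample S y) = (\<integral>t. L1norm (comb e S (\<lambda>j. y j t)) \<partial>\<mu>)"
    by (rule L1norm_sample[OF S y])
  also have "\<dots> \<le> \<bar>K1\<bar> * L1norm (comb e S (\<lambda>j. (integral\<^sup>L \<mu> (\<lambda>t. \<bar>y j t\<bar> powr r)) powr (1 / r)))"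
    by (rule concave_integral(2)[OF conc r S M.prob_space_axioms ym yr])
  also have "\<dots> \<le> \<bar>K1\<bar> * L1norm (comb e S (\<lambda>j. K2 * Lnorm1 \<mu> (y j)))"
    using K2 by (intro mult_left_mono norm_mono S) (auto intro: order_trans[OF _ abs_ge_self])
  finally show ?thesis by (simp add: norm_scale)
qed

text \<open>A relation and not a function, as the limit is determined only up to null sets.
  Integrability of the \<open>x j\<close> is included so that the triangle inequality for partial
  sums shows closure under addition.\<close>

definition sample_limit :: "(nat \<Rightarrow> real \<Rightarrow> real) \<Rightarrow> (real \<Rightarrow> real) \<Rightarrow> bool" where
  "sample_limit x g \<longleftrightarrow> (\<forall>j\<in>I. integrable \<mu> (x j)) \<and> L1in g \<and>
     (\<lambda>n. L1norm (\<lambda>\<tau>. sample (I \<inter> {..<n}) x \<tau> - g \<tau>)) \<longlonglongrightarrow> 0"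

lemma sample_limit_linear:
  obtains T where "\<And>x y. T (\<lambda>i t. x i t + y i t) = (\<lambda>t. T x t + T y t)"
    "\<And>c x. T (\<lambda>i t. c * x i t) = (\<lambda>t. c * T x t)" "\<And>x u. sample_limit x u \<Longrightarrow> sample_limit x (T x)"
proof (rule linear_selection_fun_seq[of sample_limit])
  show "sample_limit (\<lambda>i t. 0) (\<lambda>t. 0)" by (simp add: sample_limit_def sample_def L1in_def)
next
  fix x y u v assume xu: "sample_limit x u" and yv: "sample_limit y v"
  have xi: "L1in (sample (I \<inter> {..<n}) x)" and yi: "L1in (sample (I \<inter> {..<n}) y)" for n
    using xu yv by (auto simp: sample_limit_def intro!: L1in_sample)
  have lim: "(\<lambda>n. L1norm (\<lambda>\<tau>. sample (I \<inter> {..<n}) x \<tau> - u \<tau>)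
      + L1norm (\<lambda>\<tau>. sample (I \<inter> {..<n}) y \<tau> - v \<tau>)) \<longlonglongrightarrow> 0"
    using xu yv by (intro tendsto_add_zero) (simp_all add: sample_limit_def)
  have "(\<lambda>n. L1norm (\<lambda>\<tau>. sample (I \<inter> {..<n}) (\<lambda>i t. x i t + y i t) \<tau> - (u \<tau> + v \<tau>))) \<longlonglongrightarrow> 0"
  proof (rule Lim_null_comparison[OF _ lim], intro always_eventually allI)
    fix n
    have "(\<lambda>\<tau>. sample (I \<inter> {..<n}) (\<lambda>i t. x i t + y i t) \<tau> - (u \<tau> + v \<tau>))
        = (\<lambda>\<tau>. (sample (I \<inter> {..<n}) x \<tau> - u \<tau>) + (sample (I \<inter> {..<n}) y \<tau> - v \<tau>))"
      by (simp add: sample_def sum.distrib algebra_simps)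
    then show "norm (L1norm (\<lambda>\<tau>. sample (I \<inter> {..<n}) (\<lambda>i t. x i t + y i t) \<tau> - (u \<tau> + v \<tau>)))
        \<le> L1norm (\<lambda>\<tau>. sample (I \<inter> {..<n}) x \<tau> - u \<tau>) + L1norm (\<lambda>\<tau>. sample (I \<inter> {..<n}) y \<tau> - v \<tau>)"
      using xi[of n] yi[of n] xu yv
      by (simp, intro L1norm_triangle) (auto simp: sample_limit_def L1in_def)
  qed
  then show "sample_limit (\<lambda>i t. x i t + y i t) (\<lambda>t. u t + v t)"
    using xu yv by (simp add: sample_limit_def L1in_def)
next
  fix c x u assume xu: "sample_limit x u"
  have "(\<lambda>\<tau>. sample S (\<lambda>i t. c * x i t) \<tau> - c * u \<tau>) = (\<lambda>\<tau>. c * (sample S x \<tau> - u \<tau>))" for S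
    by (simp add: sample_def sum_distrib_left algebra_simps)
  then show "sample_limit (\<lambda>i t. c * x i t) (\<lambda>t. c * u t)"
    using xu tendsto_mult_left[of _ 0 sequentially "\<bar>c\<bar>"] by (simp add: sample_limit_def L1in_def L1norm_scale)
qed blast

end

section \<open>The direct sum\<close>

context unconditional_seq
begin

lemma comb_block: "m \<le> n \<Longrightarrow> comb e (I \<inter> {m..<n}) c t = psum e I c n t - psum e I c m t"
proof -
  assume "m \<le> n"
  then have "I \<inter> {..<n} = (I \<inter> {..<m}) \<union> (I \<inter> {m..<n})" by auto
  then show ?thesis
    unfolding psum_def comb_def by (simp add: sum.union_disjoint disjoint_iff)
qed

lemma L1in_psum: "L1in (psum e I c n)"
  unfolding psum_def by (intro L1in_comb) simp

lemma series_norm_lim: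
  assumes "series_conv e I c"
  shows "(\<lambda>n. L1norm (psum e I c n)) \<longlonglongrightarrow> series_norm e I c"
proof -
  obtain g where g: "L1in g" "(\<lambda>n. L1norm (\<lambda>t. psum e I c n t - g t)) \<longlonglongrightarrow> 0"
    using assms by (auto simp: series_conv_def)
  have "(\<lambda>n. L1norm (psum e I c n)) \<longlonglongrightarrow> L1norm g"
    by (rule L1norm_tendsto[OF L1in_psum g])
  then show ?thesis unfolding series_norm_def by (simp add: limI)
qed

lemma series_conv_block:
  assumes "series_conv e I c" "\<epsilon> > 0"
  shows "\<exists>N. \<forall>m\<ge>N. \<forall>n\<ge>m. L1norm (comb e (I \<inter> {m..<n}) c) < \<epsilon>"
proof -
  obtain g where g: "L1in g" "(\<lambda>n. L1norm (\<lambda>t. psum e I c n t - g t)) \<longlonglongrightarrow> 0"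
    using assms by (auto simp: series_conv_def)
  from LIMSEQ_D[OF g(2), of "\<epsilon> / 2"] \<open>\<epsilon> > 0\<close> obtain N where
    N: "\<And>n. n \<ge> N \<Longrightarrow> L1norm (\<lambda>t. psum e I c n t - g t) < \<epsilon> / 2" by auto
  have "L1norm (comb e (I \<inter> {m..<n}) c) < \<epsilon>" if "m \<ge> N" "n \<ge> m" for m n
  proof -
    have "L1norm (comb e (I \<inter> {m..<n}) c) = L1norm (\<lambda>t. psum e I c n t - psum e I c m t)"
      by (simp only: comb_block[OF \<open>n \<ge> m\<close>, symmetric])
    also have "\<dots> \<le> L1norm (\<lambda>t. psum e I c n t - g t) + L1norm (\<lambda>t. g t - psum e I c m t)"
      by (intro L1norm_triangle_diff L1in_psum g)
    also have "L1norm (\<lambda>t. g t - psum e I c m t) = L1norm (\<lambda>t. psum e I c m t - g t)"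
      by (rule L1norm_minus_commute)
    finally show ?thesis using N[of m] N[of n] that by linarith
  qed
  then show ?thesis by blast
qed

end

text \<open>A difference of two partial sums is the sample of a block, whose norm is at most a
  multiple of the corresponding block of the series with coefficients \<open>c\<close>. The Cauchy
  property therefore transfers, and completeness of L1 provides the limit.\<close>

lemma (in sampled_seq) sample_limit_exists:
  assumes x: "\<And>j. j \<in> I \<Longrightarrow> integrable \<mu> (x j)"
    and bound: "\<And>S. finite S \<Longrightarrow> S \<subseteq> I \<Longrightarrow> L1norm (sample S x) \<le> C * L1norm (comb e S c)"
    and Cauchy: "\<And>\<epsilon>. \<epsilon> > 0 \<Longrightarrow> \<exists>N. \<forall>m\<ge>N. \<forall>n\<ge>m. L1norm (comb e (I \<inter> {m..<n}) c) < \<epsilon>"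
  shows "\<exists>g. sample_limit x g"
proof -
  have L1: "L1in (sample (I \<inter> {..<n}) x)" for n
    using x by (intro L1in_sample) auto
  have "\<exists>N. \<forall>m\<ge>N. \<forall>n\<ge>m. L1norm (\<lambda>t. sample (I \<inter> {..<m}) x t - sample (I \<inter> {..<n}) x t) < \<epsilon>"
    if "\<epsilon> > 0" for \<epsilon>
  proof -
    have "\<epsilon> / (\<bar>C\<bar> + 1) > 0" using that by simp
    from Cauchy[OF this] obtain N where
      N: "\<And>m n. m \<ge> N \<Longrightarrow> n \<ge> m \<Longrightarrow> L1norm (comb e (I \<inter> {m..<n}) c) < \<epsilon> / (\<bar>C\<bar> + 1)" by blast
    have "L1norm (\<lambda>t. sample (I \<inter> {..<m}) x t - sample (I \<inter> {..<n}) x t) < \<epsilon>" if "m \<ge> N" "n \<ge> m" for m n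
    proof -
      have un: "I \<inter> {..<n} = (I \<inter> {..<m}) \<union> (I \<inter> {m..<n})" using \<open>n \<ge> m\<close> by auto
      have "L1norm (\<lambda>t. sample (I \<inter> {..<m}) x t - sample (I \<inter> {..<n}) x t)
          = L1norm (\<lambda>t. sample (I \<inter> {..<n}) x t - sample (I \<inter> {..<m}) x t)"
        by (rule L1norm_minus_commute)
      also have "\<dots> = L1norm (sample (I \<inter> {m..<n}) x)"
        unfolding sample_def un by (simp add: sum.union_disjoint disjoint_iff)
      also have "\<dots> \<le> C * L1norm (comb e (I \<inter> {m..<n}) c)" by (intro bound) auto
      also have "\<dots> \<le> (\<bar>C\<bar> + 1) * L1norm (comb e (I \<inter> {m..<n}) c)" by (intro mult_right_mono) auto
      also have "\<dots> < \<epsilon>" using N[OF that] by (simp add: field_simps)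
      finally show ?thesis .
    qed
    then show ?thesis by blast
  qed
  from L1_complete[OF L1 this] obtain g where "L1in g"
    "(\<lambda>n. L1norm (\<lambda>t. sample (I \<inter> {..<n}) x t - g t)) \<longlonglongrightarrow> 0" by blast
  then show ?thesis using x by (auto simp: sample_limit_def)
qed

text \<open>Both estimates hold for finite partial sums and pass to the limit. The summand 1 in the
  upper constant keeps it positive even if \<open>K1\<close> or \<open>K2\<close> is 0.\<close>

lemma dsum_embedding:
  assumes r: "1 \<le> r" and e: "unc_basic_seq e I" and conc: "r_concave r K1 e I"
    and \<mu>: "prob_on_01 \<mu>" and X: "lin_subspace_L1 \<mu> X"
    and K2: "\<And>x. x \<in> X \<Longrightarrow> integrable \<mu> (\<lambda>t. \<bar>x t\<bar> powr r)"
      "\<And>x. x \<in> X \<Longrightarrow> (integral\<^sup>L \<mu> (\<lambda>t. \<bar>x t\<bar> powr r)) powr (1/r) \<le> K2 * Lnorm1 \<mu> x"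
  obtains T where "\<And>x y. T (\<lambda>i t. x i t + y i t) = (\<lambda>t. T x t + T y t)"
    "\<And>c x. T (\<lambda>i t. c * x i t) = (\<lambda>t. c * T x t)"
    "\<And>x. x \<in> dsum_space e I \<mu> X \<Longrightarrow> L1in (T x)"
    "\<And>x. x \<in> dsum_space e I \<mu> X \<Longrightarrow> dsum_norm e I \<mu> x \<le> L1norm (T x)"
    "\<And>x. x \<in> dsum_space e I \<mu> X \<Longrightarrow> L1norm (T x) \<le> (1 + \<bar>K1\<bar> * \<bar>K2\<bar>) * dsum_norm e I \<mu> x"
proof -
  have E: "unconditional_seq e I"
    using e by (auto simp: unconditional_seq_def unc_basic_seq_def basic_seq_def)
  then interpret E: unconditional_seq e I .
  obtain e' where e': "unconditional_seq e' I" "\<And>j. e' j \<in> borel_measurable borel"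
    and norm_eq: "\<And>S c. S \<subseteq> I \<Longrightarrow> L1norm (comb e' S c) = L1norm (comb e S c)"
    using unconditional_seq_borel_version[OF E] by blast
  obtain U V where "U \<in> measurable L1B L1B" "V \<in> measurable L1B \<mu>"
    "distr L1B (L1B \<Otimes>\<^sub>M \<mu>) (\<lambda>\<tau>. (U \<tau>, V \<tau>)) = L1B \<Otimes>\<^sub>M \<mu>"
    using sampling[OF \<mu>] by blast
  then have "sampled_seq e' I \<mu> U V"
    using e' \<mu> by (simp add: sampled_seq_def sampled_seq_axioms_def)
  then interpret sampled_seq e' I \<mu> U V .
  have conc': "r_concave r K1 e' I"
    using conc unfolding r_concave_def by (simp add: norm_eq)
  obtain T where T: "\<And>x y. T (\<lambda>i t. x i t + y i t) = (\<lambda>t. T x t + T y t)"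
    "\<And>c x. T (\<lambda>i t. c * x i t) = (\<lambda>t. c * T x t)" "\<And>x u. sample_limit x u \<Longrightarrow> sample_limit x (T x)"
    using sample_limit_linear by blast
  have main: "L1in (T x)" "dsum_norm e I \<mu> x \<le> L1norm (T x)"
    "L1norm (T x) \<le> \<bar>K1\<bar> * \<bar>K2\<bar> * dsum_norm e I \<mu> x" "0 \<le> dsum_norm e I \<mu> x"
    if x: "x \<in> dsum_space e I \<mu> X" for x
  proof -
    define c where "c i = Lnorm1 \<mu> (x i)" for i
    have xX: "x j \<in> X" if "j \<in> I" for j using x that by (simp add: dsum_space_def)
    then have xi: "integrable \<mu> (x j)" if "j \<in> I" for j using X that by (simp add: lin_subspace_L1_def)
    have conv: "series_conv e I c" using x by (simp add: dsum_space_def c_def[abs_def])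
    have up: "L1norm (sample S x) \<le> \<bar>K1\<bar> * \<bar>K2\<bar> * L1norm (comb e' S c)"
      if S: "finite S" "S \<subseteq> I" for S
      unfolding c_def[abs_def] using S xX xi K2
      by (intro L1norm_sample_le[OF S _ conc' r]) auto
    have low: "L1norm (comb e' S c) \<le> L1norm (sample S x)" if S: "finite S" "S \<subseteq> I" for S
      unfolding c_def[abs_def] using S xi by (intro L1norm_sample_ge[OF S]) auto
    have "\<exists>g. sample_limit x g"
    proof (rule sample_limit_exists[OF xi up])
      show "\<exists>N. \<forall>m\<ge>N. \<forall>n\<ge>m. L1norm (comb e' (I \<inter> {m..<n}) c) < \<epsilon>" if "\<epsilon> > 0" for \<epsilon>
        using E.series_conv_block[OF conv that] by (simp add: norm_eq)
    qed
    then have lim: "sample_limit x (T x)" using T(3) by blast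
    then show TL: "L1in (T x)" by (simp add: sample_limit_def)
    have limT: "(\<lambda>n. L1norm (sample (I \<inter> {..<n}) x)) \<longlonglongrightarrow> L1norm (T x)"
      using lim xi by (intro L1norm_tendsto L1in_sample) (auto simp: sample_limit_def)
    have limc: "(\<lambda>n. L1norm (comb e' (I \<inter> {..<n}) c)) \<longlonglongrightarrow> dsum_norm e I \<mu> x"
      using E.series_norm_lim[OF conv] by (simp add: dsum_norm_def c_def[abs_def] psum_def norm_eq)
    show "dsum_norm e I \<mu> x \<le> L1norm (T x)"
      by (rule LIMSEQ_le[OF limc limT]) (simp add: low)
    show "L1norm (T x) \<le> \<bar>K1\<bar> * \<bar>K2\<bar> * dsum_norm e I \<mu> x"
      by (rule LIMSEQ_le[OF limT tendsto_mult_left[OF limc]]) (simp add: up)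
    show "0 \<le> dsum_norm e I \<mu> x"
      by (rule LIMSEQ_le_const[OF limc]) simp
  qed
  show ?thesis
  proof (rule that[of T, OF T(1,2) main(1,2)])
    show "L1norm (T x) \<le> (1 + \<bar>K1\<bar> * \<bar>K2\<bar>) * dsum_norm e I \<mu> x" if "x \<in> dsum_space e I \<mu> X" for x
      using main(3,4)[OF that] by (simp add: distrib_right)
  qed
qed

section \<open>Khinchine's inequality and maximal functions\<close>

text \<open>A Rademacher sum: \<open>A\<close> is the set of indices with sign plus. Expectations
  over random signs become sums over \<open>Pow S\<close>, which explains the factors
  \<open>2 ^ card S\<close> below.\<close>

definition rad :: "nat set \<Rightarrow> (nat \<Rightarrow> real) \<Rightarrow> nat set \<Rightarrow> real" where
  "rad S a A = (\<Sum>j\<in>S. (if j \<in> A then 1 else - 1) * a j)"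

lemma sum_Pow_insert:
  assumes "finite S" "k \<notin> S"
  shows "(\<Sum>A\<in>Pow (insert k S). F A) = (\<Sum>A\<in>Pow S. F A + (F (insert k A) :: real))"
proof -
  have "inj_on (insert k) (Pow S)" using assms(2) by (auto simp: inj_on_def)
  moreover have "Pow S \<inter> insert k ` Pow S = {}" using assms(2) by auto
  ultimately show ?thesis
    using assms(1) by (simp add: Pow_insert sum.union_disjoint sum.reindex sum.distrib)
qed

lemma rad_insert:
  assumes "finite S" "k \<notin> S" "A \<subseteq> S"
  shows "rad (insert k S) a A = rad S a A - a k"
    and "rad (insert k S) a (insert k A) = rad S a A + a k"
proof -
  have "k \<notin> A" using assms by auto
  then show "rad (insert k S) a A = rad S a A - a k" using assms by (simp add: rad_def)
  have "(\<Sum>j\<in>S. (if j \<in> insert k A then 1 else - 1) * a j) = rad S a A"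
    unfolding rad_def using assms(2) by (intro sum.cong) auto
  then show "rad (insert k S) a (insert k A) = rad S a A + a k"
    using assms unfolding rad_def by simp
qed

lemma sum_rad_insert:
  assumes "finite S" "k \<notin> S"
  shows "(\<Sum>A\<in>Pow (insert k S). (F :: real \<Rightarrow> real) (rad (insert k S) a A))
    = (\<Sum>A\<in>Pow S. F (rad S a A - a k) + F (rad S a A + a k))"
  unfolding sum_Pow_insert[OF assms] using assms by (intro sum.cong) (auto simp: rad_insert)

lemma rad_second_moment:
  assumes "finite S"
  shows "(\<Sum>A\<in>Pow S. (rad S a A)\<^sup>2) = 2 ^ card S * (\<Sum>j\<in>S. (a j)\<^sup>2)"
  using assms
proof (induction S rule: finite_induct)
  case (insert k S)
  have "(\<Sum>A\<in>Pow (insert k S). (rad (insert k S) a A)\<^sup>2) = (\<Sum>A\<in>Pow S. 2 * (rad S a A)\<^sup>2 + 2 * (a k)\<^sup>2)"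
    using sum_rad_insert[OF insert(1,2), of "\<lambda>x. x\<^sup>2" a] by (simp add: power2_eq_square algebra_simps)
  also have "\<dots> = 2 * (\<Sum>A\<in>Pow S. (rad S a A)\<^sup>2) + 2 ^ card S * (2 * (a k)\<^sup>2)"
    using insert(1) by (simp add: sum.distrib card_Pow flip: sum_distrib_left)
  finally show ?case using insert by (simp add: algebra_simps)
qed (simp add: rad_def)

lemma rad_fourth_moment:
  assumes "finite S"
  shows "(\<Sum>A\<in>Pow S. (rad S a A) ^ 4) \<le> 3 * 2 ^ card S * (\<Sum>j\<in>S. (a j)\<^sup>2)\<^sup>2"
  using assms
proof (induction S rule: finite_induct)
  case (insert k S)
  define s where "s = (\<Sum>j\<in>S. (a j)\<^sup>2)"
  have "(\<Sum>A\<in>Pow (insert k S). (rad (insert k S) a A) ^ 4)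
      = (\<Sum>A\<in>Pow S. 2 * (rad S a A) ^ 4 + 12 * (a k)\<^sup>2 * (rad S a A)\<^sup>2 + 2 * (a k) ^ 4)"
    using sum_rad_insert[OF insert(1,2), of "\<lambda>x. x ^ 4" a]
    by (simp add: power2_eq_square power4_eq_xxxx algebra_simps)
  also have "\<dots> = 2 * (\<Sum>A\<in>Pow S. (rad S a A) ^ 4)
      + 12 * (a k)\<^sup>2 * (\<Sum>A\<in>Pow S. (rad S a A)\<^sup>2) + 2 ^ card S * (2 * (a k) ^ 4)"
    using insert(1) by (simp add: sum.distrib card_Pow flip: sum_distrib_left)
  \<comment> \<open>Enlarging the coefficient of \<open>(a k) ^ 4\<close> from 2 to 6 completes the
    square of \<open>s + (a k)\<^sup>2\<close>; this is the origin of the constant 3.\<close>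
  also have "\<dots> \<le> 2 * (3 * 2 ^ card S * s\<^sup>2) + 12 * (a k)\<^sup>2 * (2 ^ card S * s) + 2 ^ card S * (6 * (a k) ^ 4)"
    using insert rad_second_moment[OF insert(1), of a]
    by (intro add_mono mult_left_mono) (auto simp: s_def)
  also have "\<dots> = 3 * 2 ^ card (insert k S) * (s + (a k)\<^sup>2)\<^sup>2"
    using insert by (simp add: power2_eq_square power4_eq_xxxx algebra_simps)
  finally show ?case using insert by (simp add: s_def add.commute)
qed (simp add: rad_def)

lemma sum_sqrt_le:
  fixes v :: "'a \<Rightarrow> real"
  assumes "finite B" "\<And>A. A \<in> B \<Longrightarrow> 0 \<le> v A"
  shows "(\<Sum>A\<in>B. sqrt (v A)) \<le> sqrt (card B * (\<Sum>A\<in>B. v A))"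
proof (rule real_le_rsqrt)
  have "(\<Sum>A\<in>B. 1 * sqrt (v A))\<^sup>2 \<le> (\<Sum>A\<in>B. 1\<^sup>2) * (\<Sum>A\<in>B. (sqrt (v A))\<^sup>2)"
    by (rule Cauchy_Schwarz_ineq_sum)
  also have "(\<Sum>A\<in>B. (sqrt (v A))\<^sup>2) = (\<Sum>A\<in>B. v A)"
    using assms by (intro sum.cong) auto
  finally show "(\<Sum>A\<in>B. sqrt (v A))\<^sup>2 \<le> card B * (\<Sum>A\<in>B. v A)" by simp
qed

lemma Khinchine_upper:
  assumes "finite S"
  shows "(\<Sum>A\<in>Pow S. \<bar>rad S a A\<bar>) \<le> 2 ^ card S * sqrt (\<Sum>j\<in>S. (a j)\<^sup>2)"
proof -
  have "(\<Sum>A\<in>Pow S. \<bar>rad S a A\<bar>) \<le> sqrt (card (Pow S) * (\<Sum>A\<in>Pow S. (rad S a A)\<^sup>2))"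
    using sum_sqrt_le[of "Pow S" "\<lambda>A. (rad S a A)\<^sup>2"] assms by simp
  also have "\<dots> = sqrt ((2 ^ card S)\<^sup>2 * (\<Sum>j\<in>S. (a j)\<^sup>2))"
    unfolding rad_second_moment[OF assms] using assms by (simp add: card_Pow power2_eq_square)
  finally show ?thesis by (simp add: real_sqrt_mult)
qed

lemma Khinchine_lower:
  assumes "finite S"
  shows "2 ^ card S * sqrt (\<Sum>j\<in>S. (a j)\<^sup>2) \<le> 2 * (\<Sum>A\<in>Pow S. \<bar>rad S a A\<bar>)"
proof (cases "(\<Sum>j\<in>S. (a j)\<^sup>2) = 0")
  case True
  then show ?thesis by (simp add: sum_nonneg)
next
  case False
  define \<sigma> where "\<sigma> = sqrt (\<Sum>j\<in>S. (a j)\<^sup>2)"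
  have "(\<Sum>j\<in>S. (a j)\<^sup>2) > 0" using False by (simp add: order_less_le sum_nonneg)
  then have \<sigma>: "\<sigma> > 0" "(\<Sum>j\<in>S. (a j)\<^sup>2) = \<sigma>\<^sup>2" by (auto simp: \<sigma>_def)
  \<comment> \<open>A lower bound for \<open>\<bar>x\<bar>\<close> by second and fourth powers, tight at \<open>\<bar>x\<bar> = 2 \<sigma>\<close>.\<close>
  have pw: "3 / 4 * x\<^sup>2 / \<sigma> - x ^ 4 / (16 * \<sigma> ^ 3) \<le> \<bar>x\<bar>" for x
  proof -
    define y where "y = \<bar>x\<bar> / \<sigma>"
    have y: "y \<ge> 0" "\<bar>x\<bar> = \<sigma> * y" using \<sigma> by (auto simp: y_def)
    have "0 \<le> y * ((y - 2)\<^sup>2 * (y + 4)) / 16" using y by simp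
    also have "y * ((y - 2)\<^sup>2 * (y + 4)) = 16 * y - 12 * y\<^sup>2 + y ^ 4"
      by (simp add: power2_eq_square power4_eq_xxxx algebra_simps)
    also have "\<dots> / 16 = y - (3 / 4 * y\<^sup>2 - y ^ 4 / 16)"
      by (simp add: field_simps)
    finally have "\<sigma> * (3 / 4 * y\<^sup>2 - y ^ 4 / 16) \<le> \<sigma> * y" using \<sigma> by (intro mult_left_mono) auto
    also have "\<sigma> * (3 / 4 * y\<^sup>2 - y ^ 4 / 16) = 3 / 4 * \<bar>x\<bar>\<^sup>2 / \<sigma> - \<bar>x\<bar> ^ 4 / (16 * \<sigma> ^ 3)"
      unfolding y using \<sigma> by (simp add: field_simps power2_eq_square power3_eq_cube power4_eq_xxxx)
    also have "\<bar>x\<bar> ^ 4 = x ^ 4" by simp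
    finally show ?thesis by (simp only: power2_abs flip: y(2))
  qed
  have "(\<Sum>A\<in>Pow S. 3 / 4 * (rad S a A)\<^sup>2 / \<sigma> - (rad S a A) ^ 4 / (16 * \<sigma> ^ 3)) \<le> (\<Sum>A\<in>Pow S. \<bar>rad S a A\<bar>)"
    by (intro sum_mono pw)
  also have "(\<Sum>A\<in>Pow S. 3 / 4 * (rad S a A)\<^sup>2 / \<sigma> - (rad S a A) ^ 4 / (16 * \<sigma> ^ 3))
      = 3 / 4 * (\<Sum>A\<in>Pow S. (rad S a A)\<^sup>2) / \<sigma> - (\<Sum>A\<in>Pow S. (rad S a A) ^ 4) / (16 * \<sigma> ^ 3)"
    by (simp add: sum_subtractf sum_distrib_left sum_divide_distrib)
  finally have "3 / 4 * (2 ^ card S * \<sigma>\<^sup>2) / \<sigma> - (\<Sum>A\<in>Pow S. (rad S a A) ^ 4) / (16 * \<sigma> ^ 3)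
      \<le> (\<Sum>A\<in>Pow S. \<bar>rad S a A\<bar>)"
    by (simp add: rad_second_moment[OF assms] \<sigma>)
  moreover have "(\<Sum>A\<in>Pow S. (rad S a A) ^ 4) / (16 * \<sigma> ^ 3) \<le> (3 * 2 ^ card S * (\<sigma>\<^sup>2)\<^sup>2) / (16 * \<sigma> ^ 3)"
    using rad_fourth_moment[OF assms, of a] \<sigma> by (intro divide_right_mono) auto
  moreover have "(3 * 2 ^ card S * (\<sigma>\<^sup>2)\<^sup>2) / (16 * \<sigma> ^ 3) = 3 / 16 * (2 ^ card S * \<sigma>)"
    "3 / 4 * (2 ^ card S * \<sigma>\<^sup>2) / \<sigma> = 3 / 4 * (2 ^ card S * \<sigma>)"
    using \<sigma> by (auto simp: field_simps power2_eq_square power3_eq_cube)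
  moreover have "0 \<le> 2 ^ card S * \<sigma>" using \<sigma> by simp
  \<comment> \<open>The second and fourth moments leave the factor 3/4 - 3/16 = 9/16, which is at
    least 1/2.\<close>
  ultimately have "2 ^ card S * \<sigma> \<le> 2 * (\<Sum>A\<in>Pow S. \<bar>rad S a A\<bar>)" by linarith
  then show ?thesis by (simp add: \<sigma>_def)
qed

text \<open>Sign choices that differ only at \<open>k\<close> are paired, and \<open>\<bar>x -
  a\<bar> + \<bar>x + a\<bar> \<ge> 2 * \<bar>a\<bar>\<close> is used for each pair.\<close>

lemma abs_le_sum_rad:
  assumes "finite S" "k \<in> S"
  shows "2 ^ card S * \<bar>a k\<bar> \<le> (\<Sum>A\<in>Pow S. \<bar>rad S a A\<bar>)"
proof -
  define R where "R = S - {k}"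
  have R: "finite R" "k \<notin> R" "S = insert k R" using assms by (auto simp: R_def)
  have "2 ^ card S * \<bar>a k\<bar> = (\<Sum>A\<in>Pow R. 2 * \<bar>a k\<bar>)"
    using R by (simp add: card_Pow)
  also have "\<dots> \<le> (\<Sum>A\<in>Pow R. \<bar>rad R a A - a k\<bar> + \<bar>rad R a A + a k\<bar>)"
    by (intro sum_mono) auto
  also have "\<dots> = (\<Sum>A\<in>Pow S. \<bar>rad S a A\<bar>)"
    using sum_rad_insert[OF R(1,2), of abs a] R(3) by simp
  finally show ?thesis .
qed

text \<open>With \<open>M\<close> the lp norm, each entry is at most \<open>M\<close>, so its square
  is at most \<open>\<bar>x i\<bar> powr p * M powr (2 - p)\<close>; summing gives
  \<open>M\<^sup>2\<close>.\<close>

lemma sqrt_sum_le_powr_sum: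
  fixes x :: "nat \<Rightarrow> real"
  assumes "1 \<le> p" "p \<le> 2" "finite S"
  shows "sqrt (\<Sum>i\<in>S. (x i)\<^sup>2) \<le> (\<Sum>i\<in>S. \<bar>x i\<bar> powr p) powr (1 / p)"
proof -
  define M where "M = (\<Sum>i\<in>S. \<bar>x i\<bar> powr p) powr (1 / p)"
  have M: "0 \<le> M" "M powr p = (\<Sum>i\<in>S. \<bar>x i\<bar> powr p)"
    using assms by (auto simp: M_def powr_powr sum_nonneg)
  have le: "\<bar>x i\<bar> \<le> M" if "i \<in> S" for i
  proof -
    have "\<bar>x i\<bar> powr p \<le> M powr p"
      unfolding M using assms that by (intro member_le_sum) auto
    then show ?thesis
      using assms M(1) powr_less_mono2[of p M "\<bar>x i\<bar>"] by (meson leD le_cases not_le order_less_le_trans zero_less_one)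
  qed
  have "(x i)\<^sup>2 \<le> \<bar>x i\<bar> powr p * M powr (2 - p)" if "i \<in> S" for i
  proof (cases "x i = 0")
    case False
    have "(x i)\<^sup>2 = \<bar>x i\<bar> powr p * \<bar>x i\<bar> powr (2 - p)"
      using False by (simp flip: powr_add)
    also have "\<dots> \<le> \<bar>x i\<bar> powr p * M powr (2 - p)"
      using le[OF that] assms by (intro mult_left_mono powr_mono2) auto
    finally show ?thesis .
  qed simp
  then have "(\<Sum>i\<in>S. (x i)\<^sup>2) \<le> (\<Sum>i\<in>S. \<bar>x i\<bar> powr p * M powr (2 - p))" by (rule sum_mono)
  also have "\<dots> = M powr p * M powr (2 - p)" by (simp add: M(2) sum_distrib_right)
  also have "\<dots> = M\<^sup>2" using M(1) by (cases "M = 0") (simp_all flip: powr_add)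
  finally show ?thesis using M(1) unfolding M_def[symmetric] by (simp add: real_le_lsqrt sum_nonneg)
qed

section \<open>Square functions, type p and maximal functions\<close>

context unconditional_seq
begin

text \<open>The L1 norm of the square function. It is equivalent to the norm, and its quadratic
  dependence on the coefficients makes averages over random signs computable.\<close>

definition sqnorm :: "nat set \<Rightarrow> (nat \<Rightarrow> real) \<Rightarrow> real" where
  "sqnorm S b = integral\<^sup>L L1M (\<lambda>t. sqrt (\<Sum>j\<in>S. (b j * e j t)\<^sup>2))"

lemma integrable_square_function:
  assumes S: "finite S" "S \<subseteq> I"
  shows "integrable L1M (\<lambda>t. sqrt (\<Sum>j\<in>S. (b j * e j t)\<^sup>2))"
proof (rule Bochner_Integration.integrable_bound)
  have i: "integrable L1M (e j)" if "j \<in> S" for j using S L1in_e that by (auto simp: L1in_def)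
  then have m: "e j \<in> borel_measurable L1M" if "j \<in> S" for j using that by auto
  show "integrable L1M (\<lambda>t. \<Sum>j\<in>S. \<bar>b j * e j t\<bar>)" using i by auto
  show "(\<lambda>t. sqrt (\<Sum>j\<in>S. (b j * e j t)\<^sup>2)) \<in> borel_measurable L1M" using m by measurable
  show "AE t in L1M. norm (sqrt (\<Sum>j\<in>S. (b j * e j t)\<^sup>2)) \<le> norm (\<Sum>j\<in>S. \<bar>b j * e j t\<bar>)"
    using L2_set_le_sum_abs[of "\<lambda>j. b j * e j _" S] by (intro AE_I2) (simp add: L2_set_def sum_nonneg)
qed

lemma comb_rad: "comb e S (\<lambda>j. (if j \<in> A then 1 else - 1) * b j) t = rad S (\<lambda>j. b j * e j t) A"
  by (simp add: comb_def rad_def mult.assoc)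

lemma sum_norm_eq_integral:
  assumes "finite B" "S \<subseteq> I"
  shows "(\<Sum>A\<in>B. L1norm (comb e S (c A))) = integral\<^sup>L L1M (\<lambda>t. \<Sum>A\<in>B. \<bar>comb e S (c A) t\<bar>)"
    and "integrable L1M (\<lambda>t. \<Sum>A\<in>B. \<bar>comb e S (c A) t\<bar>)"
proof -
  have "integrable L1M (\<lambda>t. \<bar>comb e S (c A) t\<bar>)" for A
    using L1in_comb[OF assms(2)] by (auto simp: L1in_def)
  then show "(\<Sum>A\<in>B. L1norm (comb e S (c A))) = integral\<^sup>L L1M (\<lambda>t. \<Sum>A\<in>B. \<bar>comb e S (c A) t\<bar>)"
    "integrable L1M (\<lambda>t. \<Sum>A\<in>B. \<bar>comb e S (c A) t\<bar>)"
    unfolding L1norm_def by (auto simp: Bochner_Integration.integral_sum)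
qed

text \<open>All sign changes of the coefficients have the same norm, so the norm equals its average
  over signs. Khinchine's inequality can then be applied at each point \<open>t\<close>.\<close>

lemma sum_signs_norm:
  assumes S: "finite S" "S \<subseteq> I"
  shows "2 ^ card S * L1norm (comb e S b) = integral\<^sup>L L1M (\<lambda>t. \<Sum>A\<in>Pow S. \<bar>rad S (\<lambda>j. b j * e j t) A\<bar>)"
    and "integrable L1M (\<lambda>t. \<Sum>A\<in>Pow S. \<bar>rad S (\<lambda>j. b j * e j t) A\<bar>)"
proof -
  have "2 ^ card S * L1norm (comb e S b)
      = (\<Sum>A\<in>Pow S. L1norm (comb e S (\<lambda>j. (if j \<in> A then 1 else - 1) * b j)))"
  proof -
    have "L1norm (comb e S (\<lambda>j. (if j \<in> A then 1 else - 1) * b j)) = L1norm (comb e S b)" for A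
      by (intro norm_sign S) (auto simp: abs_mult)
    then show ?thesis using S by (simp add: card_Pow)
  qed
  then show "2 ^ card S * L1norm (comb e S b) = integral\<^sup>L L1M (\<lambda>t. \<Sum>A\<in>Pow S. \<bar>rad S (\<lambda>j. b j * e j t) A\<bar>)"
    using S by (simp add: sum_norm_eq_integral comb_rad)
  show "integrable L1M (\<lambda>t. \<Sum>A\<in>Pow S. \<bar>rad S (\<lambda>j. b j * e j t) A\<bar>)"
    using S sum_norm_eq_integral(2)[of "Pow S" S "\<lambda>A j. (if j \<in> A then 1 else - 1) * b j"] by (simp add: comb_rad)
qed

lemma norm_le_sqnorm:
  assumes S: "finite S" "S \<subseteq> I"
  shows "L1norm (comb e S b) \<le> sqnorm S b"
proof -
  have "2 ^ card S * L1norm (comb e S b) \<le> integral\<^sup>L L1M (\<lambda>t. 2 ^ card S * sqrt (\<Sum>j\<in>S. (b j * e j t)\<^sup>2))"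
    unfolding sum_signs_norm(1)[OF S]
    using integrable_square_function[OF S] sum_signs_norm(2)[OF S] Khinchine_upper[OF S(1)]
    by (intro integral_mono) auto
  also have "\<dots> = 2 ^ card S * sqnorm S b" by (simp add: sqnorm_def)
  finally show ?thesis by simp
qed

lemma sqnorm_le_norm:
  assumes S: "finite S" "S \<subseteq> I"
  shows "sqnorm S b \<le> 2 * L1norm (comb e S b)"
proof -
  have "2 ^ card S * sqnorm S b = integral\<^sup>L L1M (\<lambda>t. 2 ^ card S * sqrt (\<Sum>j\<in>S. (b j * e j t)\<^sup>2))"
    by (simp add: sqnorm_def)
  also have "\<dots> \<le> integral\<^sup>L L1M (\<lambda>t. 2 * (\<Sum>A\<in>Pow S. \<bar>rad S (\<lambda>j. b j * e j t) A\<bar>))"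
    using integrable_square_function[OF S] sum_signs_norm(2)[OF S] Khinchine_lower[OF S(1)]
    by (intro integral_mono) auto
  also have "\<dots> = 2 ^ card S * (2 * L1norm (comb e S b))"
    using sum_signs_norm(1)[OF S, of b] by simp
  finally show ?thesis by simp
qed

text \<open>Passing to square functions costs nothing, and Cauchy-Schwarz over the signs of the
  vectors produces the coordinatewise l2 sums \<open>c j\<close>. Returning to the norm costs the
  factor 2 of the lower Khinchine inequality. Since \<open>p \<le> 2\<close>, the l2 sums lie below
  the lp sums, to which p-convexity applies.\<close>

lemma type_p:
  fixes xs :: "nat \<Rightarrow> nat \<Rightarrow> real"
  assumes conv: "p_convex p K e I" and p: "1 \<le> p" "p \<le> 2" and S: "finite S" "S \<subseteq> I"
  shows "(\<Sum>A\<in>Pow {..<n}. L1norm (comb e S (\<lambda>j. rad {..<n} (\<lambda>i. xs i j) A)))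
    \<le> 2 ^ n * (2 * K * (\<Sum>i<n. L1norm (comb e S (xs i)) powr p) powr (1 / p))"
proof -
  define c where "c j = sqrt (\<Sum>i<n. (xs i j)\<^sup>2)" for j
  have "(\<Sum>A\<in>Pow {..<n}. L1norm (comb e S (\<lambda>j. rad {..<n} (\<lambda>i. xs i j) A)))
      \<le> (\<Sum>A\<in>Pow {..<n}. sqnorm S (\<lambda>j. rad {..<n} (\<lambda>i. xs i j) A))"
    by (intro sum_mono norm_le_sqnorm S)
  also have "\<dots> = integral\<^sup>L L1M (\<lambda>t. \<Sum>A\<in>Pow {..<n}. sqrt (\<Sum>j\<in>S. (rad {..<n} (\<lambda>i. xs i j) A * e j t)\<^sup>2))"
    unfolding sqnorm_def by (rule Bochner_Integration.integral_sum[symmetric]) (rule integrable_square_function[OF S])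
  also have "\<dots> \<le> integral\<^sup>L L1M (\<lambda>t. 2 ^ n * sqrt (\<Sum>j\<in>S. (c j * e j t)\<^sup>2))"
  proof (rule integral_mono)
    show "integrable L1M (\<lambda>t. \<Sum>A\<in>Pow {..<n}. sqrt (\<Sum>j\<in>S. (rad {..<n} (\<lambda>i. xs i j) A * e j t)\<^sup>2))"
      by (intro Bochner_Integration.integrable_sum integrable_square_function S)
    show "integrable L1M (\<lambda>t. 2 ^ n * sqrt (\<Sum>j\<in>S. (c j * e j t)\<^sup>2))"
      by (intro integrable_mult_right integrable_square_function S)
    fix t
    have "(\<Sum>A\<in>Pow {..<n}. sqrt (\<Sum>j\<in>S. (rad {..<n} (\<lambda>i. xs i j) A * e j t)\<^sup>2))
        \<le> sqrt (card (Pow {..<n}) * (\<Sum>A\<in>Pow {..<n}. \<Sum>j\<in>S. (rad {..<n} (\<lambda>i. xs i j) A * e j t)\<^sup>2))"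
      by (intro sum_sqrt_le) (auto simp: sum_nonneg)
    also have "(\<Sum>A\<in>Pow {..<n}. \<Sum>j\<in>S. (rad {..<n} (\<lambda>i. xs i j) A * e j t)\<^sup>2)
        = (\<Sum>j\<in>S. (\<Sum>A\<in>Pow {..<n}. (rad {..<n} (\<lambda>i. xs i j) A)\<^sup>2) * (e j t)\<^sup>2)"
      by (subst sum.swap) (simp add: power_mult_distrib sum_distrib_right)
    also have "\<dots> = (\<Sum>j\<in>S. 2 ^ n * (c j * e j t)\<^sup>2)"
      by (intro sum.cong refl) (simp add: rad_second_moment c_def power_mult_distrib sum_nonneg)
    also have "\<dots> = 2 ^ n * (\<Sum>j\<in>S. (c j * e j t)\<^sup>2)"
      by (rule sum_distrib_left[symmetric])
    also have "sqrt (card (Pow {..<n}) * (2 ^ n * (\<Sum>j\<in>S. (c j * e j t)\<^sup>2)))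
        = sqrt ((2 ^ n)\<^sup>2 * (\<Sum>j\<in>S. (c j * e j t)\<^sup>2))"
      by (simp add: card_Pow power2_eq_square mult.assoc)
    also have "\<dots> = 2 ^ n * sqrt (\<Sum>j\<in>S. (c j * e j t)\<^sup>2)"
      by (simp add: real_sqrt_mult)
    finally show "(\<Sum>A\<in>Pow {..<n}. sqrt (\<Sum>j\<in>S. (rad {..<n} (\<lambda>i. xs i j) A * e j t)\<^sup>2))
        \<le> 2 ^ n * sqrt (\<Sum>j\<in>S. (c j * e j t)\<^sup>2)" .
  qed
  also have "\<dots> = 2 ^ n * sqnorm S c" by (simp add: sqnorm_def)
  also have "\<dots> \<le> 2 ^ n * (2 * L1norm (comb e S c))"
    by (intro mult_left_mono sqnorm_le_norm S) simp
  also have "L1norm (comb e S c) \<le> L1norm (comb e S (\<lambda>j. (\<Sum>i<n. \<bar>xs i j\<bar> powr p) powr (1 / p)))"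
    using sqrt_sum_le_powr_sum[OF p, of "{..<n}"] by (intro norm_mono S) (simp add: c_def sum_nonneg)
  also have "\<dots> \<le> K * (\<Sum>i<n. L1norm (comb e S (xs i)) powr p) powr (1 / p)"
    using conv S unfolding p_convex_def by blast
  finally show ?thesis by (simp add: mult.assoc)
qed

text \<open>Since \<open>\<bar>x\<^sub>i\<bar>\<close> is bounded by the average of \<open>\<bar>\<Sum>\<plusminus>x\<^sub>j\<bar>\<close> over all signs, type p controls maximal functions.\<close>

lemma maximal_function_bound:
  fixes xs :: "nat \<Rightarrow> nat \<Rightarrow> real"
  assumes conv: "p_convex p K e I" and p: "1 \<le> p" "p \<le> 2" and S: "finite S" "S \<subseteq> I"
    and h: "integrable L1M h" "\<And>t. h t \<le> 1 \<or> (\<exists>i<n. h t \<le> \<bar>comb e S (xs i) t\<bar>)"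
  shows "integral\<^sup>L L1M h \<le> 1 + 2 * K * (\<Sum>i<n. L1norm (comb e S (xs i)) powr p) powr (1 / p)"
proof -
  interpret L: prob_space L1M by (rule prob_space_L1M)
  define c where "c A = (\<lambda>j. rad {..<n} (\<lambda>i. xs i j) A)" for A
  have comb_c: "comb e S (c A) t = rad {..<n} (\<lambda>i. comb e S (xs i) t) A" for A t
    unfolding c_def comb_def rad_def
    by (simp add: sum_distrib_left sum_distrib_right mult.assoc) (rule sum.swap)
  have pw: "2 ^ n * h t \<le> 2 ^ n + (\<Sum>A\<in>Pow {..<n}. \<bar>comb e S (c A) t\<bar>)" for t
  proof (cases "h t \<le> 1")
    case True
    then have "2 ^ n * h t \<le> 2 ^ n" by simp
    then show ?thesis by (simp add: add_increasing2 sum_nonneg)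
  next
    case False
    then obtain i where i: "i < n" "h t \<le> \<bar>comb e S (xs i) t\<bar>" using h(2) by blast
    have "2 ^ n * h t \<le> 2 ^ n * \<bar>comb e S (xs i) t\<bar>" using i by simp
    also have "\<dots> \<le> (\<Sum>A\<in>Pow {..<n}. \<bar>comb e S (c A) t\<bar>)"
      unfolding comb_c using abs_le_sum_rad[of "{..<n}" i] i by simp
    finally show ?thesis by (simp add: add_increasing)
  qed
  note int = sum_norm_eq_integral[of "Pow {..<n}" S c, simplified, OF S(2)]
  have "2 ^ n * integral\<^sup>L L1M h \<le> integral\<^sup>L L1M (\<lambda>t. 2 ^ n + (\<Sum>A\<in>Pow {..<n}. \<bar>comb e S (c A) t\<bar>))"
    unfolding integral_mult_right_zero[symmetric] using h(1) int(2) pw by (intro integral_mono) auto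
  also have "\<dots> = 2 ^ n + (\<Sum>A\<in>Pow {..<n}. L1norm (comb e S (c A)))"
    using int L.prob_space by simp
  also have "\<dots> \<le> 2 ^ n + 2 ^ n * (2 * K * (\<Sum>i<n. L1norm (comb e S (xs i)) powr p) powr (1 / p))"
    unfolding c_def by (intro add_left_mono type_p[OF conv p S])
  also have "\<dots> = 2 ^ n * (1 + 2 * K * (\<Sum>i<n. L1norm (comb e S (xs i)) powr p) powr (1 / p))"
    by (simp add: distrib_left)
  finally show ?thesis by simp
qed

end

section \<open>Dominating functions\<close>

text \<open>The floor value 1 keeps the maximal function, and later the density, away from 0. Lists
  make the enlargement of a family a prepending, under which both the envelope and the cost
  grow.\<close>

fun envelope :: "(real \<Rightarrow> real) list \<Rightarrow> real \<Rightarrow> real" where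
  "envelope [] t = 1"
| "envelope (x # xs) t = max \<bar>x t\<bar> (envelope xs t)"

definition cost :: "real \<Rightarrow> (real \<Rightarrow> real) list \<Rightarrow> real" where
  "cost p xs = (\<Sum>x\<leftarrow>xs. L1norm x powr p)"

lemma envelope_append: "envelope xs t \<le> envelope (ys @ xs) t"
  by (induction ys) auto

lemma envelope_ge_1: "1 \<le> envelope xs t"
  by (induction xs) auto

lemma cost_append: "cost p (ys @ xs) = cost p ys + cost p xs"
  by (simp add: cost_def)

lemma cost_nonneg: "0 \<le> cost p xs"
  unfolding cost_def by (intro sum_list_nonneg) auto

lemma L1in_envelope: "(\<And>x. x \<in> set xs \<Longrightarrow> L1in x) \<Longrightarrow> L1in (envelope xs)"
proof (induction xs)
  case Nil
  interpret L: prob_space L1M by (rule prob_space_L1M)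
  show ?case by (simp add: L1in_def)
next
  case (Cons x xs)
  then have "integrable L1M (\<lambda>t. \<bar>x t\<bar>)" "integrable L1M (envelope xs)" by (auto simp: L1in_def)
  then have "integrable L1M (\<lambda>t. max \<bar>x t\<bar> (envelope xs t))" by (rule integrable_max)
  then show ?case by (simp add: L1in_def)
qed

text \<open>Division by \<open>s powr (1 / p)\<close> leaves
  \<open>s powr (1 - 1 / p) \<le> \<bar>C\<bar>\<close>, and \<open>p / (p - 1)\<close> is the
  inverse of the remaining exponent. Applied with \<open>s\<close> the total cost, it bounds the
  cost of all lists that do at least as well as the empty one.\<close>

lemma le_powr_self_bound:
  fixes s C p :: real
  assumes "1 < p" "0 \<le> s" "s \<le> C * s powr (1 / p)"
  shows "s \<le> \<bar>C\<bar> powr (p / (p - 1))"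
proof (cases "s = 0")
  case False
  then have s: "s > 0" using assms by simp
  have "C * s powr (1 / p) \<le> \<bar>C\<bar> * s powr (1 / p)" by (intro mult_right_mono) auto
  then have "s \<le> \<bar>C\<bar> * s powr (1 / p)" using assms(3) by linarith
  then have "s powr (1 - 1 / p) * s powr (1 / p) \<le> \<bar>C\<bar> * s powr (1 / p)"
    using s by (simp flip: powr_add)
  then have "s powr (1 - 1 / p) \<le> \<bar>C\<bar>" using s by simp
  then have "(s powr (1 - 1 / p)) powr (p / (p - 1)) \<le> \<bar>C\<bar> powr (p / (p - 1))"
    using assms by (intro powr_mono2) auto
  also have "(s powr (1 - 1 / p)) powr (p / (p - 1)) = s"
  proof -
    have "(1 - 1 / p) * (p / (p - 1)) = 1" using assms by (simp add: field_simps)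
    then show ?thesis using s by (simp only: powr_powr powr_one)
  qed
  finally show ?thesis .
qed simp

text \<open>Greedily enlarge finite maximal functions until, in the limit, no further element increases the
  integral by more than its cost.\<close>

lemma dominating_function:
  assumes p: "1 < p" and X: "\<And>x. x \<in> X \<Longrightarrow> L1in x"
    and bound: "\<And>xs. set xs \<subseteq> X \<Longrightarrow> integral\<^sup>L L1M (envelope xs) \<le> 1 + C * cost p xs powr (1 / p)"
  obtains g where "g \<in> borel_measurable borel" "L1in g" "\<And>t. 1 \<le> g t"
    "integral\<^sup>L L1M g \<le> 1 + \<bar>C\<bar> * (\<bar>C\<bar> powr (p / (p - 1))) powr (1 / p)"
    "\<And>x. x \<in> X \<Longrightarrow> integral\<^sup>L L1M (\<lambda>t. max \<bar>x t\<bar> (g t)) \<le> integral\<^sup>L L1M g + L1norm x powr p"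
proof -
  interpret L: prob_space L1M by (rule prob_space_L1M)
  define D where "D = \<bar>C\<bar> powr (p / (p - 1))"
  \<comment> \<open>The gain in the integral minus its price. For the empty list the value is
    1.\<close>
  define J where "J xs = integral\<^sup>L L1M (envelope xs) - cost p xs" for xs
  have L1: "integrable L1M (envelope xs)" if "set xs \<subseteq> X" for xs
    using L1in_envelope X that unfolding L1in_def by blast
  have small: "cost p xs \<le> D" "integral\<^sup>L L1M (envelope xs) \<le> 1 + \<bar>C\<bar> * D powr (1 / p)"
    if "set xs \<subseteq> X" "1 \<le> J xs" for xs
  proof -
    have "cost p xs \<le> C * cost p xs powr (1 / p)" using bound[OF that(1)] that(2) by (simp add: J_def)
    then show *: "cost p xs \<le> D" unfolding D_def by (rule le_powr_self_bound[OF p cost_nonneg])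
    have "C * cost p xs powr (1 / p) \<le> \<bar>C\<bar> * D powr (1 / p)"
      using * cost_nonneg p by (intro mult_mono powr_mono2) auto
    then show "integral\<^sup>L L1M (envelope xs) \<le> 1 + \<bar>C\<bar> * D powr (1 / p)" using bound[OF that(1)] by linarith
  qed
  have J_bound: "J xs \<le> 1 + \<bar>C\<bar> * D powr (1 / p)" if "set xs \<subseteq> X" for xs
  proof (cases "1 \<le> J xs")
    case True
    then show ?thesis using small(2)[OF that] cost_nonneg[of p xs] by (simp add: J_def)
  next
    case False
    have "0 \<le> \<bar>C\<bar> * D powr (1 / p)" by simp
    then show ?thesis using False by linarith
  qed
  have step: "\<exists>ys. set ys \<subseteq> X \<and> J xs \<le> J (ys @ xs) \<and> (\<forall>zs. set zs \<subseteq> X \<longrightarrow> J (zs @ xs) \<le> J (ys @ xs) + \<epsilon>)"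
    if xs: "set xs \<subseteq> X" and "\<epsilon> > 0" for xs \<epsilon>
  proof -
    define W where "W = (\<lambda>zs. J (zs @ xs)) ` {zs. set zs \<subseteq> X}"
    have bdd: "bdd_above W" unfolding W_def by (rule bdd_aboveI2, rule J_bound) (use xs in auto)
    have JW: "J xs \<in> W" unfolding W_def by (intro image_eqI[of _ _ "[]"]) auto
    then have ne: "W \<noteq> {}" by blast
    have "Sup W - \<epsilon> < Sup W" using \<open>\<epsilon> > 0\<close> by simp
    then obtain w where "w \<in> W" "Sup W - \<epsilon> < w" using less_cSup_iff[OF ne bdd] by blast
    \<comment> \<open>The larger of \<open>w\<close> and \<open>J xs\<close> is taken, so that the
      new value is nearly optimal and also no worse than the old one.\<close>
    then obtain w' where w': "w' \<in> W" "Sup W - \<epsilon> < w'" "J xs \<le> w'"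
      using JW by (metis le_cases order_less_le_trans)
    then obtain ys where ys: "set ys \<subseteq> X" "w' = J (ys @ xs)" unfolding W_def by blast
    have "J (zs @ xs) \<le> J (ys @ xs) + \<epsilon>" if "set zs \<subseteq> X" for zs
    proof -
      have "J (zs @ xs) \<le> Sup W" using that by (intro cSup_upper bdd) (auto simp: W_def)
      then show ?thesis using w' ys by simp
    qed
    then show ?thesis using ys w' by blast
  qed
  define good where "good n xs xs' \<longleftrightarrow> (\<exists>ys. xs' = ys @ xs) \<and> J xs \<le> J xs' \<and>
      (\<forall>zs. set zs \<subseteq> X \<longrightarrow> J (zs @ xs) \<le> J xs' + (1/2) ^ n)" for n :: nat and xs xs'
  \<comment> \<open>The invariant \<open>1 \<le> J (xs n)\<close> is what bounds cost and integral
    uniformly in \<open>n\<close>. It persists because \<open>J\<close> never decreases along the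
    choice.\<close>
  have "\<exists>xs. \<forall>n. (set (xs n) \<subseteq> X \<and> 1 \<le> J (xs n)) \<and> good n (xs n) (xs (Suc n))"
  proof (rule dependent_nat_choice)
    show "\<exists>xs. set xs \<subseteq> X \<and> 1 \<le> J xs"
    proof (rule exI[of _ "[]"])
      have "envelope [] = (\<lambda>t. 1)" by auto
      then show "set [] \<subseteq> X \<and> 1 \<le> J []" using L.prob_space by (simp add: J_def cost_def)
    qed
  next
    fix xs and n :: nat assume xs: "set xs \<subseteq> X \<and> 1 \<le> J xs"
    obtain ys where "set ys \<subseteq> X" "J xs \<le> J (ys @ xs)"
      "\<forall>zs. set zs \<subseteq> X \<longrightarrow> J (zs @ xs) \<le> J (ys @ xs) + (1/2) ^ n"
      using step[of xs "(1/2) ^ n"] xs by auto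
    then show "\<exists>xs'. (set xs' \<subseteq> X \<and> 1 \<le> J xs') \<and> good n xs xs'"
      using xs by (intro exI[of _ "ys @ xs"]) (auto simp: good_def)
  qed
  then obtain xs where xs: "\<And>n. set (xs n) \<subseteq> X" "\<And>n. 1 \<le> J (xs n)" "\<And>n. good n (xs n) (xs (Suc n))" by blast
  define G where "G n = envelope (xs n)" for n
  have Gi: "integrable L1M (G n)" for n unfolding G_def by (intro L1 xs)
  have G_Suc: "G n t \<le> G (Suc n) t" and cost_Suc: "cost p (xs n) \<le> cost p (xs (Suc n))" for n t
    using xs(3)[of n] cost_nonneg[of p] unfolding good_def G_def by (auto simp: envelope_append cost_append)
  have G_mono: "G m t \<le> G n t" if "m \<le> n" for m n t
    using that by (rule lift_Suc_mono_le[of "\<lambda>n. G n t", rotated]) (rule G_Suc)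
  define a where "a n = integral\<^sup>L L1M (G n)" for n
  have a_bound: "a n \<le> 1 + \<bar>C\<bar> * D powr (1 / p)" for n
    unfolding a_def G_def by (rule small(2)[OF xs(1,2)])
  have "incseq a" unfolding a_def incseq_def using Gi G_mono by (auto intro!: integral_mono)
  then obtain A where A: "a \<longlonglongrightarrow> A" using incseq_convergent[of a] a_bound by blast
  have diff: "L1norm (\<lambda>t. G m t - G n t) = a n - a m" if "m \<le> n" for m n
  proof -
    have "L1norm (\<lambda>t. G m t - G n t) = integral\<^sup>L L1M (\<lambda>t. G n t - G m t)"
    proof -
      have "\<bar>G m t - G n t\<bar> = G n t - G m t" for t using G_mono[OF that, of t] by simp
      then show ?thesis unfolding L1norm_def by simp
    qed
    then show ?thesis using Gi by (simp add: a_def)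
  qed
  have G_Cauchy: "\<exists>N. \<forall>m\<ge>N. \<forall>n\<ge>m. L1norm (\<lambda>t. G m t - G n t) < \<epsilon>" if "\<epsilon> > 0" for \<epsilon>
  proof -
    have "Cauchy a" using A by (rule LIMSEQ_imp_Cauchy)
    from CauchyD[OF this that] obtain N where N: "\<forall>m\<ge>N. \<forall>n\<ge>N. norm (a m - a n) < \<epsilon>" by blast
    have "L1norm (\<lambda>t. G m t - G n t) < \<epsilon>" if "m \<ge> N" "n \<ge> m" for m n
    proof -
      have "norm (a m - a n) < \<epsilon>" using N that by simp
      then show ?thesis unfolding diff[OF that(2)] by simp
    qed
    then show ?thesis by blast
  qed
  have "L1in (G n)" for n using Gi by (simp add: L1in_def)
  from L1_complete[OF this G_Cauchy] obtain g0 where g0: "g0 \<in> borel_measurable borel" "L1in g0" "(\<lambda>n. L1norm (\<lambda>t. G n t - g0 t)) \<longlonglongrightarrow> 0"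
    by blast
  \<comment> \<open>The limit \<open>g0\<close> is known to be at least 1 only almost everywhere.
    Taking the maximum with 1 gives the bound at every point and, as \<open>G n\<close> is at least
    1, does not increase the distance to \<open>G n\<close>.\<close>
  define g where "g t = max 1 (g0 t)" for t
  have g: "g \<in> borel_measurable borel" "\<And>t. 1 \<le> g t" "integrable L1M g"
    using g0 unfolding g_def[abs_def] L1in_def by auto
  have lim: "(\<lambda>n. L1norm (\<lambda>t. G n t - g t)) \<longlonglongrightarrow> 0"
  proof (rule Lim_null_comparison[OF _ g0(3)], intro always_eventually allI)
    fix n
    have "\<bar>G n t - g t\<bar> \<le> \<bar>G n t - g0 t\<bar>" for t
      using envelope_ge_1[of "xs n" t] by (auto simp: g_def G_def)
    then show "norm (L1norm (\<lambda>t. G n t - g t)) \<le> L1norm (\<lambda>t. G n t - g0 t)"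
      using Gi g g0(2) unfolding L1norm_def L1in_def by (simp, intro integral_mono) auto
  qed
  \<comment> \<open>Used for \<open>G n\<close> itself and for its maximum with a fixed function;
    the latter is allowed because the maximum is 1-Lipschitz in each argument.\<close>
  have lim_int: "(\<lambda>n. integral\<^sup>L L1M (f n)) \<longlonglongrightarrow> integral\<^sup>L L1M h"
    if "\<And>n. integrable L1M (f n)" "integrable L1M h" "\<And>n t. \<bar>f n t - h t\<bar> \<le> \<bar>G n t - g t\<bar>" for f h
  proof -
    have "(\<lambda>n. integral\<^sup>L L1M (f n) - integral\<^sup>L L1M h) \<longlonglongrightarrow> 0"
    proof (rule Lim_null_comparison[OF _ lim], intro always_eventually allI)
      fix n
      have "norm (integral\<^sup>L L1M (f n) - integral\<^sup>L L1M h) = \<bar>integral\<^sup>L L1M (\<lambda>t. f n t - h t)\<bar>"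
        using that by simp
      also have "\<dots> \<le> integral\<^sup>L L1M (\<lambda>t. \<bar>f n t - h t\<bar>)" by (rule integral_abs_bound)
      also have "\<dots> \<le> L1norm (\<lambda>t. G n t - g t)"
        unfolding L1norm_def using that Gi g by (intro integral_mono) auto
      finally show "norm (integral\<^sup>L L1M (f n) - integral\<^sup>L L1M h) \<le> L1norm (\<lambda>t. G n t - g t)" .
    qed
    then show ?thesis by (simp add: LIM_zero_iff)
  qed
  have a_lim: "a \<longlonglongrightarrow> integral\<^sup>L L1M g" unfolding a_def by (rule lim_int) (simp_all add: Gi g)
  show ?thesis
  proof (rule that[OF g(1) _ g(2)])
    show "L1in g" using g by (simp add: L1in_def)
    show "integral\<^sup>L L1M g \<le> 1 + \<bar>C\<bar> * (\<bar>C\<bar> powr (p / (p - 1))) powr (1 / p)"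
      using a_lim a_bound unfolding D_def by (intro LIMSEQ_le_const2) auto
    fix x assume x: "x \<in> X"
    then have xi: "integrable L1M (\<lambda>t. \<bar>x t\<bar>)" using X by (simp add: L1in_def)
    have "integral\<^sup>L L1M (\<lambda>t. max \<bar>x t\<bar> (G n t)) \<le> a (Suc n) + L1norm x powr p + (1/2) ^ n" for n
    proof -
      \<comment> \<open>The extension by \<open>x\<close> competes with the chosen extension
        \<open>xs (Suc n)\<close>. The cost of \<open>xs n\<close> is at most that of
        \<open>xs (Suc n)\<close>, so in the comparison of integrals only the cost of
        \<open>x\<close> remains.\<close>
      have "J ([x] @ xs n) \<le> J (xs (Suc n)) + (1/2) ^ n"
        using xs(3)[of n] x unfolding good_def by (metis empty_subsetI insert_subset list.set)
      moreover have "envelope (x # xs n) = (\<lambda>t. max \<bar>x t\<bar> (G n t))" by (auto simp: G_def)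
      ultimately show ?thesis
        using cost_Suc[of n] by (simp add: J_def cost_def a_def G_def)
    qed
    moreover have "(\<lambda>n. integral\<^sup>L L1M (\<lambda>t. max \<bar>x t\<bar> (G n t))) \<longlonglongrightarrow> integral\<^sup>L L1M (\<lambda>t. max \<bar>x t\<bar> (g t))"
      using xi Gi g by (intro lim_int integrable_max) auto
    moreover have "(\<lambda>n. a (Suc n) + L1norm x powr p + (1/2) ^ n) \<longlonglongrightarrow> integral\<^sup>L L1M g + L1norm x powr p + 0"
      by (intro tendsto_intros LIMSEQ_Suc a_lim LIMSEQ_power_zero) simp
    ultimately show "integral\<^sup>L L1M (\<lambda>t. max \<bar>x t\<bar> (g t)) \<le> integral\<^sup>L L1M g + L1norm x powr p"
      using LIMSEQ_le[of _ _ _ "integral\<^sup>L L1M g + L1norm x powr p + 0"] by fastforce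
  qed
qed

section \<open>Weighted power bounds\<close>

text \<open>Where \<open>y \<le> 2 * g\<close> one factor \<open>y / g\<close> raised to
  \<open>r - 1\<close> is at most \<open>2 powr (r - 1)\<close>. Otherwise
  \<open>y / (2 * g)\<close> lies between \<open>2 ^ k\<close> and \<open>2 * 2 ^ k\<close> for some
  \<open>k\<close>. Then \<open>(1/2) ^ k * y\<close> exceeds \<open>g\<close> by at least
  \<open>g\<close>, and \<open>y / g \<le> 4 * 2 ^ k\<close> yields the factor
  \<open>4 powr r * (2 powr r) ^ k\<close>.\<close>

lemma powr_layer_bound:
  fixes y g r :: real
  assumes r: "1 \<le> r" and g: "0 < g" and y: "0 \<le> y"
  shows "y powr r * g powr (1 - r) \<le> 2 powr (r - 1) * y \<or>
    (\<exists>k::nat. y powr r * g powr (1 - r) \<le> 4 powr r * (2 powr r) ^ k * max 0 ((1/2) ^ k * y - g))"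
proof (cases "y \<le> 2 * g")
  case True
  show ?thesis
  proof (cases "y = 0")
    case False
    have "y powr r * g powr (1 - r) = y * (y / g) powr (r - 1)"
      using False y g by (simp add: powr_divide powr_diff powr_minus field_simps)
    also have "\<dots> \<le> y * 2 powr (r - 1)"
      using True y g r by (intro mult_left_mono powr_mono2) (auto simp: field_simps)
    finally show ?thesis by (simp add: mult.commute)
  qed simp
next
  case False
  define z where "z = y / (2 * g)"
  have z: "z > 1" "y = 2 * g * z" using False g by (auto simp: z_def field_simps)
  obtain n where "z < 2 ^ n" using real_arch_pow[of 2 z] by auto
  define m where "m = (LEAST n. z < (2::real) ^ n)"
  have m: "z < 2 ^ m" unfolding m_def using \<open>z < 2 ^ n\<close> by (rule LeastI)
  then obtain k where k: "m = Suc k" using z by (cases m) auto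
  have "\<not> z < 2 ^ k" using not_less_Least[of k "\<lambda>n. z < (2::real) ^ n"] k by (simp add: m_def)
  then have z2: "2 ^ k \<le> z" "z \<le> 2 * 2 ^ k" using m k by auto
  have gap: "g \<le> (1/2) ^ k * y - g"
  proof -
    have "2 * g * 1 \<le> 2 * g * (z / 2 ^ k)" using z2 g by (intro mult_left_mono) auto
    then show ?thesis by (simp add: z(2) power_divide)
  qed
  have "y powr r * g powr (1 - r) = g * (y / g) powr r"
    using False y g by (simp add: powr_divide powr_diff powr_minus field_simps)
  also have "\<dots> \<le> g * (4 * 2 ^ k) powr r"
    using z2 z g r by (intro mult_left_mono powr_mono2) auto
  also have "(4 * 2 ^ k) powr r = 4 powr r * (2 powr r) ^ k"
    by (simp add: powr_mult powr_power powr_powr flip: powr_realpow) (simp add: mult.commute)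
  also have "g * \<dots> \<le> max 0 ((1/2) ^ k * y - g) * (4 powr r * (2 powr r) ^ k)"
    using gap by (intro mult_right_mono) auto
  finally show ?thesis by (intro disjI2 exI[of _ k]) (simp add: mult.commute)
qed

text \<open>The constant is the total of the bounds \<open>4\<^sup>r 2\<^sup>k\<^sup>r 2\<^sup>-\<^sup>k\<^sup>p\<close> for the layers \<open>k\<close> of the previous lemma,
  plus the contribution of the set where \<open>y \<le> 2 g\<close>.\<close>

definition weight_const :: "real \<Rightarrow> real \<Rightarrow> real" where
  "weight_const r p = 2 powr (r - 1) + 4 powr r / (1 - 2 powr (r - p))"

text \<open>Domination at \<open>l = (1/2) ^ k\<close> says that the excess of
  \<open>(1/2) ^ k * \<bar>y\<bar>\<close> over \<open>g\<close> has integral at most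
  \<open>2 powr (- p)\<close> to the power \<open>k\<close>. Against the layer factors this gives a
  geometric series of ratio \<open>2 powr (r - p)\<close>. Nonnegative integrals allow summation
  over \<open>k\<close> before integrability of the left side is known.\<close>

lemma weighted_powr_bound_unit:
  assumes r: "1 \<le> r" "r < p" and g: "g \<in> borel_measurable borel" "L1in g" "\<And>t. 1 \<le> g t"
    and y: "L1in y" "L1norm y = 1"
    and dom: "\<And>l. 0 \<le> l \<Longrightarrow> integral\<^sup>L L1M (\<lambda>t. max (l * \<bar>y t\<bar>) (g t)) \<le> integral\<^sup>L L1M g + l powr p"
  shows "(\<integral>\<^sup>+t. ennreal (\<bar>y t\<bar> powr r * g t powr (1 - r)) \<partial>L1M) \<le> ennreal (weight_const r p)"
proof -
  define h where "h k t = 4 powr r * (2 powr r) ^ k * max 0 ((1/2) ^ k * \<bar>y t\<bar> - g t)" for k :: nat and t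
  have yi: "integrable L1M y" and gi: "integrable L1M g" using y g by (auto simp: L1in_def)
  then have ym [measurable]: "y \<in> borel_measurable L1M" and gm [measurable]: "g \<in> borel_measurable L1M" by auto
  have max_eq: "max 0 ((1/2) ^ k * \<bar>y t\<bar> - g t) = max ((1/2) ^ k * \<bar>y t\<bar>) (g t) - g t" for k :: nat and t
    by (auto simp: max_def)
  have hi: "integrable L1M (h k)" for k
    unfolding h_def[abs_def] max_eq using yi gi
    by (intro integrable_mult_right Bochner_Integration.integrable_diff integrable_max integrable_abs) auto
  have h0: "0 \<le> h k t" for k t by (simp add: h_def)
  have int_h: "integral\<^sup>L L1M (h k) \<le> 4 powr r * (2 powr (r - p)) ^ k" for k
  proof -
    have mi: "integrable L1M (\<lambda>t. max ((1/2) ^ k * \<bar>y t\<bar>) (g t))"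
      using yi gi by (intro integrable_max integrable_mult_right integrable_abs)
    have "integral\<^sup>L L1M (h k) = 4 powr r * (2 powr r) ^ k *
        (integral\<^sup>L L1M (\<lambda>t. max ((1/2) ^ k * \<bar>y t\<bar>) (g t)) - integral\<^sup>L L1M g)"
      unfolding h_def[abs_def] max_eq using mi gi by simp
    also have "\<dots> \<le> 4 powr r * (2 powr r) ^ k * ((1/2) ^ k) powr p"
      using dom[of "(1/2) ^ k"] by (intro mult_left_mono) auto
    also have "((1/2) ^ k) powr p = (2 powr (- p)) ^ k"
      by (simp add: powr_minus powr_divide power_divide powr_power powr_powr inverse_eq_divide flip: powr_realpow)
        (simp add: mult.commute)
    also have "4 powr r * (2 powr r) ^ k * (2 powr (- p)) ^ k = 4 powr r * (2 powr (r - p)) ^ k"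
      by (simp add: mult.assoc powr_diff powr_minus divide_inverse flip: power_mult_distrib)
    finally show ?thesis .
  qed
  have q: "0 \<le> 2 powr (r - p)" "2 powr (r - p) < 1"
    using r powr_less_mono[of "r - p" 0 2] by auto
  have "(\<integral>\<^sup>+t. ennreal (\<bar>y t\<bar> powr r * g t powr (1 - r)) \<partial>L1M)
      \<le> (\<integral>\<^sup>+t. ennreal (2 powr (r - 1) * \<bar>y t\<bar>) + (\<Sum>k. ennreal (h k t)) \<partial>L1M)"
  proof (rule nn_integral_mono)
    fix t
    have "0 < g t" using g(3)[of t] by simp
    from powr_layer_bound[OF r(1) this, of "\<bar>y t\<bar>"]
    consider "\<bar>y t\<bar> powr r * g t powr (1 - r) \<le> 2 powr (r - 1) * \<bar>y t\<bar>"
      | k where "\<bar>y t\<bar> powr r * g t powr (1 - r) \<le> h k t" unfolding h_def by auto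
    then show "ennreal (\<bar>y t\<bar> powr r * g t powr (1 - r)) \<le> ennreal (2 powr (r - 1) * \<bar>y t\<bar>) + (\<Sum>k. ennreal (h k t))"
    proof cases
      case 1
      then show ?thesis by (intro order_trans[OF ennreal_leI[OF 1]]) simp
    next
      case 2
      have "ennreal (h k t) \<le> (\<Sum>k. ennreal (h k t))"
        using sum_le_suminf[of "\<lambda>k. ennreal (h k t)" "{k}"] by simp
      then show ?thesis
        by (intro order_trans[OF ennreal_leI[OF 2]]) (simp add: add_increasing)
    qed
  qed
  also have "\<dots> = (\<integral>\<^sup>+t. ennreal (2 powr (r - 1) * \<bar>y t\<bar>) \<partial>L1M) + (\<Sum>k. \<integral>\<^sup>+t. ennreal (h k t) \<partial>L1M)"
  proof -
    have [measurable]: "h k \<in> borel_measurable L1M" for k using hi by auto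
    show ?thesis by (subst nn_integral_add, simp, simp) (simp add: nn_integral_suminf)
  qed
  also have "(\<integral>\<^sup>+t. ennreal (2 powr (r - 1) * \<bar>y t\<bar>) \<partial>L1M) = ennreal (2 powr (r - 1))"
    using yi y(2) by (subst nn_integral_eq_integral) (auto simp: L1norm_def)
  also have "(\<Sum>k. \<integral>\<^sup>+t. ennreal (h k t) \<partial>L1M) \<le> (\<Sum>k. ennreal (4 powr r * (2 powr (r - p)) ^ k))"
    by (intro suminf_le summableI) (subst nn_integral_eq_integral[OF hi], auto simp: h0 intro!: ennreal_leI int_h)
  also have "\<dots> = ennreal (4 powr r / (1 - 2 powr (r - p)))"
    using sums_mult[OF geometric_sums[of "2 powr (r - p)"], of "4 powr r"] q
    by (intro suminf_ennreal_eq) auto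
  also have "ennreal (2 powr (r - 1)) + \<dots> = ennreal (weight_const r p)"
    unfolding weight_const_def using q by (intro ennreal_plus[symmetric]) auto
  finally show ?thesis by (simp add: add_left_mono)
qed

text \<open>Both sides are homogeneous of degree \<open>r\<close> in \<open>y\<close>, so
  \<open>y\<close> is normalized; a function of norm 0 vanishes almost everywhere. The bound on the
  nonnegative integral also yields integrability.\<close>

lemma weighted_powr_bound:
  assumes r: "1 \<le> r" "r < p" and g: "g \<in> borel_measurable borel" "L1in g" "\<And>t. 1 \<le> g t"
    and y: "L1in y"
    and dom: "\<And>l. 0 \<le> l \<Longrightarrow> integral\<^sup>L L1M (\<lambda>t. max (l * \<bar>y t\<bar>) (g t)) \<le> integral\<^sup>L L1M g + (l * L1norm y) powr p"
  shows "integrable L1M (\<lambda>t. \<bar>y t\<bar> powr r * g t powr (1 - r))"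
    and "integral\<^sup>L L1M (\<lambda>t. \<bar>y t\<bar> powr r * g t powr (1 - r)) \<le> weight_const r p * L1norm y powr r"
proof -
  have yi: "integrable L1M y" and gi: "integrable L1M g" using y g by (auto simp: L1in_def)
  then have ym [measurable]: "y \<in> borel_measurable L1M" and gm [measurable]: "g \<in> borel_measurable L1M" by auto
  have B: "0 \<le> weight_const r p"
    using r powr_less_mono[of "r - p" 0 2] by (auto simp: weight_const_def)
  have le: "(\<integral>\<^sup>+t. ennreal (\<bar>y t\<bar> powr r * g t powr (1 - r)) \<partial>L1M) \<le> ennreal (weight_const r p * L1norm y powr r)"
  proof (cases "L1norm y = 0")
    case True
    then have "AE t in L1M. \<bar>y t\<bar> = 0"
      using yi unfolding L1norm_def by (subst (asm) integral_nonneg_eq_0_iff_AE) auto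
    then have "(\<integral>\<^sup>+t. ennreal (\<bar>y t\<bar> powr r * g t powr (1 - r)) \<partial>L1M) = (\<integral>\<^sup>+t. 0 \<partial>L1M)"
      by (intro nn_integral_cong_AE) (auto elim!: eventually_mono)
    then show ?thesis by simp
  next
    case False
    define N where "N = L1norm y"
    have N: "N > 0" using False by (simp add: N_def order_less_le)
    define z where "z t = y t / N" for t
    have zy: "L1in z" "L1norm z = 1"
      using y N L1norm_scale[of "1 / N" y] by (auto simp: z_def[abs_def] L1in_def N_def)
    have "(\<integral>\<^sup>+t. ennreal (\<bar>z t\<bar> powr r * g t powr (1 - r)) \<partial>L1M) \<le> ennreal (weight_const r p)"
    proof (rule weighted_powr_bound_unit[OF r g zy])
      fix l :: real assume "0 \<le> l"
      then show "integral\<^sup>L L1M (\<lambda>t. max (l * \<bar>z t\<bar>) (g t)) \<le> integral\<^sup>L L1M g + l powr p"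
        using dom[of "l / N"] N by (simp add: z_def abs_divide N_def[symmetric])
    qed
    then have "ennreal (N powr r) * (\<integral>\<^sup>+t. ennreal (\<bar>z t\<bar> powr r * g t powr (1 - r)) \<partial>L1M)
        \<le> ennreal (N powr r) * ennreal (weight_const r p)" by (rule mult_left_mono) simp
    moreover have "ennreal (N powr r) * (\<integral>\<^sup>+t. ennreal (\<bar>z t\<bar> powr r * g t powr (1 - r)) \<partial>L1M)
        = (\<integral>\<^sup>+t. ennreal (\<bar>y t\<bar> powr r * g t powr (1 - r)) \<partial>L1M)"
    proof -
      have [measurable]: "z \<in> borel_measurable L1M" unfolding z_def[abs_def] by measurable
      have "ennreal (N powr r) * ennreal (\<bar>z t\<bar> powr r * g t powr (1 - r)) = ennreal (\<bar>y t\<bar> powr r * g t powr (1 - r))" for t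
        using N by (simp add: z_def abs_divide powr_divide flip: ennreal_mult)
      then show ?thesis by (subst nn_integral_cmult[symmetric]) auto
    qed
    ultimately show ?thesis using B by (simp add: N_def mult.commute flip: ennreal_mult)
  qed
  show int: "integrable L1M (\<lambda>t. \<bar>y t\<bar> powr r * g t powr (1 - r))"
    by (rule integrableI_bounded) (use le in \<open>auto intro: order_le_less_trans\<close>)
  then show "integral\<^sup>L L1M (\<lambda>t. \<bar>y t\<bar> powr r * g t powr (1 - r)) \<le> weight_const r p * L1norm y powr r"
    using le B by (subst (asm) nn_integral_eq_integral) auto
qed

section \<open>The finite span, its closure and the domination inequality\<close>

context unconditional_seq
begin

definition fin_span :: "(real \<Rightarrow> real) set" where
  "fin_span = {comb e S c | S c. finite S \<and> S \<subseteq> I}"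

text \<open>p-convexity speaks of coefficient vectors on a common finite set, so the members of the
  list are all rewritten over the union \<open>U\<close> of their supports, with coefficients 0
  elsewhere.\<close>

lemma envelope_fin_span_bound:
  assumes conv: "p_convex p K e I" and p: "1 \<le> p" "p \<le> 2" and xs: "set xs \<subseteq> fin_span"
  shows "integral\<^sup>L L1M (envelope xs) \<le> 1 + 2 * K * cost p xs powr (1 / p)"
proof -
  have "\<exists>S c. finite S \<and> S \<subseteq> I \<and> xs ! i = comb e S c" if "i < length xs" for i
    using xs nth_mem[OF that] unfolding fin_span_def by blast
  then obtain S c where Sc: "\<And>i. i < length xs \<Longrightarrow> finite (S i) \<and> S i \<subseteq> I \<and> xs ! i = comb e (S i) (c i)" by metis
  define U where "U = (\<Union>i<length xs. S i)"
  define c' where "c' i j = (if j \<in> S i then c i j else 0)" for i j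
  have U: "finite U" "U \<subseteq> I" using Sc by (auto simp: U_def)
  have eq: "xs ! i = comb e U (c' i)" if "i < length xs" for i
  proof -
    have "comb e U (c' i) t = comb e (S i) (c i) t" for t
      unfolding comb_def c'_def using Sc[OF that] U(1) that
      by (intro sum.mono_neutral_cong_right) (auto simp: U_def)
    then show ?thesis using Sc[OF that] by auto
  qed
  have L1: "L1in x" if "x \<in> set xs" for x using that xs L1in_comb by (auto simp: fin_span_def)
  have env: "envelope ys t \<le> 1 \<or> (\<exists>i<length ys. envelope ys t \<le> \<bar>(ys ! i) t\<bar>)" for ys t
  proof (induction ys)
    case (Cons y ys)
    then show ?case by (auto simp: max_def intro: exI[of _ 0] exI[of _ "Suc _"])
  qed simp
  have "integral\<^sup>L L1M (envelope xs) \<le> 1 + 2 * K * (\<Sum>i<length xs. L1norm (comb e U (c' i)) powr p) powr (1 / p)"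
  proof (rule maximal_function_bound[OF conv p U])
    show "integrable L1M (envelope xs)" using L1in_envelope[OF L1] by (simp add: L1in_def)
    show "envelope xs t \<le> 1 \<or> (\<exists>i<length xs. envelope xs t \<le> \<bar>comb e U (c' i) t\<bar>)" for t
      using env[of xs t] eq by metis
  qed
  also have "(\<Sum>i<length xs. L1norm (comb e U (c' i)) powr p) = cost p xs"
    unfolding cost_def by (simp add: sum_list_sum_nth atLeast0LessThan eq)
  finally show ?thesis .
qed

definition fin_span_closure :: "(real \<Rightarrow> real) set" where
  "fin_span_closure = {y. y \<in> borel_measurable borel \<and> L1in y \<and>
     (\<exists>x. (\<forall>n. x n \<in> fin_span) \<and> (\<lambda>n. L1norm (\<lambda>t. x n t - y t)) \<longlonglongrightarrow> 0)}"

lemma fin_span_scale: "x \<in> fin_span \<Longrightarrow> (\<lambda>t. c * x t) \<in> fin_span"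
  unfolding fin_span_def by (force simp: comb_scale[symmetric])

lemma fin_span_add:
  assumes "x \<in> fin_span" "y \<in> fin_span" shows "(\<lambda>t. x t + y t) \<in> fin_span"
proof -
  obtain S c where x: "finite S" "S \<subseteq> I" "x = comb e S c" using assms(1) by (auto simp: fin_span_def)
  obtain S' c' where y: "finite S'" "S' \<subseteq> I" "y = comb e S' c'" using assms(2) by (auto simp: fin_span_def)
  have 1: "comb e (S \<union> S') (\<lambda>j. if j \<in> S then c j else 0) t = x t" for t
    unfolding comb_def x using x y by (intro sum.mono_neutral_cong_right) auto
  have 2: "comb e (S \<union> S') (\<lambda>j. if j \<in> S' then c' j else 0) t = y t" for t
    unfolding comb_def y using x y by (intro sum.mono_neutral_cong_right) auto
  have "(\<lambda>t. x t + y t) = comb e (S \<union> S') (\<lambda>j. (if j \<in> S then c j else 0) + (if j \<in> S' then c' j else 0))"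
    unfolding comb_add 1 2 ..
  then show ?thesis using x y unfolding fin_span_def by blast
qed

lemma L1in_fin_span: "x \<in> fin_span \<Longrightarrow> L1in x"
  using L1in_comb by (auto simp: fin_span_def)

lemma fin_span_closure_scale:
  assumes "y \<in> fin_span_closure" shows "(\<lambda>t. c * y t) \<in> fin_span_closure"
proof -
  obtain x where y: "y \<in> borel_measurable borel" "L1in y"
    and x: "\<And>n. x n \<in> fin_span" "(\<lambda>n. L1norm (\<lambda>t. x n t - y t)) \<longlonglongrightarrow> 0"
    using assms by (auto simp: fin_span_closure_def)
  have "(\<lambda>n. L1norm (\<lambda>t. c * x n t - c * y t)) \<longlonglongrightarrow> 0"
    using tendsto_mult_left[OF x(2), of "\<bar>c\<bar>"] by (simp add: L1norm_scale flip: right_diff_distrib)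
  then show ?thesis
    using y fin_span_scale[OF x(1), of c] unfolding fin_span_closure_def L1in_def
    by (auto intro!: exI[of _ "\<lambda>n t. c * x n t"])
qed

lemma fin_span_closure_add:
  assumes "y \<in> fin_span_closure" "z \<in> fin_span_closure" shows "(\<lambda>t. y t + z t) \<in> fin_span_closure"
proof -
  obtain u where y: "y \<in> borel_measurable borel" "L1in y"
    and u: "\<And>n. u n \<in> fin_span" "(\<lambda>n. L1norm (\<lambda>t. u n t - y t)) \<longlonglongrightarrow> 0"
    using assms(1) by (auto simp: fin_span_closure_def)
  obtain v where z: "z \<in> borel_measurable borel" "L1in z"
    and v: "\<And>n. v n \<in> fin_span" "(\<lambda>n. L1norm (\<lambda>t. v n t - z t)) \<longlonglongrightarrow> 0"
    using assms(2) by (auto simp: fin_span_closure_def)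
  have lim: "(\<lambda>n. L1norm (\<lambda>t. u n t - y t) + L1norm (\<lambda>t. v n t - z t)) \<longlonglongrightarrow> 0"
    using u v by (intro tendsto_add_zero)
  have "(\<lambda>n. L1norm (\<lambda>t. (u n t + v n t) - (y t + z t))) \<longlonglongrightarrow> 0"
  proof (rule Lim_null_comparison[OF _ lim], intro always_eventually allI)
    fix n
    have "L1norm (\<lambda>t. (u n t + v n t) - (y t + z t)) = L1norm (\<lambda>t. (u n t - y t) + (v n t - z t))"
      by (simp add: algebra_simps)
    also have "\<dots> \<le> L1norm (\<lambda>t. u n t - y t) + L1norm (\<lambda>t. v n t - z t)"
      using L1in_fin_span[OF u(1)] L1in_fin_span[OF v(1)] y z by (intro L1norm_triangle) (auto simp: L1in_def)
    finally show "norm (L1norm (\<lambda>t. (u n t + v n t) - (y t + z t)))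
        \<le> L1norm (\<lambda>t. u n t - y t) + L1norm (\<lambda>t. v n t - z t)" by simp
  qed
  then show ?thesis
    using y z fin_span_add[OF u(1) v(1)] unfolding fin_span_closure_def L1in_def
    by (auto intro!: exI[of _ "\<lambda>n t. u n t + v n t"])
qed

text \<open>Both sides are continuous in L1, the left one because the maximum with \<open>g\<close>
  is 1-Lipschitz. The factor \<open>l\<close> needs no separate argument, as \<open>l * y\<close>
  again lies in the closure.\<close>

lemma domination_closure:
  assumes y: "y \<in> fin_span_closure" and g: "L1in g"
    and dom: "\<And>x. x \<in> fin_span \<Longrightarrow> integral\<^sup>L L1M (\<lambda>t. max \<bar>x t\<bar> (g t)) \<le> integral\<^sup>L L1M g + L1norm x powr p"
    and p: "0 < p" and l: "0 \<le> l"
  shows "integral\<^sup>L L1M (\<lambda>t. max (l * \<bar>y t\<bar>) (g t)) \<le> integral\<^sup>L L1M g + (l * L1norm y) powr p"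
proof -
  define z where "z t = l * y t" for t
  have "z \<in> fin_span_closure" unfolding z_def[abs_def] by (rule fin_span_closure_scale[OF y])
  then obtain x where z: "L1in z"
    and x: "\<And>n. x n \<in> fin_span" "(\<lambda>n. L1norm (\<lambda>t. x n t - z t)) \<longlonglongrightarrow> 0"
    by (auto simp: fin_span_closure_def)
  have xi: "integrable L1M (x n)" for n using L1in_fin_span[OF x(1)] by (simp add: L1in_def)
  have zi: "integrable L1M z" and gi: "integrable L1M g" using z g by (simp_all add: L1in_def)
  have ineq: "integral\<^sup>L L1M (\<lambda>t. max \<bar>z t\<bar> (g t))
      \<le> integral\<^sup>L L1M g + L1norm (x n) powr p + L1norm (\<lambda>t. x n t - z t)" for n
  proof -
    have "integral\<^sup>L L1M (\<lambda>t. max \<bar>z t\<bar> (g t)) \<le> integral\<^sup>L L1M (\<lambda>t. max \<bar>x n t\<bar> (g t) + \<bar>x n t - z t\<bar>)"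
      using xi zi gi
      by (intro integral_mono Bochner_Integration.integrable_add integrable_max integrable_abs
        Bochner_Integration.integrable_diff) auto
    also have "\<dots> = integral\<^sup>L L1M (\<lambda>t. max \<bar>x n t\<bar> (g t)) + L1norm (\<lambda>t. x n t - z t)"
      unfolding L1norm_def using xi zi gi
      by (intro Bochner_Integration.integral_add integrable_max integrable_abs Bochner_Integration.integrable_diff) auto
    finally show ?thesis using dom[OF x(1), of n] by linarith
  qed
  have "(\<lambda>n. L1norm (x n)) \<longlonglongrightarrow> L1norm z"
    by (rule L1norm_tendsto[OF L1in_fin_span[OF x(1)] z x(2)])
  then have "(\<lambda>n. integral\<^sup>L L1M g + L1norm (x n) powr p + L1norm (\<lambda>t. x n t - z t))
      \<longlonglongrightarrow> integral\<^sup>L L1M g + L1norm z powr p + 0"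
    using p by (intro tendsto_add tendsto_const x(2) tendsto_powr' ) auto
  from LIMSEQ_le_const[OF this, of "integral\<^sup>L L1M (\<lambda>t. max \<bar>z t\<bar> (g t))"] ineq
  have "integral\<^sup>L L1M (\<lambda>t. max \<bar>z t\<bar> (g t)) \<le> integral\<^sup>L L1M g + L1norm z powr p" by auto
  then show ?thesis using l by (simp add: z_def[abs_def] abs_mult L1norm_scale)
qed

end

section \<open>Change of density and the embeddings\<close>

lemma psum_cong: "(\<And>k. k \<in> I \<Longrightarrow> c k = c' k) \<Longrightarrow> psum e I c = psum e I c'"
  unfolding psum_def by (intro ext, subst comb_cong[of _ c c']) auto

text \<open>The first factor is the bound on the integral of the dominating function, raised to
  \<open>r - 1\<close>; the constant \<open>2 * K\<close> in it is that of type p. The second factor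
  is the weighted bound for r-th powers, and the root \<open>1 / r\<close> turns the product into a
  bound for the L_r norm.\<close>

definition density_const :: "real \<Rightarrow> real \<Rightarrow> real \<Rightarrow> real" where
  "density_const r p K =
    ((1 + \<bar>2 * K\<bar> * (\<bar>2 * K\<bar> powr (p / (p - 1))) powr (1 / p)) powr (r - 1) * weight_const r p) powr (1 / r)"

context unconditional_seq
begin

lemma change_of_density:
  assumes conv: "p_convex p K e I" and p: "1 < p" "p \<le> 2" and r: "1 \<le> r" "r < p"
  obtains \<mu> d where "prob_on_01 \<mu>" "d \<in> borel_measurable borel" "\<And>t. 0 < d t"
    "\<And>y. y \<in> fin_span_closure \<Longrightarrow> integrable \<mu> (\<lambda>t. y t / d t)"
    "\<And>y. y \<in> fin_span_closure \<Longrightarrow> Lnorm1 \<mu> (\<lambda>t. y t / d t) = L1norm y"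
    "\<And>y. y \<in> fin_span_closure \<Longrightarrow> integrable \<mu> (\<lambda>t. \<bar>y t / d t\<bar> powr r)"
    "\<And>y. y \<in> fin_span_closure \<Longrightarrow>
      (integral\<^sup>L \<mu> (\<lambda>t. \<bar>y t / d t\<bar> powr r)) powr (1 / r) \<le> density_const r p K * L1norm y"
proof -
  interpret L: prob_space L1B by (rule prob_space_L1B)
  define M0 where "M0 = 1 + \<bar>2 * K\<bar> * (\<bar>2 * K\<bar> powr (p / (p - 1))) powr (1 / p)"
  have bound: "integral\<^sup>L L1M (envelope xs) \<le> 1 + 2 * K * cost p xs powr (1 / p)" if "set xs \<subseteq> fin_span" for xs
    using p by (intro envelope_fin_span_bound[OF conv _ _ that]) auto
  obtain g where g: "g \<in> borel_measurable borel" "L1in g" "\<And>t. 1 \<le> g t" "integral\<^sup>L L1M g \<le> M0"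
    and dom: "\<And>x. x \<in> fin_span \<Longrightarrow> integral\<^sup>L L1M (\<lambda>t. max \<bar>x t\<bar> (g t)) \<le> integral\<^sup>L L1M g + L1norm x powr p"
  proof (rule dominating_function[OF p(1) L1in_fin_span bound])
    fix g
    assume g: "g \<in> borel_measurable borel" "L1in g" "\<And>t. 1 \<le> g t"
      "integral\<^sup>L L1M g \<le> 1 + \<bar>2 * K\<bar> * (\<bar>2 * K\<bar> powr (p / (p - 1))) powr (1 / p)"
      "\<And>x. x \<in> fin_span \<Longrightarrow> integral\<^sup>L L1M (\<lambda>t. max \<bar>x t\<bar> (g t)) \<le> integral\<^sup>L L1M g + L1norm x powr p"
    show thesis by (rule that[OF g(1-3) g(4)[folded M0_def] g(5)])
  qed
  have g0: "0 < g t" for t using g(3)[of t] by simp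
  have gB [measurable]: "g \<in> borel_measurable L1B" using g(1) by (rule borel_measurable_L1B)
  have giB: "integrable L1B g" using g(2) integrable_L1M_iff[OF gB] by (simp add: L1in_def)
  define m where "m = integral\<^sup>L L1B g"
  have m_eq: "m = integral\<^sup>L L1M g" unfolding m_def using integral_L1M_eq[OF gB] by simp
  have "integral\<^sup>L L1B (\<lambda>t. 1) \<le> m" unfolding m_def using giB g(3) by (intro integral_mono) auto
  then have m: "1 \<le> m" "m \<le> M0" using L.prob_space g(4) m_eq by auto
  \<comment> \<open>The integral \<open>m\<close> is at least 1 since \<open>g\<close> is, so
    normalization is legitimate. Positivity of \<open>d\<close> everywhere makes division by
    \<open>d\<close> a linear map on functions that loses no information.\<close>
  define d where "d t = g t / m" for t
  have d: "d \<in> borel_measurable borel" unfolding d_def[abs_def] using g(1) by measurable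
  then have dB [measurable]: "d \<in> borel_measurable L1B" by (rule borel_measurable_L1B)
  have d0: "0 < d t" for t using g0[of t] m by (simp add: d_def)
  have d_int: "integrable L1B d" "integral\<^sup>L L1B d = 1"
    using giB m by (simp_all add: d_def[abs_def] m_def[symmetric])
  define \<mu> where "\<mu> = density L1B (\<lambda>t. ennreal (d t))"
  have "prob_space \<mu>"
  proof (rule prob_spaceI)
    have "emeasure \<mu> (space \<mu>) = (\<integral>\<^sup>+t. ennreal (d t) \<partial>L1B)"
      unfolding \<mu>_def by (subst emeasure_density) (auto intro!: nn_integral_cong simp del: space_L1B)
    also have "\<dots> = 1"
      using d_int d0 by (subst nn_integral_eq_integral) (auto intro: less_imp_le)
    finally show "emeasure \<mu> (space \<mu>) = 1" .
  qed
  then have \<mu>: "prob_on_01 \<mu>" by (simp add: prob_on_01_def \<mu>_def sets_L1B)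
  have dens: "integrable \<mu> f \<longleftrightarrow> integrable L1B (\<lambda>t. d t * f t)" "integral\<^sup>L \<mu> f = integral\<^sup>L L1B (\<lambda>t. d t * f t)"
    if "f \<in> borel_measurable L1B" for f :: "real \<Rightarrow> real"
    unfolding \<mu>_def using that d0 dB
    by (simp_all add: integrable_density integral_density less_imp_le)
  have main: "integrable \<mu> (\<lambda>t. y t / d t)" "Lnorm1 \<mu> (\<lambda>t. y t / d t) = L1norm y"
    "integrable \<mu> (\<lambda>t. \<bar>y t / d t\<bar> powr r)"
    "(integral\<^sup>L \<mu> (\<lambda>t. \<bar>y t / d t\<bar> powr r)) powr (1 / r) \<le> density_const r p K * L1norm y"
    if y: "y \<in> fin_span_closure" for y
  proof -
    have yb: "y \<in> borel_measurable borel" and yL: "L1in y" using y by (auto simp: fin_span_closure_def)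
    have yB [measurable]: "y \<in> borel_measurable L1B" using yb by (rule borel_measurable_L1B)
    have yi: "integrable L1B y" using yL integrable_L1M_iff[OF yB] by (simp add: L1in_def)
    have dne: "d t \<noteq> 0" for t using d0[of t] by simp
    have qB: "(\<lambda>t. y t / d t) \<in> borel_measurable L1B" by measurable
    then have aqB: "(\<lambda>t. \<bar>y t / d t\<bar>) \<in> borel_measurable L1B" by measurable
    show "integrable \<mu> (\<lambda>t. y t / d t)" unfolding dens(1)[OF qB] using yi dne by simp
    have "d t * \<bar>y t / d t\<bar> = \<bar>y t\<bar>" for t using d0[of t] by (simp add: abs_divide)
    then show "Lnorm1 \<mu> (\<lambda>t. y t / d t) = L1norm y"
      unfolding Lnorm1_def dens(2)[OF aqB] L1norm_eq_L1B[OF yB] by simp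
    \<comment> \<open>Normalization contributes \<open>m\<close> to the power \<open>r - 1\<close>,
      which is nonnegative; hence an upper bound on \<open>m\<close> suffices.\<close>
    have eq: "d t * \<bar>y t / d t\<bar> powr r = m powr (r - 1) * (\<bar>y t\<bar> powr r * g t powr (1 - r))" for t
    proof -
      have "d t * \<bar>y t / d t\<bar> powr r = \<bar>y t\<bar> powr r * (d t powr 1 / d t powr r)"
        using d0[of t] by (simp add: abs_divide powr_divide)
      also have "d t powr 1 / d t powr r = d t powr (1 - r)" by (rule powr_diff[symmetric])
      also have "d t powr (1 - r) = g t powr (1 - r) / m powr (1 - r)"
        unfolding d_def using g0[of t] m by (simp add: powr_divide)
      also have "\<dots> = m powr (r - 1) * g t powr (1 - r)"
        using powr_minus_divide[of m "1 - r"] by simp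
      finally show ?thesis by simp
    qed
    have W: "integrable L1M (\<lambda>t. \<bar>y t\<bar> powr r * g t powr (1 - r))"
      "integral\<^sup>L L1M (\<lambda>t. \<bar>y t\<bar> powr r * g t powr (1 - r)) \<le> weight_const r p * L1norm y powr r"
    proof -
      have dom': "integral\<^sup>L L1M (\<lambda>t. max (l * \<bar>y t\<bar>) (g t)) \<le> integral\<^sup>L L1M g + (l * L1norm y) powr p" if "0 \<le> l" for l
        by (rule domination_closure[OF y g(2) dom _ that]) (use p in auto)
      show "integrable L1M (\<lambda>t. \<bar>y t\<bar> powr r * g t powr (1 - r))"
        by (rule weighted_powr_bound(1)[OF r g(1-3) yL dom'])
      show "integral\<^sup>L L1M (\<lambda>t. \<bar>y t\<bar> powr r * g t powr (1 - r)) \<le> weight_const r p * L1norm y powr r"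
        by (rule weighted_powr_bound(2)[OF r g(1-3) yL dom'])
    qed
    have wB: "(\<lambda>t. \<bar>y t\<bar> powr r * g t powr (1 - r)) \<in> borel_measurable L1B" by measurable
    have ydB: "(\<lambda>t. \<bar>y t / d t\<bar> powr r) \<in> borel_measurable L1B" by measurable
    show "integrable \<mu> (\<lambda>t. \<bar>y t / d t\<bar> powr r)"
      unfolding dens(1)[OF ydB] eq using W(1) integrable_L1M_iff[OF wB] by simp
    have "integral\<^sup>L \<mu> (\<lambda>t. \<bar>y t / d t\<bar> powr r)
        = m powr (r - 1) * integral\<^sup>L L1M (\<lambda>t. \<bar>y t\<bar> powr r * g t powr (1 - r))"
      unfolding dens(2)[OF ydB] eq integral_L1M_eq[OF wB] by simp
    also have "\<dots> \<le> M0 powr (r - 1) * (weight_const r p * L1norm y powr r)"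
      using m r W(2) by (intro mult_mono powr_mono2) auto
    finally have "(integral\<^sup>L \<mu> (\<lambda>t. \<bar>y t / d t\<bar> powr r)) powr (1 / r)
        \<le> ((M0 powr (r - 1) * weight_const r p) * L1norm y powr r) powr (1 / r)"
      using r by (intro powr_mono2) (auto simp: mult.assoc)
    also have "\<dots> = density_const r p K * L1norm y"
    proof -
      have "0 \<le> weight_const r p"
        using r powr_less_mono[of "r - p" 0 2] by (auto simp: weight_const_def)
      then show ?thesis
        using r unfolding density_const_def M0_def[symmetric] by (simp add: powr_mult powr_powr)
    qed
    finally show "(integral\<^sup>L \<mu> (\<lambda>t. \<bar>y t / d t\<bar> powr r)) powr (1 / r) \<le> density_const r p K * L1norm y" .
  qed
  show ?thesis by (rule that[OF \<mu> d d0 main])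
qed

text \<open>Sums of convergent series are realized by Borel functions that depend linearly on the
  coefficients. This is needed to send the rows of a matrix linearly into the closed span; for
  divergent series only linearity is claimed.\<close>

lemma linear_sum:
  obtains \<Sigma> where "\<And>a b. \<Sigma> (\<lambda>i. a i + b i) = (\<lambda>t. \<Sigma> a t + \<Sigma> b t)" "\<And>c a. \<Sigma> (\<lambda>i. c * a i) = (\<lambda>t. c * \<Sigma> a t)"
    "\<And>a. series_conv e I a \<Longrightarrow> \<Sigma> a \<in> fin_span_closure"
    "\<And>a. series_conv e I a \<Longrightarrow> L1norm (\<Sigma> a) = series_norm e I a"
proof -
  define R where "R a y \<longleftrightarrow> y \<in> borel_measurable borel \<and> L1in y \<and>
    (\<lambda>n. L1norm (\<lambda>t. psum e I a n t - y t)) \<longlonglongrightarrow> 0" for a y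
  obtain \<Sigma> where \<Sigma>: "\<And>a b. \<Sigma> (\<lambda>i. a i + b i) = (\<lambda>t. \<Sigma> a t + \<Sigma> b t)" "\<And>c a. \<Sigma> (\<lambda>i. c * a i) = (\<lambda>t. c * \<Sigma> a t)"
    "\<And>a y. R a y \<Longrightarrow> R a (\<Sigma> a)"
  proof (rule linear_selection_seq[of R])
    show "R (\<lambda>i. 0) (\<lambda>t. 0)" by (simp add: R_def L1in_def psum_def comb_def)
  next
    fix a b u v assume a: "R a u" and b: "R b v"
    have lim: "(\<lambda>n. L1norm (\<lambda>t. psum e I a n t - u t) + L1norm (\<lambda>t. psum e I b n t - v t)) \<longlonglongrightarrow> 0"
      using a b by (intro tendsto_add_zero) (auto simp: R_def)
    have "(\<lambda>n. L1norm (\<lambda>t. psum e I (\<lambda>i. a i + b i) n t - (u t + v t))) \<longlonglongrightarrow> 0"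
    proof (rule Lim_null_comparison[OF _ lim], intro always_eventually allI)
      fix n
      have "L1norm (\<lambda>t. psum e I (\<lambda>i. a i + b i) n t - (u t + v t))
          = L1norm (\<lambda>t. (psum e I a n t - u t) + (psum e I b n t - v t))"
        by (simp add: psum_def comb_add algebra_simps)
      also have "\<dots> \<le> L1norm (\<lambda>t. psum e I a n t - u t) + L1norm (\<lambda>t. psum e I b n t - v t)"
        using a b L1in_psum[of a n] L1in_psum[of b n] by (intro L1norm_triangle) (auto simp: R_def L1in_def)
      finally show "norm (L1norm (\<lambda>t. psum e I (\<lambda>i. a i + b i) n t - (u t + v t)))
          \<le> L1norm (\<lambda>t. psum e I a n t - u t) + L1norm (\<lambda>t. psum e I b n t - v t)" by simp
    qed
    then show "R (\<lambda>i. a i + b i) (\<lambda>t. u t + v t)" using a b by (auto simp: R_def L1in_def)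
  next
    fix c a u assume a: "R a u"
    have "(\<lambda>t. psum e I (\<lambda>i. c * a i) n t - c * u t) = (\<lambda>t. c * (psum e I a n t - u t))" for n
      by (simp add: psum_def comb_scale algebra_simps)
    then show "R (\<lambda>i. c * a i) (\<lambda>t. c * u t)"
      using a tendsto_mult_left[of _ 0 sequentially "\<bar>c\<bar>"]
      by (simp add: R_def L1in_def L1norm_scale borel_measurable_times)
  qed blast
  have R: "R a (\<Sigma> a)" if conv: "series_conv e I a" for a
  proof -
    obtain h where h: "L1in h" "(\<lambda>n. L1norm (\<lambda>t. psum e I a n t - h t)) \<longlonglongrightarrow> 0"
      using conv by (auto simp: series_conv_def)
    have hm: "h \<in> borel_measurable L1M" using h(1) unfolding L1in_def by auto
    from borel_version[OF this] obtain y where y: "y \<in> borel_measurable borel" "AE t in L1M. y t = h t" by blast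
    have ym: "y \<in> borel_measurable L1M" by (intro measurable_L1M_if_L1B borel_measurable_L1B y)
    have pm: "psum e I a n \<in> borel_measurable L1M" for n using L1in_psum[of a n] unfolding L1in_def by auto
    have "integrable L1M y \<longleftrightarrow> integrable L1M h" using y(2) ym hm by (intro integrable_cong_AE) auto
    then have "L1in y" using h by (simp add: L1in_def)
    moreover have "L1norm (\<lambda>t. psum e I a n t - y t) = L1norm (\<lambda>t. psum e I a n t - h t)" for n
      using y(2) ym hm pm by (intro L1norm_cong_AE borel_measurable_diff) auto
    ultimately have "R a y" using y(1) h(2) by (simp add: R_def)
    then show ?thesis by (rule \<Sigma>(3))
  qed
  show ?thesis
  proof (rule that[OF \<Sigma>(1,2)])
    fix a assume conv: "series_conv e I a"
    have "psum e I a n \<in> fin_span" for n unfolding psum_def fin_span_def by blast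
    then show "\<Sigma> a \<in> fin_span_closure" using R[OF conv] by (auto simp: fin_span_closure_def R_def)
    have "(\<lambda>n. L1norm (psum e I a n)) \<longlonglongrightarrow> L1norm (\<Sigma> a)"
      using R[OF conv] by (intro L1norm_tendsto L1in_psum) (auto simp: R_def)
    then show "L1norm (\<Sigma> a) = series_norm e I a"
      using series_norm_lim[OF conv] by (rule LIMSEQ_unique)
  qed
qed

end

text \<open>Each row is summed in the closed span of \<open>f\<close> and divided by
  \<open>d\<close>, which preserves its L1 norm. The matrix therefore has the same norm as its image
  in the direct sum, and the constant is that of the direct sum with
  \<open>density_const r p K2\<close> in place of the L_r bound.\<close>

lemma EF_embedding:
  assumes r: "1 \<le> r" and p: "r < p" "p \<le> 2" and e: "unc_basic_seq e I" and f: "unc_basic_seq f J"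
    and conc: "r_concave r K1 e I" and conv: "p_convex p K2 f J"
  obtains T where "\<And>A B. T (\<lambda>k l. A k l + B k l) = (\<lambda>t. T A t + T B t)"
    "\<And>c A. T (\<lambda>k l. c * A k l) = (\<lambda>t. c * T A t)"
    "\<And>A. A \<in> EF_space e I f J \<Longrightarrow> L1in (T A)"
    "\<And>A. A \<in> EF_space e I f J \<Longrightarrow> EF_norm e I f J A \<le> L1norm (T A)"
    "\<And>A. A \<in> EF_space e I f J \<Longrightarrow> L1norm (T A) \<le> (1 + \<bar>K1\<bar> * \<bar>density_const r p K2\<bar>) * EF_norm e I f J A"
proof -
  interpret F: unconditional_seq f J
    using f by unfold_locales (auto simp: unc_basic_seq_def basic_seq_def)
  have p1: "1 < p" using r p by simp
  obtain \<mu> d where \<mu>: "prob_on_01 \<mu>" "d \<in> borel_measurable borel" "\<And>t. 0 < d t"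
    and D: "\<And>y. y \<in> F.fin_span_closure \<Longrightarrow> integrable \<mu> (\<lambda>t. y t / d t)"
    "\<And>y. y \<in> F.fin_span_closure \<Longrightarrow> Lnorm1 \<mu> (\<lambda>t. y t / d t) = L1norm y"
    "\<And>y. y \<in> F.fin_span_closure \<Longrightarrow> integrable \<mu> (\<lambda>t. \<bar>y t / d t\<bar> powr r)"
    "\<And>y. y \<in> F.fin_span_closure \<Longrightarrow>
      (integral\<^sup>L \<mu> (\<lambda>t. \<bar>y t / d t\<bar> powr r)) powr (1 / r) \<le> density_const r p K2 * L1norm y"
    using F.change_of_density[OF conv p1 p(2) r p(1)] by blast
  define X where "X = (\<lambda>y t. y t / d t) ` F.fin_span_closure"
  have subspace: "lin_subspace_L1 \<mu> X"
    unfolding lin_subspace_L1_def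
  proof (intro conjI ballI allI)
    show "integrable \<mu> x" if "x \<in> X" for x using that D(1) by (auto simp: X_def)
    show "(\<lambda>t. x t + y t) \<in> X" if xy: "x \<in> X" "y \<in> X" for x y
    proof -
      obtain u v where "u \<in> F.fin_span_closure" "v \<in> F.fin_span_closure" "x = (\<lambda>t. u t / d t)" "y = (\<lambda>t. v t / d t)"
        using xy by (auto simp: X_def)
      then show ?thesis
        unfolding X_def by (intro image_eqI[OF _ F.fin_span_closure_add[of u v]]) (auto simp: add_divide_distrib)
    qed
    show "(\<lambda>t. c * x t) \<in> X" if x: "x \<in> X" for c x
    proof -
      obtain u where "u \<in> F.fin_span_closure" "x = (\<lambda>t. u t / d t)" using x by (auto simp: X_def)
      then show ?thesis
        unfolding X_def by (intro image_eqI[OF _ F.fin_span_closure_scale[of u c]]) auto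
    qed
    have "(\<lambda>t. 0) \<in> F.fin_span" unfolding F.fin_span_def comb_def by (auto intro!: exI[of _ "{}"])
    then have "(\<lambda>t. 0) \<in> F.fin_span_closure"
      unfolding F.fin_span_closure_def L1in_def by (auto intro!: exI[of _ "\<lambda>n t. 0"])
    then show "(\<lambda>t. 0) \<in> X" unfolding X_def by (rule image_eqI[rotated]) simp
  qed
  obtain T where T: "\<And>x y. T (\<lambda>i t. x i t + y i t) = (\<lambda>t. T x t + T y t)"
    "\<And>c x. T (\<lambda>i t. c * x i t) = (\<lambda>t. c * T x t)"
    "\<And>x. x \<in> dsum_space e I \<mu> X \<Longrightarrow> L1in (T x)"
    "\<And>x. x \<in> dsum_space e I \<mu> X \<Longrightarrow> dsum_norm e I \<mu> x \<le> L1norm (T x)"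
    "\<And>x. x \<in> dsum_space e I \<mu> X \<Longrightarrow> L1norm (T x) \<le> (1 + \<bar>K1\<bar> * \<bar>density_const r p K2\<bar>) * dsum_norm e I \<mu> x"
  proof (rule dsum_embedding[OF r e conc \<mu>(1) subspace])
    show "integrable \<mu> (\<lambda>t. \<bar>x t\<bar> powr r)"
      "(integral\<^sup>L \<mu> (\<lambda>t. \<bar>x t\<bar> powr r)) powr (1/r) \<le> density_const r p K2 * Lnorm1 \<mu> x" if "x \<in> X" for x
      using that D(2-4) by (auto simp: X_def)
  qed blast
  obtain \<Sigma> where \<Sigma>: "\<And>a b. \<Sigma> (\<lambda>i. a i + b i) = (\<lambda>t. \<Sigma> a t + \<Sigma> b t)" "\<And>c a. \<Sigma> (\<lambda>i. c * a i) = (\<lambda>t. c * \<Sigma> a t)"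
    "\<And>a. series_conv f J a \<Longrightarrow> \<Sigma> a \<in> F.fin_span_closure"
    "\<And>a. series_conv f J a \<Longrightarrow> L1norm (\<Sigma> a) = series_norm f J a"
    using F.linear_sum by blast
  \<comment> \<open>Entries outside \<open>I\<close> are the zero function, as membership in
    \<open>dsum_space\<close> demands; the case distinction does not depend on \<open>A\<close>, so
    \<open>\<Phi>\<close> stays linear.\<close>
  define \<Phi> where "\<Phi> A = (\<lambda>k t. if k \<in> I then \<Sigma> (A k) t / d t else 0)" for A :: "nat \<Rightarrow> nat \<Rightarrow> real"
  have \<Phi>: "\<Phi> A \<in> dsum_space e I \<mu> X" "dsum_norm e I \<mu> (\<Phi> A) = EF_norm e I f J A"
    if A: "A \<in> EF_space e I f J" for A
  proof -
    have row: "series_conv f J (A k)" if "k \<in> I" for k using A that by (simp add: EF_space_def)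
    have "Lnorm1 \<mu> (\<Phi> A k) = series_norm f J (A k)" if "k \<in> I" for k
      using row[OF that] that by (simp add: \<Phi>_def D(2) \<Sigma>(3,4))
    then have ps: "psum e I (\<lambda>k. Lnorm1 \<mu> (\<Phi> A k)) = psum e I (\<lambda>k. series_norm f J (A k))"
      by (rule psum_cong)
    then have "series_conv e I (\<lambda>k. Lnorm1 \<mu> (\<Phi> A k))"
      using A by (simp add: EF_space_def series_conv_def)
    moreover have "\<Phi> A k \<in> X" if "k \<in> I" for k
      using \<Sigma>(3)[OF row[OF that]] that by (simp add: \<Phi>_def X_def)
    ultimately show "\<Phi> A \<in> dsum_space e I \<mu> X"
      by (auto simp: dsum_space_def \<Phi>_def)
    show "dsum_norm e I \<mu> (\<Phi> A) = EF_norm e I f J A"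
      using ps by (simp add: dsum_norm_def EF_norm_def series_norm_def)
  qed
  show ?thesis
  proof (rule that[of "\<lambda>A. T (\<Phi> A)"])
    fix A B :: "nat \<Rightarrow> nat \<Rightarrow> real"
    have "\<Phi> (\<lambda>k l. A k l + B k l) = (\<lambda>k t. \<Phi> A k t + \<Phi> B k t)"
      by (simp add: \<Phi>_def \<Sigma>(1) add_divide_distrib fun_eq_iff)
    then show "T (\<Phi> (\<lambda>k l. A k l + B k l)) = (\<lambda>t. T (\<Phi> A) t + T (\<Phi> B) t)" by (simp add: T(1))
  next
    fix c and A :: "nat \<Rightarrow> nat \<Rightarrow> real"
    have "\<Phi> (\<lambda>k l. c * A k l) = (\<lambda>k t. c * \<Phi> A k t)"
      by (simp add: \<Phi>_def \<Sigma>(2) fun_eq_iff)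
    then show "T (\<Phi> (\<lambda>k l. c * A k l)) = (\<lambda>t. c * T (\<Phi> A) t)" by (simp add: T(2))
  next
    fix A assume A: "A \<in> EF_space e I f J"
    show "L1in (T (\<Phi> A))" by (rule T(3)[OF \<Phi>(1)[OF A]])
    show "EF_norm e I f J A \<le> L1norm (T (\<Phi> A))"
      using T(4)[OF \<Phi>(1)[OF A]] by (simp add: \<Phi>(2)[OF A])
    show "L1norm (T (\<Phi> A)) \<le> (1 + \<bar>K1\<bar> * \<bar>density_const r p K2\<bar>) * EF_norm e I f J A"
      using T(5)[OF \<Phi>(1)[OF A]] by (simp add: \<Phi>(2)[OF A])
  qed
qed

theorem theorem1:
  shows
  "(\<forall>r K1 K2. r \<ge> 1 \<longrightarrow> (\<exists>C>0. \<forall>(e :: nat \<Rightarrow> real \<Rightarrow> real) I \<mu> X.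
      unc_basic_seq e I \<and> r_concave r K1 e I \<and> prob_on_01 \<mu> \<and> lin_subspace_L1 \<mu> X \<and>
      (\<forall>x\<in>X. integrable \<mu> (\<lambda>t. \<bar>x t\<bar> powr r) \<and>
              (integral\<^sup>L \<mu> (\<lambda>t. \<bar>x t\<bar> powr r)) powr (1/r) \<le> K2 * Lnorm1 \<mu> x)
      \<longrightarrow> (\<exists>T a b. a > 0 \<and> b > 0 \<and> b / a \<le> C \<and>
            (\<forall>x\<in>dsum_space e I \<mu> X. \<forall>y\<in>dsum_space e I \<mu> X.
                T (\<lambda>i t. x i t + y i t) = (\<lambda>t. T x t + T y t)) \<and>
            (\<forall>c. \<forall>x\<in>dsum_space e I \<mu> X. T (\<lambda>i t. c * x i t) = (\<lambda>t. c * T x t)) \<and>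
            (\<forall>x\<in>dsum_space e I \<mu> X. L1in (T x) \<and>
                a * dsum_norm e I \<mu> x \<le> L1norm (T x) \<and> L1norm (T x) \<le> b * dsum_norm e I \<mu> x))))
   \<and>
   (\<forall>r p K1 K2. 1 \<le> r \<and> r < p \<and> p \<le> 2 \<longrightarrow> (\<exists>C>0. \<forall>(e :: nat \<Rightarrow> real \<Rightarrow> real) I f J.
      unc_basic_seq e I \<and> unc_basic_seq f J \<and> r_concave r K1 e I \<and> p_convex p K2 f J
      \<longrightarrow> (\<exists>T a b. a > 0 \<and> b > 0 \<and> b / a \<le> C \<and>
            (\<forall>A\<in>EF_space e I f J. \<forall>B\<in>EF_space e I f J.
                T (\<lambda>k l. A k l + B k l) = (\<lambda>t. T A t + T B t)) \<and>
            (\<forall>c. \<forall>A\<in>EF_space e I f J. T (\<lambda>k l. c * A k l) = (\<lambda>t. c * T A t)) \<and>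
            (\<forall>A\<in>EF_space e I f J. L1in (T A) \<and>
                a * EF_norm e I f J A \<le> L1norm (T A) \<and> L1norm (T A) \<le> b * EF_norm e I f J A))))"
proof (intro conjI allI impI)
  fix r K1 K2 :: real assume r: "r \<ge> 1"
  \<comment> \<open>\<open>C\<close> is fixed before the sequence, the measure and the subspace are
    given, so it depends on the constants only. The embedding is used with lower constant 1 and
    upper constant \<open>C\<close>.\<close>
  define C where "C = 1 + \<bar>K1\<bar> * \<bar>K2\<bar>"
  have C: "C > 0" by (simp add: C_def add_pos_nonneg)
  show "\<exists>C>0. \<forall>(e :: nat \<Rightarrow> real \<Rightarrow> real) I \<mu> X.
      unc_basic_seq e I \<and> r_concave r K1 e I \<and> prob_on_01 \<mu> \<and> lin_subspace_L1 \<mu> X \<and>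
      (\<forall>x\<in>X. integrable \<mu> (\<lambda>t. \<bar>x t\<bar> powr r) \<and>
              (integral\<^sup>L \<mu> (\<lambda>t. \<bar>x t\<bar> powr r)) powr (1/r) \<le> K2 * Lnorm1 \<mu> x)
      \<longrightarrow> (\<exists>T a b. a > 0 \<and> b > 0 \<and> b / a \<le> C \<and>
            (\<forall>x\<in>dsum_space e I \<mu> X. \<forall>y\<in>dsum_space e I \<mu> X.
                T (\<lambda>i t. x i t + y i t) = (\<lambda>t. T x t + T y t)) \<and>
            (\<forall>c. \<forall>x\<in>dsum_space e I \<mu> X. T (\<lambda>i t. c * x i t) = (\<lambda>t. c * T x t)) \<and>
            (\<forall>x\<in>dsum_space e I \<mu> X. L1in (T x) \<and>
                a * dsum_norm e I \<mu> x \<le> L1norm (T x) \<and> L1norm (T x) \<le> b * dsum_norm e I \<mu> x))"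
  proof (intro exI[of _ C] conjI C allI impI, elim conjE)
    fix e I \<mu> X
    assume e: "unc_basic_seq e I" "r_concave r K1 e I" "prob_on_01 \<mu>" "lin_subspace_L1 \<mu> X"
      and K2: "\<forall>x\<in>X. integrable \<mu> (\<lambda>t. \<bar>x t\<bar> powr r) \<and>
              (integral\<^sup>L \<mu> (\<lambda>t. \<bar>x t\<bar> powr r)) powr (1/r) \<le> K2 * Lnorm1 \<mu> x"
    note K2' = K2[THEN bspec, THEN conjunct1] K2[THEN bspec, THEN conjunct2]
    obtain T where T: "\<And>x y. T (\<lambda>i t. x i t + y i t) = (\<lambda>t. T x t + T y t)"
      "\<And>c x. T (\<lambda>i t. c * x i t) = (\<lambda>t. c * T x t)"
      "\<And>x. x \<in> dsum_space e I \<mu> X \<Longrightarrow> L1in (T x)"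
      "\<And>x. x \<in> dsum_space e I \<mu> X \<Longrightarrow> dsum_norm e I \<mu> x \<le> L1norm (T x)"
      "\<And>x. x \<in> dsum_space e I \<mu> X \<Longrightarrow> L1norm (T x) \<le> C * dsum_norm e I \<mu> x"
      unfolding C_def using dsum_embedding[OF r e K2'] by blast
    show "\<exists>T a b. a > 0 \<and> b > 0 \<and> b / a \<le> C \<and>
            (\<forall>x\<in>dsum_space e I \<mu> X. \<forall>y\<in>dsum_space e I \<mu> X.
                T (\<lambda>i t. x i t + y i t) = (\<lambda>t. T x t + T y t)) \<and>
            (\<forall>c. \<forall>x\<in>dsum_space e I \<mu> X. T (\<lambda>i t. c * x i t) = (\<lambda>t. c * T x t)) \<and>
            (\<forall>x\<in>dsum_space e I \<mu> X. L1in (T x) \<and>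
                a * dsum_norm e I \<mu> x \<le> L1norm (T x) \<and> L1norm (T x) \<le> b * dsum_norm e I \<mu> x)"
      by - (rule exI[of _ T], rule exI[of _ 1], rule exI[of _ C],
        intro conjI ballI allI C T(1-3,5), simp_all add: T(4))
  qed
next
  fix r p K1 K2 :: real assume rp: "1 \<le> r \<and> r < p \<and> p \<le> 2"
  then have rp': "1 \<le> r" "r < p" "p \<le> 2" by auto
  \<comment> \<open>Here too \<open>C\<close> precedes the choice of both sequences; the change of
    density, which depends on \<open>f\<close>, enters only through the uniform
    \<open>density_const\<close>.\<close>
  define C where "C = 1 + \<bar>K1\<bar> * \<bar>density_const r p K2\<bar>"
  have C: "C > 0" by (simp add: C_def add_pos_nonneg)
  show "\<exists>C>0. \<forall>(e :: nat \<Rightarrow> real \<Rightarrow> real) I f J.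
      unc_basic_seq e I \<and> unc_basic_seq f J \<and> r_concave r K1 e I \<and> p_convex p K2 f J
      \<longrightarrow> (\<exists>T a b. a > 0 \<and> b > 0 \<and> b / a \<le> C \<and>
            (\<forall>A\<in>EF_space e I f J. \<forall>B\<in>EF_space e I f J.
                T (\<lambda>k l. A k l + B k l) = (\<lambda>t. T A t + T B t)) \<and>
            (\<forall>c. \<forall>A\<in>EF_space e I f J. T (\<lambda>k l. c * A k l) = (\<lambda>t. c * T A t)) \<and>
            (\<forall>A\<in>EF_space e I f J. L1in (T A) \<and>
                a * EF_norm e I f J A \<le> L1norm (T A) \<and> L1norm (T A) \<le> b * EF_norm e I f J A))"
  proof (intro exI[of _ C] conjI C allI impI, elim conjE)
    fix e I f J
    assume ef: "unc_basic_seq e I" "unc_basic_seq f J" "r_concave r K1 e I" "p_convex p K2 f J"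
    obtain T where T: "\<And>A B. T (\<lambda>k l. A k l + B k l) = (\<lambda>t. T A t + T B t)"
      "\<And>c A. T (\<lambda>k l. c * A k l) = (\<lambda>t. c * T A t)"
      "\<And>A. A \<in> EF_space e I f J \<Longrightarrow> L1in (T A)"
      "\<And>A. A \<in> EF_space e I f J \<Longrightarrow> EF_norm e I f J A \<le> L1norm (T A)"
      "\<And>A. A \<in> EF_space e I f J \<Longrightarrow> L1norm (T A) \<le> C * EF_norm e I f J A"
      unfolding C_def using EF_embedding[OF rp' ef] by blast
    show "\<exists>T a b. a > 0 \<and> b > 0 \<and> b / a \<le> C \<and>
            (\<forall>A\<in>EF_space e I f J. \<forall>B\<in>EF_space e I f J.
                T (\<lambda>k l. A k l + B k l) = (\<lambda>t. T A t + T B t)) \<and>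
            (\<forall>c. \<forall>A\<in>EF_space e I f J. T (\<lambda>k l. c * A k l) = (\<lambda>t. c * T A t)) \<and>
            (\<forall>A\<in>EF_space e I f J. L1in (T A) \<and>
                a * EF_norm e I f J A \<le> L1norm (T A) \<and> L1norm (T A) \<le> b * EF_norm e I f J A)"
      by - (rule exI[of _ T], rule exI[of _ 1], rule exI[of _ C],
        intro conjI ballI allI C T(1-3,5), simp_all add: T(4))
  qed
qed

end
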